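(* Let $\varepsilon\in(0,1)$ be a small parameter and consider the equation of motion of a charged particle \[ \ddot x = \dot x\times B(x) + E(x),\qquad x(t)\in\mathbb R^3, \] where $B(x)=\nabla\times A(x)$ for a vector potential $A$, $E(x)=-\nabla\phi(x)$ for a scalar potential $\phi:\mathbb R^3\to\mathbb R$ that is bounded from below, and \[ B(x)=\frac1\varepsilon B_1(x) \] with $B_1$ smooth, independent of $\varepsilon$, and $|B_1(x)|\ge 1$ for all $x$. Let the initial values satisfy $|x(0)|\le M_0$ and $|\dot x(0)|\le M_1$ with constants $M_0,M_1$ independent of $\varepsilon$, and let $T>0$ be fixed independently of $\varepsilon$. Apply the modified Boris method with step size $h$: with $\mu^0=\mu(x(0),\dot x(0))$, it computes $x^n\approx x(nh)$ via \[ \frac{x^{n+1}-2x^n+x^{n-1}}{h^2}=v^n\times B(x^n)+E(x^n)-\mu^0\,\nabla|B|(x^n),\qquad v^n=\frac{x^{n+1}-x^{n-1}}{2h}, \] started from the modified initial values $x^0=x(0)$, $v^0=P_\parallel(x^0)\dot x(0)$ (equivalently, $x^1=x^0+hv^0+\tfrac{h^2}{2}\bigl(v^0\times B(x^0)+E(x^0)-\mu^0\nabla|B|(x^0)\bigr)$). Assume the step size satisfies $c_*\varepsilon\le h^2\le C_*\varepsilon$ for some positive constants $c_*,C_*$, and assume the following nondegeneracy condition: for all $(x,v)=(x^n,v^n)$ along the numerical trajectory, the linear maps \[ L_{x,v}:P_\perp(x)\mathbb R^3\to P_\perp(x)\mathbb R^3,\qquad z\mapsto z+\tfrac14 h^2\,P_\perp(x)\bigl(v\times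 B'(x)z\bigr) \] are invertible with inverse bounded independently of $(x,v)$ and of $h,\varepsilon$ with $h^2/\varepsilon\le C_*$. Then for all $n$ with $t_n=nh\le T$, \[ |x^n-x(t_n)|\le Ch^2,\qquad |v^n_\parallel-v_\parallel(t_n)|\le Ch^2,\qquad |v^n_\perp|\le Ch^2, \] where $v^n_\parallel=P_\parallel(x^n)v^n$, $v^n_\perp=P_\perp(x^n)v^n$, $v_\parallel(t)=P_\parallel(x(t))\dot x(t)$, and $C$ is independent of $\varepsilon$, $h$ and $n$ (but depends on $T$, on bounds of derivatives of $B_1$ and $E$, and on $c_*$ and $C_*$).
   Context: $|\cdot|$ is the Euclidean norm. The magnetic moment is $\mu(x,v)=\frac12\frac{|v\times B(x)|^2}{|B(x)|^3}$. For $x\in\mathbb R^3$, $P_\parallel(x)$ denotes the orthogonal projection onto the span of $B(x)$, and $P_\perp(x)=I-P_\parallel(x)$. $B'(x)$ denotes the Jacobian matrix of $B$ at $x$, and $\nabla|B|$ is the gradient of the function $x\mapsto|B(x)|$. *)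

theory Defs
  imports "HOL-Analysis.Analysis"
begin

type_synonym vec3 = "real^3"

fun Ck :: "nat \<Rightarrow> (vec3 \<Rightarrow> 'b::real_normed_vector) \<Rightarrow> bool" where
  "Ck 0 f = continuous_on UNIV f"
| "Ck (Suc k) f = (continuous_on UNIV f \<and> (\<forall>x. f differentiable (at x)) \<and>
      (\<forall>w. Ck k (\<lambda>x. frechet_derivative f (at x) w)))"

definition smooth3 :: "(vec3 \<Rightarrow> 'b::real_normed_vector) \<Rightarrow> bool" where
  "smooth3 f \<longleftrightarrow> (\<forall>k. Ck k f)"

definition jac :: "(vec3 \<Rightarrow> vec3) \<Rightarrow> vec3 \<Rightarrow> vec3 \<Rightarrow> vec3" where
  "jac B x z = frechet_derivative B (at x) z"

definition grad :: "(vec3 \<Rightarrow> real) \<Rightarrow> vec3 \<Rightarrow> vec3" where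
  "grad f x = (THE D. GDERIV f x :> D)"

definition curl :: "(vec3 \<Rightarrow> vec3) \<Rightarrow> vec3 \<Rightarrow> vec3" where
  "curl A x = (\<chi> i. let d = (\<lambda>j k. jac A x (axis j 1) $ k) in
      if i = 1 then d 2 3 - d 3 2 else if i = 2 then d 3 1 - d 1 3 else d 1 2 - d 2 1)"

definition magmom :: "(vec3 \<Rightarrow> vec3) \<Rightarrow> vec3 \<Rightarrow> vec3 \<Rightarrow> real" where
  "magmom B x v = (1/2) * (norm (cross3 v (B x)))\<^sup>2 / (norm (B x)) ^ 3"

definition Ppar :: "(vec3 \<Rightarrow> vec3) \<Rightarrow> vec3 \<Rightarrow> vec3 \<Rightarrow> vec3" where
  "Ppar B x v = ((v \<bullet> B x) / (norm (B x))\<^sup>2) *\<^sub>R B x"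

definition Pperp :: "(vec3 \<Rightarrow> vec3) \<Rightarrow> vec3 \<Rightarrow> vec3 \<Rightarrow> vec3" where
  "Pperp B x v = v - Ppar B x v"

end

theory Submission
  imports Defs
begin

text \<open>
  Let \<open>b = B\<^sub>1/|B\<^sub>1|\<close> and let \<open>m\<close> be the initial magnetic moment divided by \<open>\<epsilon>\<close>. Both the exact and the
  numerical solution are compared with the guiding-center equations \<open>x' = u b(x)\<close>,
  \<open>u' = b(x) \<bullet> (E - m \<nabla>|B\<^sub>1|)(x)\<close>.

  For the exact solution, the fast rotation about \<open>b\<close> is averaged out by explicit correctors: a function
  with vanishing gyro-average is, up to \<open>O(\<epsilon>)\<close>, the time derivative of \<open>\<epsilon>\<close> times a polynomial in \<open>v\<close>. With
  \<open>div B\<^sub>1 = 0\<close> this gives \<open>m + O(\<epsilon>)\<close> for the magnetic moment along the motion and a pair \<open>O(\<epsilon>)\<close>-close to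
  position and parallel velocity that satisfies the trapezoidal rule with defect \<open>O(h\<^sup>3)\<close>.

  For the numerical solution with acceleration \<open>a\<^sub>n\<close>, subtracting two consecutive steps shows that
  \<open>s\<^sub>n = a\<^sub>n - c(x\<^sub>n, v\<^sub>n)\<close>, with a smooth slow acceleration \<open>c\<close>, obeys \<open>s\<^sub>n\<^sub>+\<^sub>1 = - s\<^sub>n + O(h)\<close>; hence \<open>a\<^sub>n\<close> stays
  bounded, which is \<open>v\<^sub>\<perp> = O(\<epsilon>)\<close>. Then \<open>x\<^sub>n + h\<^sup>2/4 a\<^sub>n\<close> and \<open>v\<^sub>n \<bullet> b + h\<^sup>2/4 a\<^sub>n \<bullet> b' v\<^sub>n\<close> satisfy the same trapezoidal
  rule with defect \<open>O(h\<^sup>3)\<close>, and a discrete Gronwall estimate with a bootstrap argument compares the two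
  solutions. Step sizes bounded away from 0 only need bounds for finitely many steps.
\<close>

text \<open>The gyration has a period of order \<epsilon> at most, while \<open>h\<close> is of
  order sqrt(\<epsilon>): a step does not resolve the rotation, so the exact motion cannot be Taylor
  expanded over one step. Each solution is instead turned into a pair without fast terms, and only
  these pairs are compared. The sign flip arises as follows. The scheme says
  \<open>v_n \<times> B_1 = \<epsilon> (a_n - f_n)\<close> with a bounded force \<open>f_n\<close>.
  Subtracting consecutive instances and inserting \<open>v_(n+1) - v_n = h/2 (a_n + a_(n+1))\<close>
  determines \<open>(a_n + a_(n+1)) \<times> B_1\<close> up to \<open>2\<epsilon>/h\<close> times a
  difference of accelerations, and \<open>\<epsilon>/h \<le> h/c_*\<close>. The lower bound on
  \<open>h^2\<close> is thus a stability condition; the upper bound keeps \<epsilon> away from 0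
  when \<open>h\<close> is. The shift by \<open>h^2/4 a_n\<close> comes from the identity
  \<open>x_(n+1) - x_n = h/2 (v_n + v_(n+1)) - h^2/4 (a_(n+1) - a_n)\<close>. Alternating
  accelerations of size 1 would leave a defect of order \<open>h^2\<close> per step, one order too
  much for an error of order \<open>h^2\<close> after \<open>T/h\<close> steps.\<close>

unbundle cross3_syntax

section \<open>Smooth functions\<close>

abbreviation fd :: "(vec3 \<Rightarrow> 'b::real_normed_vector) \<Rightarrow> vec3 \<Rightarrow> vec3 \<Rightarrow> 'b" where
  "fd f x \<equiv> frechet_derivative f (at x)"

lemma Ck_continuous: "Ck k f \<Longrightarrow> continuous_on UNIV f"
  by (cases k) auto

lemma Ck_Suc_imp: "Ck (Suc k) f \<Longrightarrow> Ck k f"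
  by (induction k arbitrary: f) auto

lemma Ck_const: "Ck k (\<lambda>x. c)"
  by (induction k arbitrary: c) auto

lemma Ck_add:
  "Ck k f \<Longrightarrow> Ck k g \<Longrightarrow> Ck k (\<lambda>x. f x + g x)"
proof (induction k arbitrary: f g)
  case (Suc k)
  have "fd (\<lambda>x. f x + g x) x = (\<lambda>w. fd f x w + fd g x w)" for x
    by (rule frechet_derivative_at[symmetric])
       (use Suc.prems frechet_derivative_works in \<open>auto intro!: has_derivative_add\<close>)
  then show ?case using Suc by (auto intro: continuous_on_add)
qed (auto intro: continuous_on_add)

text \<open>An arbitrary bounded bilinear operation covers scalar multiples, inner products and
  cross products at once. The induction closes because the derivative is a sum of two such products,
  each with one factor differentiated.\<close>

lemma Ck_bilinear:
  assumes "bounded_bilinear op2"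
  shows "Ck k f \<Longrightarrow> Ck k g \<Longrightarrow> Ck k (\<lambda>x. op2 (f x) (g x))"
proof (induction k arbitrary: f g)
  case 0
  then show ?case using bounded_bilinear.continuous_on[OF assms] by auto
next
  case (Suc k)
  have der: "((\<lambda>x. op2 (f x) (g x)) has_derivative
      (\<lambda>w. op2 (f x) (fd g x w) + op2 (fd f x w) (g x))) (at x)" for x
    by (rule bounded_bilinear.FDERIV[OF assms])
       (use Suc.prems in \<open>auto simp flip: frechet_derivative_works\<close>)
  note eq = frechet_derivative_at[OF der, symmetric]
  have "Ck k f" "Ck k g" using Suc.prems Ck_Suc_imp by blast+
  then have "Ck k (\<lambda>x. op2 (f x) (fd g x w) + op2 (fd f x w) (g x))" for w
    using Suc by (intro Ck_add Suc.IH) auto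
  moreover have "continuous_on UNIV (\<lambda>x. op2 (f x) (g x))"
    using Suc.prems bounded_bilinear.continuous_on[OF assms] by auto
  moreover have "(\<lambda>x. op2 (f x) (g x)) differentiable at x" for x
    using der differentiable_def by blast
  ultimately show ?case by (simp add: eq)
qed

lemma smooth3_const: "smooth3 (\<lambda>x. c)"
  by (simp add: smooth3_def Ck_const)

lemma smooth3_add: "smooth3 f \<Longrightarrow> smooth3 g \<Longrightarrow> smooth3 (\<lambda>x. f x + g x)"
  by (simp add: smooth3_def Ck_add)

lemma smooth3_bilinear:
  "bounded_bilinear op2 \<Longrightarrow> smooth3 f \<Longrightarrow> smooth3 g \<Longrightarrow> smooth3 (\<lambda>x. op2 (f x) (g x))"
  by (simp add: smooth3_def Ck_bilinear)

lemma bounded_bilinear_cross3: "bounded_bilinear cross3"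
  using bilinear_cross bilinear_conv_bounded_bilinear by blast

lemmas smooth3_scaleR = smooth3_bilinear[OF bounded_bilinear_scaleR]
  and smooth3_mult = smooth3_bilinear[OF bounded_bilinear_mult]
  and smooth3_inner = smooth3_bilinear[OF bounded_bilinear_inner]

lemma smooth3_minus:
  assumes "smooth3 f" shows "smooth3 (\<lambda>x. - f x)"
  using smooth3_scaleR[OF smooth3_const[of "-1::real"] assms] by simp

lemma smooth3_diff: "smooth3 f \<Longrightarrow> smooth3 g \<Longrightarrow> smooth3 (\<lambda>x. f x - g x)"
  using smooth3_add[of f "\<lambda>x. - g x"] by (simp add: smooth3_minus)

lemma smooth3_sum: "(\<And>i. i \<in> A \<Longrightarrow> smooth3 (f i)) \<Longrightarrow> smooth3 (\<lambda>x. \<Sum>i\<in>A. f i x)"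
  by (induction A rule: infinite_finite_induct) (auto intro: smooth3_const smooth3_add)

lemma smooth3_fd: "smooth3 f \<Longrightarrow> smooth3 (\<lambda>x. fd f x w)"
  unfolding smooth3_def by (metis Ck.simps(2))

lemma smooth3_differentiable: "smooth3 f \<Longrightarrow> f differentiable at x"
  unfolding smooth3_def by (metis Ck.simps(2))

lemma smooth3_continuous_on: "smooth3 f \<Longrightarrow> continuous_on S f"
  unfolding smooth3_def using Ck_continuous continuous_on_subset subset_UNIV by metis

lemma smooth3_has_derivative: "smooth3 f \<Longrightarrow> (f has_derivative fd f x) (at x)"
  using smooth3_differentiable frechet_derivative_works by blast

lemma smooth3_linear_fd: "smooth3 f \<Longrightarrow> linear (fd f x)"
  by (simp add: linear_frechet_derivative smooth3_differentiable)

lemma fd_eqI: "(f has_derivative f') (at x) \<Longrightarrow> fd f x = f'"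
  by (metis frechet_derivative_at)

text \<open>The derivative of the inverse is built from the inverse itself and
  \<open>fd f x w\<close>, so class \<open>k\<close> of the inverse already gives class
  \<open>k\<close> of its derivative, hence class \<open>k + 1\<close>.\<close>

lemma smooth3_inverse:
  fixes f :: "vec3 \<Rightarrow> real"
  assumes f: "smooth3 f" and nz: "\<And>x. f x \<noteq> 0"
  shows "smooth3 (\<lambda>x. inverse (f x))"
proof -
  let ?g = "\<lambda>x. inverse (f x)"
  have der: "(?g has_derivative (\<lambda>w. - (?g x * fd f x w * ?g x))) (at x)" for x
    using smooth3_has_derivative[OF f] nz by (auto intro!: derivative_eq_intros)
  have cont: "continuous_on UNIV ?g"
    using smooth3_continuous_on[OF f] nz by (auto intro: continuous_on_inverse)
  have "Ck k ?g" for k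
  proof (induction k)
    case (Suc k)
    have "Ck k (\<lambda>x. (?g x * fd f x w) * ?g x)" for w
      using Suc smooth3_fd[OF f, of w]
      by (intro Ck_bilinear[OF bounded_bilinear_mult, of k "\<lambda>x. ?g x * fd f x w" ?g]
        Ck_bilinear[OF bounded_bilinear_mult, of k ?g]) (auto simp: smooth3_def)
    then have "Ck k (\<lambda>x. (-1) * ((?g x * fd f x w) * ?g x))" for w
      by (rule Ck_bilinear[OF bounded_bilinear_mult Ck_const])
    then show ?case
      using cont der by (auto simp: fd_eqI[OF der] differentiable_def)
  qed (use cont in simp)
  then show ?thesis by (simp add: smooth3_def)
qed

text \<open>Same induction as for the inverse: the factor \<open>1 / (2 sqrt f)\<close> is written
  as half of \<open>sqrt f\<close> times \<open>inverse f\<close>, so the derivative contains the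
  root only as a factor.\<close>

lemma smooth3_sqrt:
  fixes f :: "vec3 \<Rightarrow> real"
  assumes f: "smooth3 f" and pos: "\<And>x. f x > 0"
  shows "smooth3 (\<lambda>x. sqrt (f x))"
proof -
  let ?g = "\<lambda>x. sqrt (f x)"
  have "inverse (?g x) = ?g x * inverse (f x)" for x
    using pos[of x] by (simp add: field_simps flip: power2_eq_square)
  then have der: "(?g has_derivative (\<lambda>w. ((1/2) * ?g x) * (inverse (f x) * fd f x w))) (at x)" for x
    using smooth3_has_derivative[OF f] pos[of x]
    by (auto intro!: derivative_eq_intros simp: fun_eq_iff)
  have cont: "continuous_on UNIV ?g"
    using smooth3_continuous_on[OF f] by (auto intro: continuous_on_real_sqrt)
  have "smooth3 (\<lambda>x. inverse (f x))"
    by (rule smooth3_inverse[OF f]) (metis less_irrefl pos)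
  then have s: "smooth3 (\<lambda>x. inverse (f x) * fd f x w)" for w
    using smooth3_mult smooth3_fd[OF f] by blast
  have "Ck k ?g" for k
  proof (induction k)
    case (Suc k)
    have "Ck k (\<lambda>x. ((1/2) * ?g x) * (inverse (f x) * fd f x w))" for w
      using Suc s[of w]
      by (intro Ck_bilinear[OF bounded_bilinear_mult, of k "\<lambda>x. (1/2) * ?g x"]
        Ck_bilinear[OF bounded_bilinear_mult, of k "\<lambda>x. 1/2"] Ck_const) (auto simp: smooth3_def)
    then show ?case
      using cont der by (auto simp: fd_eqI[OF der] differentiable_def)
  qed (use cont in simp)
  then show ?thesis by (simp add: smooth3_def)
qed

lemma smooth3_norm:
  fixes f :: "vec3 \<Rightarrow> 'b::real_inner"
  assumes "smooth3 f" and "\<And>x. f x \<noteq> 0"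
  shows "smooth3 (\<lambda>x. norm (f x))"
  unfolding norm_eq_sqrt_inner using assms by (intro smooth3_sqrt smooth3_inner) auto

text \<open>\<open>smooth3\<close> controls derivatives only in fixed directions. Expanding the
  direction in the basis extends smoothness and bounds to directions that vary with the
  point.\<close>

lemma fd_basis_expansion:
  assumes "smooth3 f"
  shows "fd f x w = (\<Sum>i\<in>Basis. (w \<bullet> i) *\<^sub>R fd f x i)"
proof -
  interpret linear "fd f x" using smooth3_linear_fd[OF assms] .
  have "fd f x w = fd f x (\<Sum>i\<in>Basis. (w \<bullet> i) *\<^sub>R i)" by (simp add: euclidean_representation)
  then show ?thesis by (simp add: sum scaleR)
qed

lemma smooth3_fd_apply:
  assumes "smooth3 f" "smooth3 g"
  shows "smooth3 (\<lambda>x. fd f x (g x))"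
proof -
  have eq: "(\<lambda>x. fd f x (g x)) = (\<lambda>x. \<Sum>i\<in>Basis. (g x \<bullet> i) *\<^sub>R fd f x i)"
    by (rule ext) (rule fd_basis_expansion[OF assms(1)])
  show ?thesis
    unfolding eq by (intro smooth3_sum smooth3_scaleR smooth3_inner assms smooth3_const smooth3_fd)
qed

text \<open>A vector is determined by its inner products with all vectors; this uniqueness resolves
  the \<open>THE\<close> in \<open>grad\<close>.\<close>

lemma grad_eq:
  fixes f :: "vec3 \<Rightarrow> real"
  assumes "f differentiable at x"
  shows "grad f x = (\<Sum>i\<in>Basis. fd f x i *\<^sub>R i)"
proof -
  interpret linear "fd f x" using assms linear_frechet_derivative by blast
  have "fd f x w = w \<bullet> (\<Sum>i\<in>Basis. fd f x i *\<^sub>R i)" for w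
  proof -
    have "fd f x w = fd f x (\<Sum>i\<in>Basis. (w \<bullet> i) *\<^sub>R i)" by (simp add: euclidean_representation)
    also have "\<dots> = (\<Sum>i\<in>Basis. (w \<bullet> i) * fd f x i)" by (simp add: sum scaleR)
    finally show ?thesis by (simp add: inner_sum_right mult.commute)
  qed
  then have "fd f x = (\<lambda>w. w \<bullet> (\<Sum>i\<in>Basis. fd f x i *\<^sub>R i))" ..
  then have G: "GDERIV f x :> (\<Sum>i\<in>Basis. fd f x i *\<^sub>R i)"
    unfolding gderiv_def using assms[unfolded frechet_derivative_works] by argo
  show ?thesis unfolding grad_def
  proof (rule the_equality[where P="\<lambda>D. GDERIV f x :> D", OF G])
    fix D assume "GDERIV f x :> D"
    with G have "(\<lambda>h. h \<bullet> D) = (\<lambda>h. h \<bullet> (\<Sum>i\<in>Basis. fd f x i *\<^sub>R i))"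
      unfolding gderiv_def using has_derivative_unique by blast
    then show "D = (\<Sum>i\<in>Basis. fd f x i *\<^sub>R i)"
      unfolding fun_eq_iff vector_eq_ldot .
  qed
qed

lemma smooth3_grad:
  fixes f :: "vec3 \<Rightarrow> real"
  assumes "smooth3 f"
  shows "smooth3 (grad f)"
proof -
  have eq: "grad f = (\<lambda>x. \<Sum>i\<in>Basis. fd f x i *\<^sub>R i)"
    by (rule ext) (rule grad_eq[OF smooth3_differentiable[OF assms]])
  show ?thesis
    unfolding eq by (intro smooth3_sum smooth3_scaleR smooth3_fd smooth3_const assms)
qed

lemma fd_eq_grad:
  fixes f :: "vec3 \<Rightarrow> real"
  assumes "smooth3 f"
  shows "fd f x w = w \<bullet> grad f x"
  unfolding grad_eq[OF smooth3_differentiable[OF assms]]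
  using fd_basis_expansion[OF assms, of x w] by (simp add: inner_sum_right mult.commute)

lemma grad_scale:
  fixes f :: "vec3 \<Rightarrow> real"
  assumes "smooth3 f"
  shows "grad (\<lambda>y. c * f y) x = c *\<^sub>R grad f x"
proof -
  have d: "((\<lambda>y. c * f y) has_derivative (\<lambda>w. c * fd f x w)) (at x)"
    using smooth3_has_derivative[OF assms] by (auto intro!: derivative_eq_intros)
  then have "(\<lambda>y. c * f y) differentiable at x" using differentiable_def by blast
  then show ?thesis
    by (simp add: grad_eq smooth3_differentiable[OF assms] fd_eqI[OF d] scaleR_sum_right)
qed

section \<open>Symmetry of second derivatives and the divergence of a curl\<close>

lemma smooth3_has_derivative_line:
  assumes "smooth3 f"
  shows "((\<lambda>r. f (a + r *\<^sub>R v)) has_vector_derivative fd f (a + r *\<^sub>R v) v) (at r within S)"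
proof -
  have "((\<lambda>r. a + r *\<^sub>R v) has_vector_derivative v) (at r within S)"
    by (auto intro!: derivative_eq_intros)
  from vector_derivative_diff_chain_within[OF this, of f "fd f (a + r *\<^sub>R v)"]
  show ?thesis
    using smooth3_has_derivative[OF assms, of "a + r *\<^sub>R v"]
    by (simp add: o_def has_derivative_at_withinI)
qed

text \<open>The mean value theorem is applied twice: along \<open>v\<close> to the difference of
  \<open>f\<close> on two parallel lines, then along \<open>w\<close> to the derivative in direction
  \<open>v\<close>. The second difference is symmetric in \<open>v\<close> and \<open>w\<close>,
  which is what \<open>fd_commute\<close> exploits.\<close>

lemma second_difference_mean_value:
  fixes f :: "vec3 \<Rightarrow> real"
  assumes f: "smooth3 f" and s: "s > 0"
  obtains p where "norm (p - x) \<le> s * (norm v + norm w)"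
    and "f (x + s *\<^sub>R v + s *\<^sub>R w) - f (x + s *\<^sub>R v) - f (x + s *\<^sub>R w) + f x
         = s * s * fd (\<lambda>y. fd f y v) p w"
proof -
  let ?\<phi> = "\<lambda>r. f ((x + s *\<^sub>R w) + r *\<^sub>R v) - f (x + r *\<^sub>R v)"
  let ?\<phi>' = "\<lambda>r. fd f ((x + s *\<^sub>R w) + r *\<^sub>R v) v - fd f (x + r *\<^sub>R v) v"
  have "(?\<phi> has_vector_derivative ?\<phi>' r) (at r)" for r
    by (intro has_vector_derivative_diff smooth3_has_derivative_line f)
  then have "\<exists>r. 0 < r \<and> r < s \<and> ?\<phi> s - ?\<phi> 0 = (s - 0) * ?\<phi>' r"
    using s by (intro MVT2) (simp_all add: has_real_derivative_iff_has_vector_derivative)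
  then obtain r where r: "0 < r" "r < s" "?\<phi> s - ?\<phi> 0 = s * ?\<phi>' r" by auto
  let ?\<psi> = "\<lambda>q. fd f ((x + r *\<^sub>R v) + q *\<^sub>R w) v"
  let ?\<psi>' = "\<lambda>q. fd (\<lambda>y. fd f y v) ((x + r *\<^sub>R v) + q *\<^sub>R w) w"
  have "(?\<psi> has_vector_derivative ?\<psi>' q) (at q)" for q
    by (intro smooth3_has_derivative_line[of "\<lambda>y. fd f y v"] smooth3_fd f)
  then have "\<exists>q. 0 < q \<and> q < s \<and> ?\<psi> s - ?\<psi> 0 = (s - 0) * ?\<psi>' q"
    using s by (intro MVT2) (simp_all add: has_real_derivative_iff_has_vector_derivative)
  then obtain q where q: "0 < q" "q < s" "?\<psi> s - ?\<psi> 0 = s * ?\<psi>' q" by auto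
  show ?thesis
  proof
    have "norm (r *\<^sub>R v + q *\<^sub>R w) \<le> r * norm v + q * norm w"
      using r(1) q(1) by (metis abs_of_pos norm_scaleR norm_triangle_ineq)
    also have "\<dots> \<le> s * norm v + s * norm w"
      using r q by (intro add_mono mult_right_mono) auto
    finally show "norm ((x + r *\<^sub>R v) + q *\<^sub>R w - x) \<le> s * (norm v + norm w)"
      by (simp add: algebra_simps)
    have e: "(x + s *\<^sub>R w) + r *\<^sub>R v = (x + r *\<^sub>R v) + s *\<^sub>R w" by simp
    have "?\<phi>' r = s * ?\<psi>' q" using q(3) unfolding e by simp
    with r(3) have "?\<phi> s - ?\<phi> 0 = s * s * ?\<psi>' q" by simp
    then show "f (x + s *\<^sub>R v + s *\<^sub>R w) - f (x + s *\<^sub>R v) - f (x + s *\<^sub>R w) + f x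
         = s * s * fd (\<lambda>y. fd f y v) ((x + r *\<^sub>R v) + q *\<^sub>R w) w"
      by (simp add: algebra_simps)
  qed
qed

text \<open>Both mixed derivatives, taken at suitable points near \<open>x\<close>, equal the same
  second difference quotient. If they differed at \<open>x\<close>, continuity would keep them apart
  near \<open>x\<close>.\<close>

lemma fd_commute:
  fixes f :: "vec3 \<Rightarrow> real"
  assumes f: "smooth3 f"
  shows "fd (\<lambda>y. fd f y v) x w = fd (\<lambda>y. fd f y w) x v"
proof (rule ccontr)
  let ?H = "\<lambda>p. fd (\<lambda>y. fd f y v) p w" and ?G = "\<lambda>p. fd (\<lambda>y. fd f y w) p v"
  assume ne: "?H x \<noteq> ?G x"
  define e where "e = dist (?H x) (?G x) / 2"
  have e: "e > 0" using ne by (simp add: e_def)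
  have "continuous_on UNIV ?H" "continuous_on UNIV ?G"
    by (intro smooth3_continuous_on smooth3_fd f)+
  then have "isCont ?H x" "isCont ?G x"
    by (simp_all add: continuous_on_eq_continuous_at)
  then obtain d1 d2 where d: "d1 > 0" "d2 > 0"
    "\<And>p. dist p x < d1 \<Longrightarrow> dist (?H p) (?H x) < e"
    "\<And>p. dist p x < d2 \<Longrightarrow> dist (?G p) (?G x) < e"
    using e unfolding continuous_at_eps_delta by metis
  \<comment> \<open>This choice of \<open>s\<close> keeps both intermediate points inside the two
    continuity radii; the summand 1 keeps the denominator positive when \<open>v\<close> and
    \<open>w\<close> vanish.\<close>
  define n where "n = norm v + norm w + 1"
  define s where "s = min d1 d2 / (2 * n)"
  have n: "n > 0" by (simp add: n_def add_nonneg_pos)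
  have s: "s > 0" using d n by (simp add: s_def)
  have sn: "s * (norm v + norm w) < min d1 d2"
  proof -
    have "s * (norm v + norm w) \<le> s * n" using s by (intro mult_left_mono) (auto simp: n_def)
    also have "\<dots> = min d1 d2 / 2" using n unfolding s_def n_def[symmetric] by simp
    finally show ?thesis using d by linarith
  qed
  obtain p where p: "norm (p - x) \<le> s * (norm v + norm w)"
    "f (x + s *\<^sub>R v + s *\<^sub>R w) - f (x + s *\<^sub>R v) - f (x + s *\<^sub>R w) + f x = s * s * ?H p"
    using second_difference_mean_value[OF f s] by blast
  obtain q where q: "norm (q - x) \<le> s * (norm w + norm v)"
    "f (x + s *\<^sub>R w + s *\<^sub>R v) - f (x + s *\<^sub>R w) - f (x + s *\<^sub>R v) + f x = s * s * ?G q"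
    using second_difference_mean_value[OF f s] by blast
  have "x + s *\<^sub>R w + s *\<^sub>R v = x + s *\<^sub>R v + s *\<^sub>R w" by simp
  then have "s * s * ?H p = s * s * ?G q" using p(2) q(2) by (smt (verit))
  then have "?H p = ?G q" using s by simp
  moreover have "dist (?H p) (?H x) < e"
    using p(1) sn by (intro d) (simp add: dist_norm)
  moreover have "dist (?G q) (?G x) < e"
    using q(1) sn by (intro d) (simp add: dist_norm add.commute)
  ultimately show False using e_def by (smt (verit) dist_commute dist_triangle field_sum_of_halves)
qed

definition divg :: "(vec3 \<Rightarrow> vec3) \<Rightarrow> vec3 \<Rightarrow> real" where
  "divg F x = (\<Sum>i\<in>UNIV. fd F x (axis i 1) $ i)"

lemma fd_component:
  assumes "smooth3 F"
  shows "fd (\<lambda>y. F y $ k) x w = fd F x w $ k"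
proof -
  have "((\<lambda>y. F y $ k) has_derivative (\<lambda>w. fd F x w $ k)) (at x)"
    using smooth3_has_derivative[OF assms] bounded_linear.has_derivative[OF bounded_linear_vec_nth]
    by blast
  then show ?thesis by (simp add: fd_eqI)
qed

lemma smooth3_component:
  fixes F :: "vec3 \<Rightarrow> vec3"
  assumes "smooth3 F"
  shows "smooth3 (\<lambda>y. F y $ k)"
  using smooth3_inner[OF assms smooth3_const[of "axis k 1"]] by (simp add: inner_axis)

text \<open>Each diagonal entry of the Jacobian is a difference of mixed second derivatives of
  components of \<open>A\<close>, and these cancel in pairs by symmetry. The vector potential enters
  the proof through this identity.\<close>

lemma divg_curl:
  assumes A: "smooth3 A" and B: "smooth3 B" and eq: "\<And>y. B y = curl A y"
  shows "divg B x = 0"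
proof -
  let ?e = "\<lambda>i. axis i 1 :: vec3" and ?a = "\<lambda>k y. A y $ k"
  have a: "smooth3 (?a k)" for k by (rule smooth3_component[OF A])
  have d: "fd (\<lambda>y. fd (?a k) y u - fd (?a l) y v) x w
      = fd (\<lambda>y. fd (?a k) y u) x w - fd (\<lambda>y. fd (?a l) y v) x w" for k l u v w
    by (rule fun_cong[OF fd_eqI]) (intro has_derivative_diff smooth3_has_derivative smooth3_fd a)
  have "fd B x (?e 1) $ 1 = fd (\<lambda>y. fd (?a 3) y (?e 2) - fd (?a 2) y (?e 3)) x (?e 1)"
    "fd B x (?e 2) $ 2 = fd (\<lambda>y. fd (?a 1) y (?e 3) - fd (?a 3) y (?e 1)) x (?e 2)"
    "fd B x (?e 3) $ 3 = fd (\<lambda>y. fd (?a 2) y (?e 1) - fd (?a 1) y (?e 2)) x (?e 3)"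
    using fd_component[OF B, symmetric]
    by (simp_all add: eq curl_def jac_def fd_component[OF A])
  then show ?thesis
    unfolding divg_def sum_3 d
    using fd_commute[OF a, of _ "?e 1" x "?e 2"] fd_commute[OF a, of _ "?e 1" x "?e 3"]
      fd_commute[OF a, of _ "?e 2" x "?e 3"]
    by simp
qed

section \<open>Local Lipschitz bounds\<close>

text \<open>Bound and Lipschitz constant depend on the radius only, which makes later constants
  uniform in \<epsilon> and \<open>h\<close>. General normed spaces are allowed because functions of
  position, velocity and moment are treated as functions of nested pairs.\<close>

definition loc_lipschitz :: "('a::real_normed_vector \<Rightarrow> 'b::real_normed_vector) \<Rightarrow> bool" where
  "loc_lipschitz f \<longleftrightarrow> (\<forall>r. \<exists>L\<ge>0. (\<forall>x. norm x \<le> r \<longrightarrow> norm (f x) \<le> L) \<and>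
     (\<forall>x y. norm x \<le> r \<longrightarrow> norm y \<le> r \<longrightarrow> norm (f x - f y) \<le> L * norm (x - y)))"

lemma lipE:
  assumes "loc_lipschitz f"
  obtains L where "L \<ge> 0" "\<And>x. norm x \<le> r \<Longrightarrow> norm (f x) \<le> L"
    "\<And>x y. norm x \<le> r \<Longrightarrow> norm y \<le> r \<Longrightarrow> norm (f x - f y) \<le> L * norm (x - y)"
  using assms unfolding loc_lipschitz_def by metis

lemma lip_bound:
  assumes "loc_lipschitz f"
  obtains L where "L \<ge> 0" "\<And>x. norm x \<le> r \<Longrightarrow> norm (f x) \<le> L"
  by (rule lipE[OF assms, of r]) (rule that)

lemma lip_increment:
  assumes "loc_lipschitz f"
  obtains L where "L \<ge> 0" "\<And>x y. norm x \<le> r \<Longrightarrow> norm y \<le> r \<Longrightarrow> norm (f x - f y) \<le> L * norm (x - y)"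
  by (rule lipE[OF assms, of r]) (rule that)

lemma lipI:
  assumes "\<And>r. \<exists>L M. (\<forall>x. norm x \<le> r \<longrightarrow> norm (f x) \<le> M) \<and>
     (\<forall>x y. norm x \<le> r \<longrightarrow> norm y \<le> r \<longrightarrow> norm (f x - f y) \<le> L * norm (x - y))"
  shows "loc_lipschitz f"
  unfolding loc_lipschitz_def
proof
  fix r
  obtain L M where LM: "\<And>x. norm x \<le> r \<Longrightarrow> norm (f x) \<le> M"
     "\<And>x y. norm x \<le> r \<Longrightarrow> norm y \<le> r \<Longrightarrow> norm (f x - f y) \<le> L * norm (x - y)"
    using assms by metis
  let ?N = "max 0 (max L M)"
  have "norm (f x - f y) \<le> ?N * norm (x - y)" if "norm x \<le> r" "norm y \<le> r" for x y
    by (rule order_trans[OF LM(2)[OF that]]) (auto intro: mult_right_mono)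
  moreover have "norm (f x) \<le> ?N" if "norm x \<le> r" for x
    using LM(1)[OF that] by linarith
  moreover have "0 \<le> ?N" by simp
  ultimately show "\<exists>L\<ge>0. (\<forall>x. norm x \<le> r \<longrightarrow> norm (f x) \<le> L) \<and>
     (\<forall>x y. norm x \<le> r \<longrightarrow> norm y \<le> r \<longrightarrow> norm (f x - f y) \<le> L * norm (x - y))"
    by blast
qed

lemma lip_const: "loc_lipschitz (\<lambda>x. c)"
  by (rule lipI) (auto intro!: exI[of _ 0] exI[of _ "norm c"])

lemma lip_bounded_linear:
  assumes "bounded_linear f"
  shows "loc_lipschitz f"
proof (rule lipI)
  fix r
  interpret f: bounded_linear f by fact
  obtain K where K: "K > 0" "\<And>x. norm (f x) \<le> norm x * K" using f.pos_bounded by blast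
  have "norm (f x) \<le> r * K" if "norm x \<le> r" for x
    using order_trans[OF K(2)] that K(1) by (simp add: mult_right_mono)
  moreover have "norm (f x - f y) \<le> K * norm (x - y)" for x y
    using K(2)[of "x - y"] by (simp add: f.diff mult.commute)
  ultimately show "\<exists>L M. (\<forall>x. norm x \<le> r \<longrightarrow> norm (f x) \<le> M) \<and>
     (\<forall>x y. norm x \<le> r \<longrightarrow> norm y \<le> r \<longrightarrow> norm (f x - f y) \<le> L * norm (x - y))"
    by blast
qed

lemmas lip_fst = lip_bounded_linear[OF bounded_linear_fst]
  and lip_snd = lip_bounded_linear[OF bounded_linear_snd]

lemma lip_bilinear:
  assumes "bounded_bilinear op2" "loc_lipschitz f" "loc_lipschitz g"
  shows "loc_lipschitz (\<lambda>x. op2 (f x) (g x))"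
proof (rule lipI)
  fix r
  interpret bounded_bilinear op2 by fact
  obtain K where K: "K > 0" "\<And>a b. norm (op2 a b) \<le> norm a * norm b * K" using pos_bounded by blast
  obtain L where L: "L \<ge> 0" "\<And>x. norm x \<le> r \<Longrightarrow> norm (f x) \<le> L"
    "\<And>x y. norm x \<le> r \<Longrightarrow> norm y \<le> r \<Longrightarrow> norm (f x - f y) \<le> L * norm (x - y)"
    using lipE[OF assms(2)] by metis
  obtain M where M: "M \<ge> 0" "\<And>x. norm x \<le> r \<Longrightarrow> norm (g x) \<le> M"
    "\<And>x y. norm x \<le> r \<Longrightarrow> norm y \<le> r \<Longrightarrow> norm (g x - g y) \<le> M * norm (x - y)"
    using lipE[OF assms(3)] by metis
  have bd: "norm (op2 a b) \<le> A * B * K" if "norm a \<le> A" "norm b \<le> B" "A \<ge> 0" for a b A B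
    using K(1) that by (intro order_trans[OF K(2)] mult_right_mono mult_mono) auto
  have "norm (op2 (f x) (g x)) \<le> L * M * K" if "norm x \<le> r" for x
    using L M that by (intro bd) auto
  moreover have "norm (op2 (f x) (g x) - op2 (f y) (g y)) \<le> (2 * L * M * K) * norm (x - y)"
    if "norm x \<le> r" "norm y \<le> r" for x y
  proof -
    have "op2 (f x) (g x) - op2 (f y) (g y) = op2 (f x - f y) (g x) + op2 (f y) (g x - g y)"
      by (simp add: diff_left diff_right)
    also have "norm \<dots> \<le> (L * norm (x - y)) * M * K + L * (M * norm (x - y)) * K"
      using L M that by (intro norm_triangle_mono bd) auto
    finally show ?thesis by (simp add: algebra_simps)
  qed
  ultimately show "\<exists>L M. (\<forall>x. norm x \<le> r \<longrightarrow> norm (op2 (f x) (g x)) \<le> M) \<and>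
     (\<forall>x y. norm x \<le> r \<longrightarrow> norm y \<le> r \<longrightarrow>
        norm (op2 (f x) (g x) - op2 (f y) (g y)) \<le> L * norm (x - y))"
    by blast
qed

lemmas lip_scaleR = lip_bilinear[OF bounded_bilinear_scaleR]
  and lip_mult = lip_bilinear[OF bounded_bilinear_mult]
  and lip_inner = lip_bilinear[OF bounded_bilinear_inner]
  and lip_cross = lip_bilinear[OF bounded_bilinear_cross3]

lemma lip_compose:
  assumes "loc_lipschitz f" "loc_lipschitz g"
  shows "loc_lipschitz (\<lambda>x. g (f x))"
proof (rule lipI)
  fix r
  obtain L where L: "L \<ge> 0" "\<And>x. norm x \<le> r \<Longrightarrow> norm (f x) \<le> L"
    "\<And>x y. norm x \<le> r \<Longrightarrow> norm y \<le> r \<Longrightarrow> norm (f x - f y) \<le> L * norm (x - y)"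
    using lipE[OF assms(1)] by metis
  obtain M where M: "M \<ge> 0" "\<And>x. norm x \<le> L \<Longrightarrow> norm (g x) \<le> M"
    "\<And>x y. norm x \<le> L \<Longrightarrow> norm y \<le> L \<Longrightarrow> norm (g x - g y) \<le> M * norm (x - y)"
    using lipE[OF assms(2)] by metis
  have "norm (g (f x) - g (f y)) \<le> (M * L) * norm (x - y)"
    if "norm x \<le> r" "norm y \<le> r" for x y
    using order_trans[OF M(3)[OF L(2) L(2)] mult_left_mono[OF L(3) M(1)]] that by (simp add: mult.assoc)
  moreover have "norm (g (f x)) \<le> M" if "norm x \<le> r" for x using M(2) L(2) that by blast
  ultimately show "\<exists>L M. (\<forall>x. norm x \<le> r \<longrightarrow> norm (g (f x)) \<le> M) \<and>
     (\<forall>x y. norm x \<le> r \<longrightarrow> norm y \<le> r \<longrightarrow> norm (g (f x) - g (f y)) \<le> L * norm (x - y))"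
    by blast
qed

lemma lip_add:
  assumes "loc_lipschitz f" "loc_lipschitz g"
  shows "loc_lipschitz (\<lambda>x. f x + g x)"
proof (rule lipI)
  fix r
  obtain L where L: "L \<ge> 0" "\<And>x. norm x \<le> r \<Longrightarrow> norm (f x) \<le> L"
    "\<And>x y. norm x \<le> r \<Longrightarrow> norm y \<le> r \<Longrightarrow> norm (f x - f y) \<le> L * norm (x - y)"
    using lipE[OF assms(1)] by metis
  obtain M where M: "M \<ge> 0" "\<And>x. norm x \<le> r \<Longrightarrow> norm (g x) \<le> M"
    "\<And>x y. norm x \<le> r \<Longrightarrow> norm y \<le> r \<Longrightarrow> norm (g x - g y) \<le> M * norm (x - y)"
    using lipE[OF assms(2)] by metis
  have "norm (f x + g x) \<le> L + M" if "norm x \<le> r" for x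
    using L M that by (intro norm_triangle_mono) auto
  moreover have "norm (f x + g x - (f y + g y)) \<le> (L + M) * norm (x - y)"
    if "norm x \<le> r" "norm y \<le> r" for x y
    unfolding add_diff_add distrib_right using L M that by (intro norm_triangle_mono) auto
  ultimately show "\<exists>L M. (\<forall>x. norm x \<le> r \<longrightarrow> norm (f x + g x) \<le> M) \<and>
     (\<forall>x y. norm x \<le> r \<longrightarrow> norm y \<le> r \<longrightarrow> norm (f x + g x - (f y + g y)) \<le> L * norm (x - y))"
    by blast
qed

lemma lip_minus: "loc_lipschitz f \<Longrightarrow> loc_lipschitz (\<lambda>x. - f x)"
  using lip_scaleR[OF lip_const[of "-1::real"]] by fastforce

lemma lip_diff: "loc_lipschitz f \<Longrightarrow> loc_lipschitz g \<Longrightarrow> loc_lipschitz (\<lambda>x. f x - g x)"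
  using lip_add[of f "\<lambda>x. - g x"] by (simp add: lip_minus)

lemma lip_sum: "(\<And>i. i \<in> A \<Longrightarrow> loc_lipschitz (f i)) \<Longrightarrow> loc_lipschitz (\<lambda>x. \<Sum>i\<in>A. f i x)"
  by (induction A rule: infinite_finite_induct) (auto intro: lip_const lip_add)

lemma lip_Pair:
  fixes f :: "'a::real_normed_vector \<Rightarrow> 'b::real_normed_vector"
    and g :: "'a \<Rightarrow> 'c::real_normed_vector"
  assumes "loc_lipschitz f" "loc_lipschitz g"
  shows "loc_lipschitz (\<lambda>x. (f x, g x))"
proof -
  have "bounded_linear (\<lambda>x. (x::'b, 0::'c))" "bounded_linear (\<lambda>y. (0::'b, y::'c))"
    by (intro bounded_linear_Pair bounded_linear_ident bounded_linear_zero)+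
  from lip_add[OF lip_compose[OF assms(1) lip_bounded_linear[OF this(1)]]
        lip_compose[OF assms(2) lip_bounded_linear[OF this(2)]]]
  show ?thesis by simp
qed

lemma smooth3_fd_bounded:
  assumes "smooth3 f"
  obtains L where "L \<ge> 0" "\<And>x w. norm x \<le> r \<Longrightarrow> norm (fd f x w) \<le> L * norm w"
proof -
  have "\<exists>M. \<forall>x. norm x \<le> r \<longrightarrow> norm (fd f x i) \<le> M" for i
  proof -
    have "compact ((\<lambda>x. fd f x i) ` cball 0 r)"
      by (intro compact_continuous_image smooth3_continuous_on smooth3_fd assms compact_cball)
    from compact_imp_bounded[OF this] obtain M
      where "\<forall>y\<in>(\<lambda>x. fd f x i) ` cball 0 r. norm y \<le> M"
      unfolding bounded_iff by blast
    then show ?thesis by (intro exI[of _ M]) simp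
  qed
  then obtain M where M: "\<And>i x. norm x \<le> r \<Longrightarrow> norm (fd f x i) \<le> M i" by metis
  let ?L = "\<Sum>i\<in>Basis. \<bar>M i\<bar>"
  have "norm (fd f x w) \<le> ?L * norm w" if "norm x \<le> r" for x w
  proof -
    have "norm (fd f x w) \<le> (\<Sum>i\<in>Basis. norm ((w \<bullet> i) *\<^sub>R fd f x i))"
      unfolding fd_basis_expansion[OF assms, of x w] by (rule norm_sum)
    also have "\<dots> \<le> (\<Sum>i\<in>Basis. norm w * \<bar>M i\<bar>)"
    proof (rule sum_mono)
      fix i :: vec3 assume "i \<in> Basis"
      then show "norm ((w \<bullet> i) *\<^sub>R fd f x i) \<le> norm w * \<bar>M i\<bar>"
        using M[OF that, of i] by (auto intro!: mult_mono Basis_le_norm)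
    qed
    finally show ?thesis by (simp add: sum_distrib_left mult.commute)
  qed
  then show ?thesis using that[of ?L] by (simp add: sum_nonneg)
qed

lemma lip_smooth3:
  assumes "smooth3 f"
  shows "loc_lipschitz f"
proof (rule lipI)
  fix r
  obtain L where L: "L \<ge> 0" "\<And>x w. norm x \<le> r \<Longrightarrow> norm (fd f x w) \<le> L * norm w"
    using smooth3_fd_bounded[OF assms] by blast
  have "norm (f x - f y) \<le> L * norm (x - y)" if "norm x \<le> r" "norm y \<le> r" for x y
    by (rule differentiable_bound[of "cball 0 r" f "fd f"])
       (use that L smooth3_has_derivative[OF assms] in \<open>auto intro: has_derivative_at_withinI onorm_le\<close>)
  moreover have "\<exists>M. \<forall>x. norm x \<le> r \<longrightarrow> norm (f x) \<le> M"
  proof -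
    have "bounded (f ` cball 0 r)"
      by (intro compact_imp_bounded compact_continuous_image smooth3_continuous_on assms compact_cball)
    then obtain M where "\<forall>y\<in>f ` cball 0 r. norm y \<le> M" unfolding bounded_iff by blast
    then show ?thesis by (intro exI[of _ M]) simp
  qed
  ultimately show "\<exists>L M. (\<forall>x. norm x \<le> r \<longrightarrow> norm (f x) \<le> M) \<and>
     (\<forall>x y. norm x \<le> r \<longrightarrow> norm y \<le> r \<longrightarrow> norm (f x - f y) \<le> L * norm (x - y))"
    by blast
qed

lemma lip_smooth3_compose: "smooth3 f \<Longrightarrow> loc_lipschitz g \<Longrightarrow> loc_lipschitz (\<lambda>x. f (g x))"
  by (rule lip_compose[OF _ lip_smooth3])

lemma lip_fd:
  assumes "smooth3 f" "loc_lipschitz g" "loc_lipschitz k"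
  shows "loc_lipschitz (\<lambda>x. fd f (g x) (k x))"
proof -
  have eq: "(\<lambda>x. fd f (g x) (k x)) = (\<lambda>x. \<Sum>i\<in>Basis. (k x \<bullet> i) *\<^sub>R fd f (g x) i)"
    by (rule ext) (rule fd_basis_expansion[OF assms(1)])
  show ?thesis unfolding eq
    by (intro lip_sum lip_scaleR lip_inner assms lip_const lip_smooth3_compose[of "\<lambda>x. fd f x _"] smooth3_fd)
qed

text \<open>The remainder is quadratic because the derivative is Lipschitz on the ball, and the
  segment between two points of the ball stays in it.\<close>

lemma smooth3_taylor:
  assumes "smooth3 f"
  obtains L where "L \<ge> 0"
    "\<And>x y. norm x \<le> r \<Longrightarrow> norm y \<le> r \<Longrightarrow> norm (f y - f x - fd f x (y - x)) \<le> L * (norm (y - x))\<^sup>2"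
proof -
  have "\<exists>M\<ge>0. \<forall>x y. norm x \<le> r \<longrightarrow> norm y \<le> r \<longrightarrow> norm (fd f x i - fd f y i) \<le> M * norm (x - y)" for i
    using lip_smooth3[OF smooth3_fd[OF assms, of i]] unfolding loc_lipschitz_def by blast
  then obtain M where M: "\<And>i. M i \<ge> 0" "\<And>i x y. norm x \<le> r \<Longrightarrow> norm y \<le> r \<Longrightarrow>
      norm (fd f x i - fd f y i) \<le> M i * norm (x - y)" by metis
  let ?L = "\<Sum>i\<in>Basis. M i"
  have L: "norm (fd f x w - fd f y w) \<le> ?L * norm (x - y) * norm w"
    if "norm x \<le> r" "norm y \<le> r" for x y w
  proof -
    have "fd f x w - fd f y w = (\<Sum>i\<in>Basis. (w \<bullet> i) *\<^sub>R (fd f x i - fd f y i))"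
      by (simp add: fd_basis_expansion[OF assms, of _ w] sum_subtractf scaleR_diff_right)
    also have "norm \<dots> \<le> (\<Sum>i\<in>Basis. norm w * (M i * norm (x - y)))"
      using M that by (intro order_trans[OF norm_sum] sum_mono) (auto intro!: mult_mono Basis_le_norm)
    finally show ?thesis by (simp add: sum_distrib_left sum_distrib_right mult_ac)
  qed
  have L0: "?L \<ge> 0" using M(1) by (simp add: sum_nonneg)
  have "norm (f y - f x - fd f x (y - x)) \<le> ?L * (norm (y - x))\<^sup>2"
    if xy: "norm x \<le> r" "norm y \<le> r" for x y
  proof -
    have seg: "norm z \<le> r \<and> norm (z - x) \<le> norm (y - x)" if "z \<in> closed_segment x y" for z
    proof
      have "closed_segment x y \<subseteq> cball 0 r"
        using xy by (intro closed_segment_subset) auto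
      then show "norm z \<le> r" using that by auto
      show "norm (z - x) \<le> norm (y - x)"
        using segment_bound(1)[OF that] by (simp add: norm_minus_commute)
    qed
    have "norm (f y - f x - fd f x (y - x)) \<le> norm (y - x) * (?L * norm (y - x))"
    proof (rule differentiable_bound_linearization[of x y "closed_segment x y" f "fd f"])
      show "x + t *\<^sub>R (y - x) \<in> closed_segment x y" if "t \<in> {0..1}" for t
        using that by (auto simp: in_segment algebra_simps intro!: exI[of _ t])
      show "(f has_derivative fd f z) (at z within closed_segment x y)" for z
        by (rule has_derivative_at_withinI[OF smooth3_has_derivative[OF assms]])
      show "onorm (fd f z - fd f x) \<le> ?L * norm (y - x)" if "z \<in> closed_segment x y" for z
      proof (rule onorm_le)
        fix w
        have "norm (fd f z w - fd f x w) \<le> ?L * norm (z - x) * norm w"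
          using seg[OF that] xy by (intro L) auto
        also have "\<dots> \<le> ?L * norm (y - x) * norm w"
          using seg[OF that] L0 by (intro mult_right_mono mult_left_mono) auto
        finally show "norm ((fd f z - fd f x) w) \<le> ?L * norm (y - x) * norm w" by simp
      qed
    qed auto
    then show ?thesis by (simp add: power2_eq_square mult_ac)
  qed
  then show ?thesis using that L0 by blast
qed

section \<open>Fast and slow derivatives along the charged-particle motion\<close>

lemma triple_cross_left: "(u \<times> v) \<times> w = (u \<bullet> w) *\<^sub>R v - (v \<bullet> w) *\<^sub>R u" for u :: vec3
  by (simp add: cross3_simps vec_eq_iff forall_3)

lemma triple_cross_right: "u \<times> (v \<times> w) = (u \<bullet> w) *\<^sub>R v - (u \<bullet> v) *\<^sub>R w" for u :: vec3
  by (simp add: cross3_simps vec_eq_iff forall_3)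

text \<open>\<open>w\<close>, \<open>w \<times> b\<close> and \<open>b\<close> are orthogonal and
  the first two have equal length, so the left side is \<open>w \<bullet> w\<close> times the trace
  of \<open>M\<close> on the plane orthogonal to \<open>b\<close>. The remaining diagonal entry
  \<open>M b \<bullet> b\<close> is zero by \<open>Mb\<close>. Without normalization,
  \<open>w = 0\<close> is no special case.\<close>

lemma trace_orthonormal_frame:
  fixes b w :: vec3
  assumes "linear M" and bb: "b \<bullet> b = 1" and wb: "w \<bullet> b = 0" and Mb: "\<And>z. M z \<bullet> b = 0"
  shows "M w \<bullet> w + M (w \<times> b) \<bullet> (w \<times> b) = (w \<bullet> w) * (\<Sum>i\<in>UNIV. M (axis i 1) $ i)"
proof -
  interpret linear M by fact
  let ?m = "\<lambda>i j. M (axis j 1) $ i"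
  have exp: "M z = z$1 *\<^sub>R M (axis 1 1) + z$2 *\<^sub>R M (axis 2 1) + z$3 *\<^sub>R M (axis 3 1)" for z
  proof -
    have "z = z$1 *\<^sub>R axis 1 1 + z$2 *\<^sub>R axis 2 1 + z$3 *\<^sub>R axis 3 1"
      by (simp add: vec_eq_iff forall_3 axis_def)
    then have "M z = M (z$1 *\<^sub>R axis 1 1 + z$2 *\<^sub>R axis 2 1 + z$3 *\<^sub>R axis 3 1)" by (rule arg_cong)
    then show ?thesis by (simp add: add scaleR)
  qed
  have r: "?m 1 j * b$1 + ?m 2 j * b$2 + ?m 3 j * b$3 = 0" for j
    using Mb[of "axis j 1"] by (simp add: inner_vec_def sum_3)
  have bb': "b$1 * b$1 + b$2 * b$2 + b$3 * b$3 = 1" and wb': "w$1 * b$1 + w$2 * b$2 + w$3 * b$3 = 0"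
    using bb wb by (simp_all add: inner_vec_def sum_3)
  let ?c = "w \<times> b" and ?ww = "w \<bullet> w"
  have c: "?c$1 = w$2 * b$3 - w$3 * b$2" "?c$2 = w$3 * b$1 - w$1 * b$3" "?c$3 = w$1 * b$2 - w$2 * b$1"
    and ww: "?ww = w$1 * w$1 + w$2 * w$2 + w$3 * w$3"
    by (simp_all add: cross_components inner_vec_def sum_3)
  \<comment> \<open>Entrywise form of the matrix identity
    \<open>w w^T + c c^T = |w|^2 (I - b b^T)\<close>.\<close>
  have P: "w$1 * w$1 + ?c$1 * ?c$1 = ?ww * (1 - b$1 * b$1)" "w$2 * w$2 + ?c$2 * ?c$2 = ?ww * (1 - b$2 * b$2)"
    "w$3 * w$3 + ?c$3 * ?c$3 = ?ww * (1 - b$3 * b$3)" "w$1 * w$2 + ?c$1 * ?c$2 = - ?ww * (b$1 * b$2)"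
    "w$1 * w$3 + ?c$1 * ?c$3 = - ?ww * (b$1 * b$3)" "w$2 * w$3 + ?c$2 * ?c$3 = - ?ww * (b$2 * b$3)"
    unfolding c ww using bb' wb' by algebra+
  have e: "M w \<bullet> w + M ?c \<bullet> ?c =
      ?m 1 1 * (w$1 * w$1 + ?c$1 * ?c$1) + ?m 2 2 * (w$2 * w$2 + ?c$2 * ?c$2) + ?m 3 3 * (w$3 * w$3 + ?c$3 * ?c$3)
      + (?m 1 2 + ?m 2 1) * (w$1 * w$2 + ?c$1 * ?c$2) + (?m 1 3 + ?m 3 1) * (w$1 * w$3 + ?c$1 * ?c$3)
      + (?m 2 3 + ?m 3 2) * (w$2 * w$3 + ?c$2 * ?c$3)"
    unfolding exp[of w] exp[of ?c] by (simp add: inner_vec_def sum_3 algebra_simps)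
  have "M w \<bullet> w + M ?c \<bullet> ?c = ?ww * (?m 1 1 + ?m 2 2 + ?m 3 3)
      - ?ww * (b$1 * (?m 1 1 * b$1 + ?m 2 1 * b$2 + ?m 3 1 * b$3)
      + b$2 * (?m 1 2 * b$1 + ?m 2 2 * b$2 + ?m 3 2 * b$3) + b$3 * (?m 1 3 * b$1 + ?m 2 3 * b$2 + ?m 3 3 * b$3))"
    unfolding e P by (simp add: algebra_simps)
  then show ?thesis unfolding r by (simp add: sum_3)
qed

text \<open>The field \<open>B\<close> of the locale is the rescaled, \<epsilon>-independent
  \<open>B1\<close> of the theorem; the factor \<open>1/e\<close> is written out in the equations of
  motion. All constants obtained inside are therefore independent of \<epsilon>.\<close>

locale charged_particle =
  fixes B :: "vec3 \<Rightarrow> vec3" and phi :: "vec3 \<Rightarrow> real"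
  assumes B_smooth: "smooth3 B" and B_ge: "\<And>x. norm (B x) \<ge> 1"
    and div_B: "\<And>x. divg B x = 0"
    and phi_smooth: "smooth3 phi" and phi_bdd: "bdd_below (range phi)"
begin

section \<open>The unit field, the mirror force and their derivatives\<close>

definition "N x = norm (B x)"
definition "b x = inverse (N x) *\<^sub>R B x"
text \<open>The field divided by its squared length. Crossing with it from the left undoes the cross
  product with \<open>B x\<close> from the right, up to the component along
  \<open>b x\<close>.\<close>

definition "p x = inverse (N x) *\<^sub>R b x"
definition "E x = - grad phi x"
definition "G x = grad N x"
text \<open>The curvature vector of the field lines.\<close>

definition "k x = fd b x (b x)"
text \<open>The force on the guiding center along the field; the second summand is the mirror force
  for moment \<open>m\<close>.\<close>

definition "g m x = E x \<bullet> b x - m * (G x \<bullet> b x)"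

lemma N_ge: "N x \<ge> 1"
  using B_ge[of x] by (simp add: N_def)

lemma N_pos: "N x > 0"
  using N_ge[of x] by linarith

lemma B_eq: "B x = N x *\<^sub>R b x"
  using N_pos[of x] by (simp add: b_def)

lemma b_b: "b x \<bullet> b x = 1"
  using N_pos[of x] by (simp add: b_def N_def dot_square_norm power2_eq_square field_simps)

lemma norm_b: "norm (b x) = 1"
  by (simp add: norm_eq_1 b_b)

lemma smooth_N: "smooth3 N"
proof -
  have "B x \<noteq> 0" for x using B_ge[of x] by (metis norm_zero not_one_le_zero)
  then show ?thesis unfolding N_def[abs_def] by (rule smooth3_norm[OF B_smooth])
qed

lemma smooth_inverse_N: "smooth3 (\<lambda>x. inverse (N x))"
  using N_pos by (intro smooth3_inverse smooth_N) (metis less_irrefl)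

lemma smooth_b: "smooth3 b"
  unfolding b_def[abs_def] by (intro smooth3_scaleR smooth_inverse_N B_smooth)

lemma smooth_p: "smooth3 p"
  unfolding p_def[abs_def] by (intro smooth3_scaleR smooth_inverse_N smooth_b)

lemma smooth_E: "smooth3 E"
  unfolding E_def[abs_def] by (intro smooth3_minus smooth3_grad phi_smooth)

lemma smooth_G: "smooth3 G"
  using smooth3_grad[OF smooth_N] by (simp add: G_def[abs_def])

lemma smooth_k: "smooth3 k"
  unfolding k_def[abs_def] by (intro smooth3_fd_apply smooth_b)

lemma fd_b_b: "fd b x w \<bullet> b x = 0"
proof -
  have "((\<lambda>y. b y \<bullet> b y) has_derivative (\<lambda>w. b x \<bullet> fd b x w + fd b x w \<bullet> b x)) (at x)"
    by (intro derivative_intros smooth3_has_derivative smooth_b)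
  moreover have "((\<lambda>y. b y \<bullet> b y) has_derivative (\<lambda>w. 0)) (at x)"
    by (simp add: b_b)
  ultimately have "(\<lambda>w. b x \<bullet> fd b x w + fd b x w \<bullet> b x) = (\<lambda>w. 0)"
    by (rule has_derivative_unique)
  from fun_cong[OF this, of w] have "b x \<bullet> fd b x w + fd b x w \<bullet> b x = 0" .
  then show ?thesis by (simp add: inner_commute)
qed

lemma fd_N: "fd N x w = w \<bullet> G x"
  using fd_eq_grad[OF smooth_N] by (simp add: G_def)

text \<open>The product rule for \<open>B = N b\<close> together with the vanishing divergence of
  \<open>B\<close>. This links the trace of \<open>fd b x\<close> to the gradient of the field
  strength.\<close>

lemma div_b: "divg b x = - (G x \<bullet> b x) / N x"
proof -
  have "((\<lambda>y. N y *\<^sub>R b y) has_derivative (\<lambda>w. N x *\<^sub>R fd b x w + fd N x w *\<^sub>R b x)) (at x)"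
    by (intro derivative_intros smooth3_has_derivative smooth_b smooth_N)
  then have "fd B x = (\<lambda>w. N x *\<^sub>R fd b x w + (w \<bullet> G x) *\<^sub>R b x)"
    using fd_eqI by (simp add: B_eq[symmetric] fd_N)
  then have "divg B x = N x * divg b x + (G x \<bullet> b x)"
    by (simp add: divg_def sum.distrib sum_distrib_left inner_vec_def[of "G x"] inner_axis' sum_3 algebra_simps)
  then show ?thesis using div_B[of x] N_pos[of x] by (simp add: field_simps)
qed

text \<open>\<open>X\<close> and \<open>Y\<close> are the fast (order \<open>1/\<epsilon>\<close>) and slow parts of the time derivative of
  \<open>\<Psi>(x, v)\<close> along the motion. If \<open>X\<close> vanishes for \<open>\<Psi>\<close> and equals a given function \<open>F\<close> for \<open>\<Phi>\<close>,
  then \<open>\<Psi> - \<epsilon> \<Phi>\<close> has \<open>-F\<close> added to its slow derivative, up to \<open>O(\<epsilon>)\<close>.\<close>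

definition phase ::
  "(vec3 \<Rightarrow> vec3 \<Rightarrow> 'a) \<Rightarrow> (vec3 \<Rightarrow> vec3 \<Rightarrow> 'a) \<Rightarrow> (vec3 \<Rightarrow> vec3 \<Rightarrow> 'a::real_normed_vector) \<Rightarrow> bool" where
  "phase \<Psi> X Y \<longleftrightarrow> loc_lipschitz (\<lambda>z. \<Psi> (fst z) (snd z)) \<and> loc_lipschitz (\<lambda>z. Y (fst z) (snd z)) \<and>
    (\<forall>e x v t S. (x has_vector_derivative v t) (at t within S) \<longrightarrow>
      (v has_vector_derivative ((1/e) *\<^sub>R (v t \<times> B (x t)) + E (x t))) (at t within S) \<longrightarrow>
      ((\<lambda>t. \<Psi> (x t) (v t)) has_vector_derivative
        ((1/e) *\<^sub>R X (x t) (v t) + Y (x t) (v t))) (at t within S))"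

lemma phaseD:
  assumes "phase \<Psi> X Y" "(x has_vector_derivative v t) (at t within S)"
    "(v has_vector_derivative ((1/e) *\<^sub>R (v t \<times> B (x t)) + E (x t))) (at t within S)"
  shows "((\<lambda>t. \<Psi> (x t) (v t)) has_vector_derivative
        ((1/e) *\<^sub>R X (x t) (v t) + Y (x t) (v t))) (at t within S)"
  using assms unfolding phase_def by blast

lemma phase_cong:
  assumes "phase \<Psi> X Y" "\<And>x v. X x v = X' x v" "\<And>x v. Y x v = Y' x v"
  shows "phase \<Psi> X' Y'"
proof -
  have "X = X'" "Y = Y'" using assms(2,3) by (auto intro!: ext)
  then show ?thesis using assms by simp
qed

lemma phase_position:
  fixes f :: "vec3 \<Rightarrow> 'a::real_normed_vector"
  assumes f: "smooth3 f"
  shows "phase (\<lambda>x v. f x) (\<lambda>x v. 0) (\<lambda>x v. fd f x v)"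
  unfolding phase_def
proof (intro conjI allI impI)
  show "loc_lipschitz (\<lambda>z. f (fst z))" by (intro lip_smooth3_compose[OF f] lip_fst)
  show "loc_lipschitz (\<lambda>z. fd f (fst z) (snd z))" by (intro lip_fd f lip_fst lip_snd)
  fix e t :: real and x v :: "real \<Rightarrow> vec3" and S
  assume "(x has_vector_derivative v t) (at t within S)"
  from vector_derivative_diff_chain_within[OF this, of f "fd f (x t)"]
  show "((\<lambda>t. f (x t)) has_vector_derivative (1/e) *\<^sub>R 0 + fd f (x t) (v t)) (at t within S)"
    using smooth3_has_derivative[OF f, of "x t"] by (simp add: o_def has_derivative_at_withinI)
qed

lemma phase_velocity: "phase (\<lambda>x v. v) (\<lambda>x v. v \<times> B x) (\<lambda>x v. E x)"
  unfolding phase_def by (auto intro: lip_snd lip_smooth3_compose smooth_E lip_fst)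

text \<open>The time derivative is affine in \<open>1/e\<close>, so the Leibniz rule holds for the
  fast and the slow part separately.\<close>

lemma phase_bilinear:
  assumes op2: "bounded_bilinear op2" and P: "phase \<Psi> X Y" and Q: "phase \<Phi> X' Y'"
  shows "phase (\<lambda>x v. op2 (\<Psi> x v) (\<Phi> x v))
    (\<lambda>x v. op2 (\<Psi> x v) (X' x v) + op2 (X x v) (\<Phi> x v))
    (\<lambda>x v. op2 (\<Psi> x v) (Y' x v) + op2 (Y x v) (\<Phi> x v))"
  unfolding phase_def
proof (intro conjI allI impI)
  interpret bounded_bilinear op2 by fact
  show "loc_lipschitz (\<lambda>z. op2 (\<Psi> (fst z) (snd z)) (\<Phi> (fst z) (snd z)))"
    using P Q unfolding phase_def by (intro lip_bilinear[OF op2]) auto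
  show "loc_lipschitz (\<lambda>z. op2 (\<Psi> (fst z) (snd z)) (Y' (fst z) (snd z)) + op2 (Y (fst z) (snd z)) (\<Phi> (fst z) (snd z)))"
    using P Q unfolding phase_def by (intro lip_add lip_bilinear[OF op2]) auto
  fix e t :: real and x v :: "real \<Rightarrow> vec3" and S
  assume "(x has_vector_derivative v t) (at t within S)"
    "(v has_vector_derivative ((1/e) *\<^sub>R (v t \<times> B (x t)) + E (x t))) (at t within S)"
  from has_vector_derivative[OF phaseD[OF P this] phaseD[OF Q this]]
  show "((\<lambda>t. op2 (\<Psi> (x t) (v t)) (\<Phi> (x t) (v t))) has_vector_derivative
      (1/e) *\<^sub>R (op2 (\<Psi> (x t) (v t)) (X' (x t) (v t)) + op2 (X (x t) (v t)) (\<Phi> (x t) (v t))) +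
      (op2 (\<Psi> (x t) (v t)) (Y' (x t) (v t)) + op2 (Y (x t) (v t)) (\<Phi> (x t) (v t)))) (at t within S)"
    by (simp add: add_left add_right scaleR_left scaleR_right algebra_simps)
qed

lemmas phase_scaleR = phase_bilinear[OF bounded_bilinear_scaleR]
  and phase_mult = phase_bilinear[OF bounded_bilinear_mult]
  and phase_inner = phase_bilinear[OF bounded_bilinear_inner]
  and phase_cross = phase_bilinear[OF bounded_bilinear_cross3]

lemma phase_add:
  assumes P: "phase \<Psi> X Y" and Q: "phase \<Phi> X' Y'"
  shows "phase (\<lambda>x v. \<Psi> x v + \<Phi> x v) (\<lambda>x v. X x v + X' x v) (\<lambda>x v. Y x v + Y' x v)"
  unfolding phase_def
proof (intro conjI allI impI)
  show "loc_lipschitz (\<lambda>z. \<Psi> (fst z) (snd z) + \<Phi> (fst z) (snd z))" "loc_lipschitz (\<lambda>z. Y (fst z) (snd z) + Y' (fst z) (snd z))"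
    using P Q unfolding phase_def by (auto intro: lip_add)
  fix e t :: real and x v :: "real \<Rightarrow> vec3" and S
  assume "(x has_vector_derivative v t) (at t within S)"
    "(v has_vector_derivative ((1/e) *\<^sub>R (v t \<times> B (x t)) + E (x t))) (at t within S)"
  from has_vector_derivative_add[OF phaseD[OF P this] phaseD[OF Q this]]
  show "((\<lambda>t. \<Psi> (x t) (v t) + \<Phi> (x t) (v t)) has_vector_derivative
      (1/e) *\<^sub>R (X (x t) (v t) + X' (x t) (v t)) + (Y (x t) (v t) + Y' (x t) (v t))) (at t within S)"
    by (simp add: algebra_simps)
qed

lemma phase_const_scaleR:
  assumes "phase \<Psi> X Y"
  shows "phase (\<lambda>x v. c *\<^sub>R \<Psi> x v) (\<lambda>x v. c *\<^sub>R X x v) (\<lambda>x v. c *\<^sub>R Y x v)"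
  by (rule phase_cong[OF phase_scaleR[OF phase_position[OF smooth3_const] assms]]) auto

lemma phase_diff:
  assumes P: "phase \<Psi> X Y" and Q: "phase \<Phi> X' Y'"
  shows "phase (\<lambda>x v. \<Psi> x v - \<Phi> x v) (\<lambda>x v. X x v - X' x v) (\<lambda>x v. Y x v - Y' x v)"
  using phase_add[OF P phase_const_scaleR[OF Q, of "-1"]] by simp

lemma phase_sum:
  assumes "finite A" "\<And>i. i \<in> A \<Longrightarrow> phase (\<Psi> i) (X i) (Y i)"
  shows "phase (\<lambda>x v. \<Sum>i\<in>A. \<Psi> i x v) (\<lambda>x v. \<Sum>i\<in>A. X i x v) (\<lambda>x v. \<Sum>i\<in>A. Y i x v)"
  using assms
proof (induction A)
  case empty
  show ?case using phase_position[OF smooth3_const[of 0]] by simp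
next
  case (insert a A)
  then show ?case using phase_add[of "\<Psi> a" "X a" "Y a"] by simp
qed

text \<open>The slow part contains second derivatives of \<open>f\<close>. It is left anonymous,
  since of the slow parts of correctors only boundedness is used later.\<close>

lemma phase_fd:
  assumes f: "smooth3 f" and P: "phase \<Psi> X Y"
  obtains Z where "phase (\<lambda>x v. fd f x (\<Psi> x v)) (\<lambda>x v. fd f x (X x v)) Z"
proof -
  have "phase (\<lambda>x v. (\<Psi> x v \<bullet> i) *\<^sub>R fd f x i) (\<lambda>x v. (X x v \<bullet> i) *\<^sub>R fd f x i)
      (\<lambda>x v. (\<Psi> x v \<bullet> i) *\<^sub>R fd (\<lambda>y. fd f y i) x v + (Y x v \<bullet> i) *\<^sub>R fd f x i)" for i
    by (rule phase_cong[OF phase_scaleR[OF phase_inner[OF P phase_position[OF smooth3_const]]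
        phase_position[OF smooth3_fd[OF f]]]]) auto
  then have "phase (\<lambda>x v. \<Sum>i\<in>Basis. (\<Psi> x v \<bullet> i) *\<^sub>R fd f x i) (\<lambda>x v. \<Sum>i\<in>Basis. (X x v \<bullet> i) *\<^sub>R fd f x i)
    (\<lambda>x v. \<Sum>i\<in>Basis. (\<Psi> x v \<bullet> i) *\<^sub>R fd (\<lambda>y. fd f y i) x v + (Y x v \<bullet> i) *\<^sub>R fd f x i)"
    by (intro phase_sum finite_Basis)
  then have "phase (\<lambda>x v. fd f x (\<Psi> x v)) (\<lambda>x v. fd f x (X x v))
    (\<lambda>x v. \<Sum>i\<in>Basis. (\<Psi> x v \<bullet> i) *\<^sub>R fd (\<lambda>y. fd f y i) x v + (Y x v \<bullet> i) *\<^sub>R fd f x i)"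
    by (simp only: fd_basis_expansion[OF f, symmetric])
  then show ?thesis using that by blast
qed


section \<open>Gyration and averaging\<close>

definition "par x v = v \<bullet> b x" for v :: vec3
definition "perp x v = v - (v \<bullet> b x) *\<^sub>R b x"
definition "gyr x v = v \<times> b x"

lemma gyr_orth: "gyr x v \<bullet> b x = 0" "gyr x v \<bullet> v = 0" "gyr x v \<bullet> perp x v = 0" "perp x v \<bullet> b x = 0"
  by (simp_all add: gyr_def perp_def dot_cross_self inner_diff b_b)

lemma perp_cross_b: "perp x v \<times> b x = gyr x v"
  by (simp add: perp_def gyr_def Cross3.left_diff_distrib cross_mult_left)

lemma cross_B: "v \<times> B x = N x *\<^sub>R gyr x v"
  by (simp add: B_eq gyr_def cross_mult_right)

lemma perp_decomp: "v = par x v *\<^sub>R b x + perp x v"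
  by (simp add: par_def perp_def)

lemma fd_b_split: "v \<bullet> fd b x v = par x v * (k x \<bullet> perp x v) + fd b x (perp x v) \<bullet> perp x v"
proof -
  interpret linear "fd b x" by (rule smooth3_linear_fd[OF smooth_b])
  have "fd b x v = par x v *\<^sub>R k x + fd b x (perp x v)"
    using arg_cong[OF perp_decomp[of v x], of "fd b x"] by (simp add: add scaleR k_def)
  then have "v \<bullet> fd b x v = (par x v *\<^sub>R b x + perp x v) \<bullet> (par x v *\<^sub>R k x + fd b x (perp x v))"
    using perp_decomp[of v x] by simp
  moreover have "b x \<bullet> k x = 0" "b x \<bullet> fd b x (perp x v) = 0"
    using fd_b_b by (simp_all add: k_def inner_commute)
  ultimately show ?thesis by (simp add: inner_simps inner_commute)
qed

text \<open>The left side is twice the gyro-average of the quadratic form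
  \<open>fd b x w \<bullet> w\<close>, because \<open>perp x v\<close> and \<open>gyr x v\<close>
  are a quarter turn apart. Its value through \<open>div_b\<close> is the origin of the mirror
  force.\<close>

lemma fd_b_perp_trace:
  "fd b x (perp x v) \<bullet> perp x v + fd b x (gyr x v) \<bullet> gyr x v
    = - ((perp x v \<bullet> perp x v) * (G x \<bullet> b x) / N x)"
  using trace_orthonormal_frame[OF smooth3_linear_fd[OF smooth_b] b_b gyr_orth(4) fd_b_b]
  unfolding perp_cross_b divg_def[symmetric] div_b by simp

lemma phase_par: "phase par (\<lambda>x v. 0) (\<lambda>x v. E x \<bullet> b x + v \<bullet> fd b x v)"
  unfolding par_def[abs_def]
  by (rule phase_cong[OF phase_inner[OF phase_velocity phase_position[OF smooth_b]]])
     (simp_all add: cross_B gyr_orth)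

text \<open>Together with \<open>phase_perp\<close>: the fast part rotates \<open>perp\<close> and
  \<open>gyr\<close> into each other with frequency \<open>N x\<close>. Exchanging one for the other
  and dividing by \<open>N x\<close> therefore inverts the fast derivative on oscillating
  terms.\<close>

lemma phase_gyr:
  obtains Y where "phase gyr (\<lambda>x v. - N x *\<^sub>R perp x v) Y"
proof -
  have "phase gyr (\<lambda>x v. - N x *\<^sub>R perp x v) (\<lambda>x v. v \<times> fd b x v + E x \<times> b x)"
    unfolding gyr_def[abs_def]
    by (rule phase_cong[OF phase_cross[OF phase_velocity phase_position[OF smooth_b]]])
       (simp_all add: cross_B cross_mult_left gyr_def triple_cross_left b_b perp_def algebra_simps inner_commute)
  then show ?thesis using that by blast
qed

lemma phase_perp:
  "phase perp (\<lambda>x v. N x *\<^sub>R gyr x v)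
    (\<lambda>x v. E x - (par x v *\<^sub>R fd b x v + (E x \<bullet> b x + v \<bullet> fd b x v) *\<^sub>R b x))"
  unfolding perp_def[abs_def] par_def[symmetric]
  by (rule phase_cong[OF phase_diff[OF phase_velocity phase_scaleR[OF phase_par phase_position[OF smooth_b]]]])
     (simp_all add: cross_B par_def)

text \<open>\<open>X \<psi>\<close> is the oscillating force \<open>v \<bullet> b' v\<close> minus its gyro-average.\<close>

lemma phase_parallel_corrector:
  obtains \<psi> Y where
    "phase \<psi> (\<lambda>x v. v \<bullet> fd b x v + (perp x v \<bullet> perp x v) * (G x \<bullet> b x) * inverse (N x) / 2) Y"
proof -
  obtain Yg where Yg: "phase gyr (\<lambda>x v. - N x *\<^sub>R perp x v) Yg" by (rule phase_gyr)
  obtain Yf where Yf: "phase (\<lambda>x v. fd b x (perp x v)) (\<lambda>x v. fd b x (N x *\<^sub>R gyr x v)) Yf"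
    by (rule phase_fd[OF smooth_b phase_perp])
  note iN = phase_position[OF smooth_inverse_N]
  \<comment> \<open>Up to the sign taken care of below, \<open>P1\<close> yields the harmonic
    \<open>par x v * (k x \<bullet> perp x v)\<close>, and \<open>P2\<close> yields half the
    difference of the quadratic form at \<open>perp\<close> and at \<open>gyr\<close>, which is its
    value at \<open>perp\<close> minus the average.\<close>
  note P1 = phase_mult[OF phase_mult[OF phase_par iN] phase_inner[OF phase_position[OF smooth_k] Yg]]
  note P2 = phase_const_scaleR[OF phase_mult[OF iN phase_inner[OF Yf Yg]], of "1/2"]
  show ?thesis
  proof (rule that, rule phase_cong[OF phase_const_scaleR[OF phase_add[OF P1 P2], of "-1"]])
    fix x v
    interpret linear "fd b x" by (rule smooth3_linear_fd[OF smooth_b])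
    have n: "inverse (N x) * N x = 1" using N_pos[of x] by simp
    let ?w = "perp x v" and ?J = "gyr x v"
    \<comment> \<open>The left side, zero summands included, is the fast part exactly as composed by
      the product rules.\<close>
    have "-1 *\<^sub>R (par x v * inverse (N x) * (k x \<bullet> - N x *\<^sub>R ?w + 0 \<bullet> ?J) +
            (par x v * 0 + 0 * inverse (N x)) * (k x \<bullet> ?J) +
            (1/2) *\<^sub>R (inverse (N x) * (fd b x ?w \<bullet> - N x *\<^sub>R ?w + fd b x (N x *\<^sub>R ?J) \<bullet> ?J) +
              0 * (fd b x ?w \<bullet> ?J)))
       = (inverse (N x) * N x) * (par x v * (k x \<bullet> ?w))
         - (inverse (N x) * N x) * (fd b x ?J \<bullet> ?J - fd b x ?w \<bullet> ?w) / 2"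
      by (simp add: scaleR field_simps)
    also have "\<dots> = v \<bullet> fd b x v - (fd b x ?w \<bullet> ?w + fd b x ?J \<bullet> ?J) / 2"
      unfolding n fd_b_split by (simp add: field_simps)
    also have "\<dots> = v \<bullet> fd b x v + (?w \<bullet> ?w) * (G x \<bullet> b x) * inverse (N x) / 2"
      unfolding fd_b_perp_trace by (simp add: field_simps)
    finally show "-1 *\<^sub>R (par x v * inverse (N x) * (k x \<bullet> - N x *\<^sub>R ?w + 0 \<bullet> ?J) +
            (par x v * 0 + 0 * inverse (N x)) * (k x \<bullet> ?J) +
            (1/2) *\<^sub>R (inverse (N x) * (fd b x ?w \<bullet> - N x *\<^sub>R ?w + fd b x (N x *\<^sub>R ?J) \<bullet> ?J) +
              0 * (fd b x ?w \<bullet> ?J))) = v \<bullet> fd b x v + (?w \<bullet> ?w) * (G x \<bullet> b x) * inverse (N x) / 2" .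
  qed (rule refl)
qed

definition "moment x v = inverse (N x) * (perp x v \<bullet> perp x v) / 2"

text \<open>A rotation preserves the length of \<open>perp x v\<close>, so there is no fast part.
  The slow part is of order one but oscillates; it still has to be averaged to make the moment
  nearly constant.\<close>

lemma phase_moment:
  "phase moment (\<lambda>x v. 0) (\<lambda>x v. - (v \<bullet> G x) * (inverse (N x))\<^sup>2 * (perp x v \<bullet> perp x v) / 2
     + inverse (N x) * (perp x v \<bullet> E x - par x v * (v \<bullet> fd b x v)))"
proof -
  have fdiN: "fd (\<lambda>x. inverse (N x)) x v = - (v \<bullet> G x) * (inverse (N x))\<^sup>2" for x v
  proof -
    have "((\<lambda>x. inverse (N x)) has_derivative (\<lambda>w. - (inverse (N x) * fd N x w * inverse (N x)))) (at x)"
      using N_pos[of x] by (auto intro!: derivative_eq_intros smooth3_has_derivative smooth_N)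
    then show ?thesis by (simp add: fd_eqI fd_N power2_eq_square)
  qed
  have wb: "fd b x v \<bullet> perp x v = v \<bullet> fd b x v" for x v
    using fd_b_b[of x v] by (simp add: perp_def inner_diff inner_commute)
  have P: "phase (\<lambda>x v. (1/2) *\<^sub>R (inverse (N x) * (perp x v \<bullet> perp x v))) (\<lambda>x v. 0)
    (\<lambda>x v. - (v \<bullet> G x) * (inverse (N x))\<^sup>2 * (perp x v \<bullet> perp x v) / 2
     + inverse (N x) * (perp x v \<bullet> E x - par x v * (v \<bullet> fd b x v)))"
  proof (rule phase_cong[OF phase_const_scaleR[OF phase_mult[OF phase_position[OF smooth_inverse_N]
          phase_inner[OF phase_perp phase_perp]]]])
    fix x v
    show "(1/2) *\<^sub>R (inverse (N x) * (perp x v \<bullet> N x *\<^sub>R gyr x v + N x *\<^sub>R gyr x v \<bullet> perp x v)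
        + 0 * (perp x v \<bullet> perp x v)) = 0"
      by (simp add: gyr_orth inner_commute[of "perp x v" "gyr x v"])
    let ?Y = "E x - (par x v *\<^sub>R fd b x v + (E x \<bullet> b x + v \<bullet> fd b x v) *\<^sub>R b x)"
    have A: "?Y \<bullet> perp x v = perp x v \<bullet> E x - par x v * (v \<bullet> fd b x v)"
      using gyr_orth(4)[of x v]
      by (simp add: inner_diff_left inner_add_left wb inner_commute[of "E x" "perp x v"]
        inner_commute[of "b x" "perp x v"])
    then have A': "perp x v \<bullet> ?Y = perp x v \<bullet> E x - par x v * (v \<bullet> fd b x v)"
      by (simp only: inner_commute)
    show "(1/2) *\<^sub>R (inverse (N x) * (perp x v \<bullet> ?Y + ?Y \<bullet> perp x v)
        + fd (\<lambda>x. inverse (N x)) x v * (perp x v \<bullet> perp x v))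
      = - (v \<bullet> G x) * (inverse (N x))\<^sup>2 * (perp x v \<bullet> perp x v) / 2
     + inverse (N x) * (perp x v \<bullet> E x - par x v * (v \<bullet> fd b x v))"
      unfolding A A' fdiN by (simp add: algebra_simps)
  qed
  then show ?thesis by (simp add: moment_def[abs_def])
qed

text \<open>After \<open>v \<bullet> fd b x v\<close> is split into its oscillating part and its
  average, the average, weighted by the parallel velocity, cancels the contribution of the parallel
  gradient of the field strength. What is left is oscillating, hence a fast derivative.\<close>

lemma phase_moment_corrector:
  obtains \<psi> Y where
    "phase \<psi> (\<lambda>x v. - (v \<bullet> G x) * (inverse (N x))\<^sup>2 * (perp x v \<bullet> perp x v) / 2
     + inverse (N x) * (perp x v \<bullet> E x - par x v * (v \<bullet> fd b x v))) Y"
proof -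
  obtain \<phi> Yf where Yf: "phase \<phi>
      (\<lambda>x v. v \<bullet> fd b x v + (perp x v \<bullet> perp x v) * (G x \<bullet> b x) * inverse (N x) / 2) Yf"
    by (rule phase_parallel_corrector)
  obtain Yg where Yg: "phase gyr (\<lambda>x v. - N x *\<^sub>R perp x v) Yg" by (rule phase_gyr)
  note iN = phase_position[OF smooth_inverse_N]
  \<comment> \<open>\<open>P1\<close> accounts for the oscillating curvature force,
    \<open>P2\<close> for the electric field, \<open>P3\<close> for the perpendicular gradient of
    the field strength.\<close>
  note P1 = phase_mult[OF phase_mult[OF phase_par iN] Yf]
  note P2 = phase_mult[OF phase_mult[OF iN iN] phase_inner[OF phase_position[OF smooth_E] Yg]]
  note P3 = phase_const_scaleR[OF phase_mult[OF phase_mult[OF iN phase_mult[OF iN iN]]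
      phase_mult[OF phase_inner[OF phase_perp phase_perp] phase_inner[OF phase_position[OF smooth_G] Yg]]], of "1/2"]
  show ?thesis
  proof (rule that, rule phase_cong[OF phase_diff[OF P3 phase_add[OF P1 P2]]])
    fix x v
    have n: "inverse (N x) * N x = 1" "N x \<noteq> 0" using N_pos[of x] by auto
    have vG: "v \<bullet> G x = par x v * (G x \<bullet> b x) + perp x v \<bullet> G x"
      using arg_cong[OF perp_decomp[of v x], of "\<lambda>v. v \<bullet> G x"] by (simp add: inner_simps inner_commute)
    show "(1/2) *\<^sub>R (inverse (N x) * (inverse (N x) * inverse (N x)) *
       ((perp x v \<bullet> perp x v) * (G x \<bullet> - N x *\<^sub>R perp x v + 0 \<bullet> gyr x v) +
        (perp x v \<bullet> N x *\<^sub>R gyr x v + N x *\<^sub>R gyr x v \<bullet> perp x v) * (G x \<bullet> gyr x v)) +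
       (inverse (N x) * (inverse (N x) * 0 + 0 * inverse (N x)) + 0 * (inverse (N x) * inverse (N x))) *
       ((perp x v \<bullet> perp x v) * (G x \<bullet> gyr x v))) -
      (par x v * inverse (N x) *
        (v \<bullet> fd b x v + (perp x v \<bullet> perp x v) * (G x \<bullet> b x) * inverse (N x) / 2) +
       (par x v * 0 + 0 * inverse (N x)) * \<phi> x v +
       (inverse (N x) * inverse (N x) * (E x \<bullet> - N x *\<^sub>R perp x v + 0 \<bullet> gyr x v) +
        (inverse (N x) * 0 + 0 * inverse (N x)) * (E x \<bullet> gyr x v)))
      = - (v \<bullet> G x) * (inverse (N x))\<^sup>2 * (perp x v \<bullet> perp x v) / 2
     + inverse (N x) * (perp x v \<bullet> E x - par x v * (v \<bullet> fd b x v))"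
      unfolding vG using n(2)
      by (simp add: gyr_orth inner_commute power2_eq_square field_simps)
  qed (rule refl)
qed

text \<open>The vector triple product turns \<open>p x \<times> (v \<times> B x)\<close> into
  \<open>perp x v\<close>. Multiplied by \<open>e\<close>, the function is the gyroradius vector,
  and subtracting it from \<open>x\<close> gives the guiding center.\<close>

lemma phase_position_corrector:
  obtains Y where "phase (\<lambda>x v. p x \<times> v) perp Y"
proof (rule that, rule phase_cong[OF phase_cross[OF phase_position[OF smooth_p] phase_velocity]])
  fix x v
  have "p x \<bullet> B x = 1" using N_pos[of x] by (simp add: p_def B_eq b_b)
  moreover have "(p x \<bullet> v) *\<^sub>R B x = (v \<bullet> b x) *\<^sub>R b x"
    using N_pos[of x] by (simp add: p_def B_eq inner_commute)
  ultimately show "p x \<times> (v \<times> B x) + 0 \<times> v = perp x v"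
    by (simp add: triple_cross_right perp_def)
qed (rule refl)

lemma phase_energy: "phase (\<lambda>x v. (v \<bullet> v) / 2 + phi x) (\<lambda>x v. 0) (\<lambda>x v. 0)"
proof -
  have "phase (\<lambda>x v. (1/2) *\<^sub>R (v \<bullet> v) + phi x) (\<lambda>x v. 0) (\<lambda>x v. 0)"
    by (rule phase_cong[OF phase_add[OF phase_const_scaleR[OF phase_inner[OF phase_velocity phase_velocity]]
      phase_position[OF phi_smooth]]])
     (simp_all add: cross_B gyr_orth inner_commute[of _ "gyr _ _"] inner_commute[of "grad _ _"] E_def fd_eq_grad[OF phi_smooth])
  then show ?thesis by simp
qed

lemma phase_bound:
  assumes "phase \<Psi> X Y"
  obtains L where "L \<ge> 0" "\<And>x v. norm x \<le> r \<Longrightarrow> norm v \<le> r \<Longrightarrow> norm (\<Psi> x v) \<le> L"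
    "\<And>x v. norm x \<le> r \<Longrightarrow> norm v \<le> r \<Longrightarrow> norm (Y x v) \<le> L"
proof -
  obtain L1 where L1: "L1 \<ge> 0" "\<And>z. norm z \<le> 2 * r \<Longrightarrow> norm (\<Psi> (fst z) (snd z)) \<le> L1"
    using assms lipE[of "\<lambda>z. \<Psi> (fst z) (snd z)"] unfolding phase_def by metis
  obtain L2 where L2: "L2 \<ge> 0" "\<And>z. norm z \<le> 2 * r \<Longrightarrow> norm (Y (fst z) (snd z)) \<le> L2"
    using assms lipE[of "\<lambda>z. Y (fst z) (snd z)"] unfolding phase_def by metis
  have z: "norm (x, v) \<le> 2 * r" if "norm x \<le> r" "norm v \<le> r" for x v :: vec3
    using norm_Pair_le[of x v] that by linarith
  show ?thesis
  proof (rule that[of "max L1 L2"])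
    show "norm (\<Psi> x v) \<le> max L1 L2" "norm (Y x v) \<le> max L1 L2" if "norm x \<le> r" "norm v \<le> r" for x v
      using L1(2)[OF z[OF that]] L2(2)[OF z[OF that]] by auto
  qed (use L1 in auto)
qed

end

section \<open>The exact motion\<close>

lemma vector_derivative_increment_le:
  fixes f :: "real \<Rightarrow> 'a::real_normed_vector"
  assumes "\<And>t. t \<in> {a..b} \<Longrightarrow> (f has_vector_derivative f' t) (at t within {a..b})"
    and "\<And>t. t \<in> {a..b} \<Longrightarrow> norm (f' t) \<le> K" and "s \<in> {a..b}" "t \<in> {a..b}"
  shows "norm (f t - f s) \<le> K * \<bar>t - s\<bar>"
proof -
  have "norm (f t - f s) \<le> K * norm (t - s)"
    using assms by (intro differentiable_bound[of "{a..b}" f "\<lambda>t h. h *\<^sub>R f' t"])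
      (auto simp: has_vector_derivative_def mult.commute[of K] intro!: onorm_le mult_left_mono)
  then show ?thesis by simp
qed

text \<open>A bound through third derivatives of \<open>y\<close> is out of reach, since
  \<open>r\<close> and \<open>q\<close> may oscillate and only their sizes are controlled.
  Regularity is asked of \<open>H\<close> alone, and \<open>r\<close>, \<open>q\<close> enter the
  defect linearly.\<close>

lemma trapezoidal_defect:
  fixes y F :: "real \<Rightarrow> 'a::real_normed_vector"
  assumes y: "\<And>s. s \<in> {t..t+h} \<Longrightarrow> (y has_vector_derivative F s + r s) (at s within {t..t+h})"
    and F: "\<And>s. s \<in> {t..t+h} \<Longrightarrow> (F has_vector_derivative H s + q s) (at s within {t..t+h})"
    and r: "\<And>s. s \<in> {t..t+h} \<Longrightarrow> norm (r s) \<le> d" and q: "\<And>s. s \<in> {t..t+h} \<Longrightarrow> norm (q s) \<le> d"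
    and H: "\<And>s s'. s \<in> {t..t+h} \<Longrightarrow> s' \<in> {t..t+h} \<Longrightarrow> norm (H s - H s') \<le> K * \<bar>s - s'\<bar>"
    and h: "h \<ge> 0" and K: "K \<ge> 0"
  shows "norm (y (t + h) - y t - (h/2) *\<^sub>R (F t + F (t + h))) \<le> h * (d + h * d + K * h\<^sup>2)"
proof -
  let ?I = "{t..t+h}"
  \<comment> \<open>The defect as a function of the right end point. It vanishes at
    \<open>s = t\<close>, so a bound on its derivative suffices.\<close>
  define z where "z s = y s - y t - ((s - t)/2) *\<^sub>R (F t + F s)" for s
  define z' where "z' s = F s + r s - (((s - t)/2) *\<^sub>R (H s + q s) + (1/2) *\<^sub>R (F t + F s))" for s
  have d0: "d \<ge> 0" using r[of t] h by (intro order_trans[OF norm_ge_zero[of "r t"]]) simp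
  have "(z has_vector_derivative z' s) (at s within ?I)" if "s \<in> ?I" for s
    unfolding z_def[abs_def] z'_def
    by (rule derivative_eq_intros y[OF that] F[OF that] refl | simp)+
  moreover have "norm (z' s) \<le> d + h * d + K * h\<^sup>2" if s: "s \<in> ?I" for s
  proof -
    have s': "0 \<le> s - t" "s - t \<le> h" using s by auto
    \<comment> \<open>The expansion of \<open>F\<close> is centred at the right end \<open>s\<close>
      because \<open>z' s\<close> contains \<open>H s\<close>; hence the increment of
      \<open>F\<close> minus its linear part with slope \<open>H s\<close> is estimated.\<close>
    have "norm ((F s - s *\<^sub>R H s) - (F t - t *\<^sub>R H s)) \<le> (d + K * h) * \<bar>s - t\<bar>"
    proof (rule vector_derivative_increment_le[of t s "\<lambda>\<tau>. F \<tau> - \<tau> *\<^sub>R H s" "\<lambda>\<tau>. H \<tau> + q \<tau> - H s"])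
      fix \<tau> assume \<tau>: "\<tau> \<in> {t..s}"
      with s have \<tau>': "\<tau> \<in> ?I" "{t..s} \<subseteq> ?I" by auto
      show "((\<lambda>\<tau>. F \<tau> - \<tau> *\<^sub>R H s) has_vector_derivative H \<tau> + q \<tau> - H s) (at \<tau> within {t..s})"
        by (rule has_vector_derivative_within_subset[OF _ \<tau>'(2)])
           (rule derivative_eq_intros F[OF \<tau>'(1)] refl | simp)+
      have "norm (H \<tau> + q \<tau> - H s) \<le> norm (q \<tau>) + norm (H \<tau> - H s)"
        using norm_triangle_ineq[of "q \<tau>" "H \<tau> - H s"] by (simp add: algebra_simps)
      also have "\<dots> \<le> d + K * \<bar>\<tau> - s\<bar>" using q[OF \<tau>'(1)] H[OF \<tau>'(1) s] by linarith
      also have "\<dots> \<le> d + K * h" using \<tau> s K by (intro add_left_mono mult_left_mono) auto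
      finally show "norm (H \<tau> + q \<tau> - H s) \<le> d + K * h" .
    qed (use s in auto)
    then have "norm (F s - F t - (s - t) *\<^sub>R H s) \<le> (d + K * h) * (s - t)"
      using s' by (simp add: algebra_simps)
    also have "\<dots> \<le> (d + K * h) * h" using s' d0 K h by (intro mult_left_mono) auto
    finally have 1: "norm (F s - F t - (s - t) *\<^sub>R H s) \<le> (d + K * h) * h" .
    have "(s - t) * norm (q s) \<le> h * d" using s' q[OF s] h by (intro mult_mono) auto
    then have 2: "norm ((s - t) *\<^sub>R q s) \<le> h * d" using s' by simp
    have "z' s = r s + (1/2) *\<^sub>R (F s - F t - (s - t) *\<^sub>R H s) - (1/2) *\<^sub>R ((s - t) *\<^sub>R q s)"
    proof -
      have "F s = (1/2) *\<^sub>R F s + (1/2) *\<^sub>R F s" by (simp flip: scaleR_add_left)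
      then show ?thesis unfolding z'_def by (simp add: algebra_simps diff_divide_distrib)
    qed
    also have "norm \<dots> \<le> norm (r s) + (1/2) * norm (F s - F t - (s - t) *\<^sub>R H s) + (1/2) * norm ((s - t) *\<^sub>R q s)"
      by (intro order_trans[OF norm_triangle_ineq4] add_mono order_trans[OF norm_triangle_ineq]) auto
    also have "\<dots> \<le> d + (1/2) * ((d + K * h) * h) + (1/2) * (h * d)"
      using 1 2 r[OF s] by (intro add_mono mult_left_mono) auto
    also have "\<dots> = d + h * d + K * h\<^sup>2 / 2" by (simp add: power2_eq_square algebra_simps)
    also have "\<dots> \<le> d + h * d + K * h\<^sup>2" using K by simp
    finally show ?thesis .
  qed
  ultimately have "norm (z (t + h) - z t) \<le> (d + h * d + K * h\<^sup>2) * \<bar>t + h - t\<bar>"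
    using h by (intro vector_derivative_increment_le[of t "t+h" z z']) auto
  then show ?thesis using h by (simp add: z_def mult.commute)
qed

context charged_particle
begin

definition motion :: "real \<Rightarrow> real \<Rightarrow> (real \<Rightarrow> vec3) \<Rightarrow> (real \<Rightarrow> vec3) \<Rightarrow> bool" where
  "motion e T x v \<longleftrightarrow> (\<forall>t\<in>{0..T}. (x has_vector_derivative v t) (at t within {0..T}) \<and>
      (v has_vector_derivative ((1/e) *\<^sub>R (v t \<times> B (x t)) + E (x t))) (at t within {0..T}))"

lemma phase_along:
  assumes "phase \<Psi> X Y" "motion e T x v" "t \<in> {0..T}"
  shows "((\<lambda>t. \<Psi> (x t) (v t)) has_vector_derivative
        ((1/e) *\<^sub>R X (x t) (v t) + Y (x t) (v t))) (at t within {0..T})"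
  using assms phaseD unfolding motion_def by blast

text \<open>The magnetic force does no work, so the energy is conserved whatever \<open>e\<close>
  is. A potential bounded from below then limits the speed, and the speed limits the distance
  travelled.\<close>

lemma motion_bounded:
  assumes "T \<ge> 0"
  obtains \<rho> where "\<And>e x v t. motion e T x v \<Longrightarrow> norm (x 0) \<le> M0 \<Longrightarrow> norm (v 0) \<le> M1 \<Longrightarrow> t \<in> {0..T} \<Longrightarrow>
    norm (x t) \<le> \<rho> \<and> norm (v t) \<le> \<rho>"
proof -
  obtain c where c: "\<And>x. c \<le> phi x" using phi_bdd unfolding bdd_below_def by auto
  obtain P where P: "\<And>x. norm x \<le> M0 \<Longrightarrow> norm (phi x) \<le> P" using lipE[OF lip_smooth3[OF phi_smooth]] by metis
  define V where "V = sqrt (M1\<^sup>2 + 2 * (P - c))"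
  have "norm (x t) \<le> max V (M0 + V * T) \<and> norm (v t) \<le> max V (M0 + V * T)"
    if m: "motion e T x v" "norm (x 0) \<le> M0" "norm (v 0) \<le> M1" "t \<in> {0..T}" for e x v t
  proof -
    have z: "0 \<in> {0..T}" using assms by simp
    have v: "norm (v s) \<le> V" if s: "s \<in> {0..T}" for s
    proof -
      have "norm (((v s \<bullet> v s)/2 + phi (x s)) - ((v 0 \<bullet> v 0)/2 + phi (x 0))) \<le> 0 * \<bar>s - 0\<bar>"
        using phase_along[OF phase_energy m(1)] by (intro vector_derivative_increment_le[OF _ _ z s]) auto
      then have "v s \<bullet> v s = v 0 \<bullet> v 0 + 2 * (phi (x 0) - phi (x s))" by simp
      moreover have "v 0 \<bullet> v 0 \<le> M1\<^sup>2"
        using m(3) by (simp add: dot_square_norm power_mono)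
      ultimately have "(norm (v s))\<^sup>2 \<le> M1\<^sup>2 + 2 * (P - c)"
        using P[OF m(2)] c[of "x s"] by (simp add: dot_square_norm)
      then show ?thesis unfolding V_def by (rule real_le_rsqrt)
    qed
    have "norm (x t - x 0) \<le> V * \<bar>t - 0\<bar>"
      using m(1) v by (intro vector_derivative_increment_le[OF _ _ z m(4)]) (auto simp: motion_def)
    also have "\<dots> \<le> V * T" using m(4) order_trans[OF norm_ge_zero v[OF m(4)]] by (intro mult_left_mono) auto
    finally have "norm (x t) \<le> M0 + V * T" using norm_triangle_sub[of "x t" "x 0"] m(2) by linarith
    then show ?thesis using v[OF m(4)] by auto
  qed
  then show ?thesis using that by blast
qed

lemma lip_g: "loc_lipschitz (\<lambda>z. g (snd z) (fst z))"
  unfolding g_def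
  by (intro lip_diff lip_mult lip_inner lip_smooth3_compose[OF smooth_E] lip_smooth3_compose[OF smooth_b]
    lip_smooth3_compose[OF smooth_G] lip_fst lip_snd)

text \<open>\<open>y\<close> and \<open>U\<close> are \<open>x\<close> and the parallel velocity without their fast oscillations; as an
  approximate solution they replace the guiding-center ODE, whose solvability is not needed.\<close>

lemma motion_near_guiding_center:
  assumes T: "T \<ge> 0"
  obtains \<rho> C where "\<rho> \<ge> 0" "C \<ge> 0"
    "\<And>e x v. 0 < e \<Longrightarrow> e < 1 \<Longrightarrow> motion e T x v \<Longrightarrow> norm (x 0) \<le> M0 \<Longrightarrow> norm (v 0) \<le> M1 \<Longrightarrow>
      \<bar>moment (x 0) (v 0)\<bar> \<le> C \<and>
      (\<exists>y U. \<forall>t\<in>{0..T}. norm (x t) \<le> \<rho> \<and> norm (v t) \<le> \<rho> \<and>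
        norm (y t - x t) \<le> C * e \<and> \<bar>U t - par (x t) (v t)\<bar> \<le> C * e \<and>
        (\<exists>r s. (y has_vector_derivative U t *\<^sub>R b (y t) + r) (at t within {0..T}) \<and>
          (U has_vector_derivative g (moment (x 0) (v 0)) (y t) + s) (at t within {0..T}) \<and>
          norm r \<le> C * e \<and> \<bar>s\<bar> \<le> C * e))"
proof -
  obtain \<rho>' where \<rho>': "\<And>e x v t. motion e T x v \<Longrightarrow> norm (x 0) \<le> M0 \<Longrightarrow> norm (v 0) \<le> M1 \<Longrightarrow> t \<in> {0..T} \<Longrightarrow>
    norm (x t) \<le> \<rho>' \<and> norm (v t) \<le> \<rho>'" by (rule motion_bounded[OF T]) blast
  define \<rho> where "\<rho> = max 0 \<rho>'"
  have \<rho>0: "\<rho> \<ge> 0" by (simp add: \<rho>_def)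
  obtain \<psi> Y where \<psi>: "phase \<psi> (\<lambda>x v. v \<bullet> fd b x v + (perp x v \<bullet> perp x v) * (G x \<bullet> b x) * inverse (N x) / 2) Y"
    by (rule phase_parallel_corrector)
  obtain \<eta> Z where \<eta>: "phase \<eta> (\<lambda>x v. - (v \<bullet> G x) * (inverse (N x))\<^sup>2 * (perp x v \<bullet> perp x v) / 2
     + inverse (N x) * (perp x v \<bullet> E x - par x v * (v \<bullet> fd b x v))) Z"
    by (rule phase_moment_corrector)
  obtain W where W: "phase (\<lambda>x v. p x \<times> v) perp W" by (rule phase_position_corrector)
  obtain L1 where L1: "L1 \<ge> 0" "\<And>x v. norm x \<le> \<rho> \<Longrightarrow> norm v \<le> \<rho> \<Longrightarrow> norm (\<psi> x v) \<le> L1"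
    "\<And>x v. norm x \<le> \<rho> \<Longrightarrow> norm v \<le> \<rho> \<Longrightarrow> norm (Y x v) \<le> L1" using phase_bound[OF \<psi>] by metis
  obtain L2 where L2: "L2 \<ge> 0" "\<And>x v. norm x \<le> \<rho> \<Longrightarrow> norm v \<le> \<rho> \<Longrightarrow> norm (\<eta> x v) \<le> L2"
    "\<And>x v. norm x \<le> \<rho> \<Longrightarrow> norm v \<le> \<rho> \<Longrightarrow> norm (Z x v) \<le> L2" using phase_bound[OF \<eta>] by metis
  obtain L3 where L3: "L3 \<ge> 0" "\<And>x v. norm x \<le> \<rho> \<Longrightarrow> norm v \<le> \<rho> \<Longrightarrow> norm (p x \<times> v) \<le> L3"
    "\<And>x v. norm x \<le> \<rho> \<Longrightarrow> norm v \<le> \<rho> \<Longrightarrow> norm (W x v) \<le> L3" using phase_bound[OF W] by metis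
  obtain Lm where Lm: "Lm \<ge> 0" "\<And>x v. norm x \<le> \<rho> \<Longrightarrow> norm v \<le> \<rho> \<Longrightarrow> norm (moment x v) \<le> Lm"
    using phase_bound[OF phase_moment] by metis
  \<comment> \<open>Both pairs \<open>(x, moment)\<close> and \<open>(y, initial moment)\<close> lie
    in this ball, since \<open>y\<close> is within \<open>L3 * e\<close> of \<open>x\<close> and
    \<open>e < 1\<close>.\<close>
  define R where "R = \<rho> + L3 + Lm"
  obtain Lg where Lg: "Lg \<ge> 0" "\<And>z z'. norm z \<le> R \<Longrightarrow> norm z' \<le> R \<Longrightarrow>
      norm (g (snd z) (fst z) - g (snd z') (fst z')) \<le> Lg * norm (z - z')" using lipE[OF lip_g] by metis
  obtain Lb where Lb: "Lb \<ge> 0" "\<And>x y. norm x \<le> R \<Longrightarrow> norm y \<le> R \<Longrightarrow> norm (b x - b y) \<le> Lb * norm (x - y)"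
    using lipE[OF lip_smooth3[OF smooth_b]] by metis
  \<comment> \<open>Two values of the corrector, at time \<open>t\<close> and at time 0, and a drift
    over a time of at most \<open>T\<close>.\<close>
  define Cm where "Cm = L2 * (2 + T)"
  define C where "C = Lm + L3 + L1 + (L1 + (\<rho> + L1) * (Lb * L3) + L3) + (Lg * (L3 + Cm) + L1)"
  have Cm0: "Cm \<ge> 0" using L2 T by (simp add: Cm_def)
  have CL: "Lm \<le> C" "L3 \<le> C" "L1 \<le> C" "L1 + (\<rho> + L1) * (Lb * L3) + L3 \<le> C" "Lg * (L3 + Cm) + L1 \<le> C" "C \<ge> 0"
    using L1 L2 L3 Lm Lg Lb Cm0 \<rho>0 by (simp_all add: C_def)
  show ?thesis
  proof (rule that[OF \<rho>0 CL(6)])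
    fix e x v
    assume e: "0 < e" "e < 1" and m: "motion e T x v" and ini: "norm (x 0) \<le> M0" "norm (v 0) \<le> M1"
    let ?m0 = "moment (x 0) (v 0)"
    have zT: "0 \<in> {0..T}" using T by simp
    have bd: "norm (x t) \<le> \<rho>" "norm (v t) \<le> \<rho>" if "t \<in> {0..T}" for t
      using \<rho>'[OF m ini that] by (auto simp: \<rho>_def)
    have mom: "\<bar>moment (x t) (v t) - ?m0\<bar> \<le> Cm * e" if t: "t \<in> {0..T}" for t
    proof -
      \<comment> \<open>The fast part of \<open>\<eta>\<close> is the slow part of
        \<open>moment\<close>, so subtracting \<open>e *\<^sub>R \<eta>\<close> leaves only the rate
        \<open>- e *\<^sub>R Z\<close>.\<close>
      let ?f = "\<lambda>t. moment (x t) (v t) - e *\<^sub>R \<eta> (x t) (v t)"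
      have "norm (?f t - ?f 0) \<le> (e * L2) * \<bar>t - 0\<bar>"
      proof (rule vector_derivative_increment_le[OF _ _ zT t])
        fix s assume s: "s \<in> {0..T}"
        show "(?f has_vector_derivative (- (e *\<^sub>R Z (x s) (v s)))) (at s within {0..T})"
          using e by (intro has_vector_derivative_eq_rhs[OF has_vector_derivative_diff[OF phase_along[OF phase_moment m s]
            phase_along[OF phase_const_scaleR[OF \<eta>, of e] m s]]]) simp
        show "norm (- (e *\<^sub>R Z (x s) (v s))) \<le> e * L2"
          using L2(3)[OF bd[OF s]] e by (simp add: abs_mult)
      qed
      also have "\<dots> \<le> (e * L2) * T" using t e L2(1) by (intro mult_left_mono) auto
      finally have "\<bar>?f t - ?f 0\<bar> \<le> e * L2 * T" by simp
      moreover have "\<bar>e * \<eta> (x t) (v t)\<bar> \<le> e * L2" "\<bar>e * \<eta> (x 0) (v 0)\<bar> \<le> e * L2"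
        using L2(2)[OF bd[OF t]] L2(2)[OF bd[OF zT]] e by (simp_all add: abs_mult)
      ultimately show ?thesis by (simp add: Cm_def algebra_simps)
    qed
    define y where "y t = x t - e *\<^sub>R (p (x t) \<times> v t)" for t
    define U where "U t = par (x t) (v t) - e *\<^sub>R \<psi> (x t) (v t)" for t
    have main: "norm (x t) \<le> \<rho> \<and> norm (v t) \<le> \<rho> \<and>
        norm (y t - x t) \<le> C * e \<and> \<bar>U t - par (x t) (v t)\<bar> \<le> C * e \<and>
        (\<exists>r s. (y has_vector_derivative U t *\<^sub>R b (y t) + r) (at t within {0..T}) \<and>
          (U has_vector_derivative g ?m0 (y t) + s) (at t within {0..T}) \<and>
          norm r \<le> C * e \<and> \<bar>s\<bar> \<le> C * e)" if t: "t \<in> {0..T}" for t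
    proof -
      note bt = bd[OF t]
      have yx: "norm (y t - x t) \<le> L3 * e" using L3(2)[OF bt] e by (simp add: y_def mult.commute)
      have Up: "\<bar>U t - par (x t) (v t)\<bar> \<le> L1 * e" using L1(2)[OF bt] e by (simp add: U_def abs_mult mult.commute)
      have le1: "a * e \<le> a" if "a \<ge> 0" for a using that e by (simp add: mult_left_le)
      have yb: "norm (y t) \<le> \<rho> + L3"
        using norm_triangle_sub[of "y t" "x t"] yx bt le1[OF L3(1)] by linarith
      have parb: "\<bar>par (x t) (v t)\<bar> \<le> \<rho>"
        unfolding par_def using Cauchy_Schwarz_ineq2[of "v t" "b (x t)"] bt(2) norm_b by simp
      have Ub: "\<bar>U t\<bar> \<le> \<rho> + L1" using parb Up le1[OF L1(1)] by linarith
      have dy: "(y has_vector_derivative par (x t) (v t) *\<^sub>R b (x t) - e *\<^sub>R W (x t) (v t)) (at t within {0..T})"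
      proof -
        have "(x has_vector_derivative v t) (at t within {0..T})" using m t by (simp add: motion_def)
        from has_vector_derivative_diff[OF this phase_along[OF phase_const_scaleR[OF W, of e] m t]]
        show ?thesis unfolding y_def[abs_def]
          by (rule has_vector_derivative_eq_rhs) (use e in \<open>simp add: perp_def par_def algebra_simps\<close>)
      qed
      \<comment> \<open>Subtracting the fast part of \<open>\<psi>\<close> replaces
        \<open>v \<bullet> fd b x v\<close> by its gyro-average, minus \<open>moment\<close> times
        \<open>G x \<bullet> b x\<close>. This produces \<open>g\<close> at the current moment,
        which \<open>mom\<close> later freezes at its initial value.\<close>
      have dU: "(U has_vector_derivative g (moment (x t) (v t)) (x t) - e * Y (x t) (v t)) (at t within {0..T})"
        using has_vector_derivative_diff[OF phase_along[OF phase_par m t] phase_along[OF phase_const_scaleR[OF \<psi>, of e] m t]]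
        unfolding U_def[abs_def]
        by (rule has_vector_derivative_eq_rhs) (use e in \<open>simp add: g_def moment_def algebra_simps\<close>)
      \<comment> \<open>The residuals of the guiding-center equations for \<open>(y, U)\<close>:
        they collect the slow parts of the correctors and the cost of passing from \<open>x\<close>,
        \<open>par x v\<close> and the current moment to \<open>y\<close>, \<open>U\<close> and the
        initial moment.\<close>
      define r where "r = par (x t) (v t) *\<^sub>R b (x t) - e *\<^sub>R W (x t) (v t) - U t *\<^sub>R b (y t)"
      define s where "s = g (moment (x t) (v t)) (x t) - e * Y (x t) (v t) - g ?m0 (y t)"
      have xyR: "norm (x t) \<le> R" "norm (y t) \<le> R" using bt yb Lm L3 by (simp_all add: R_def)
      have "norm r \<le> C * e"
      proof -
        have "r = - ((U t - par (x t) (v t)) *\<^sub>R b (x t)) + U t *\<^sub>R (b (x t) - b (y t)) - e *\<^sub>R W (x t) (v t)"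
          by (simp add: r_def algebra_simps)
        also have "norm \<dots> \<le> L1 * e + (\<rho> + L1) * (Lb * (L3 * e)) + L3 * e"
        proof (intro order_trans[OF norm_triangle_ineq4] add_mono order_trans[OF norm_triangle_ineq])
          show "norm (- ((U t - par (x t) (v t)) *\<^sub>R b (x t))) \<le> L1 * e" using Up by (simp add: norm_b)
          have "norm (b (x t) - b (y t)) \<le> Lb * (L3 * e)"
            using Lb(2)[OF xyR] mult_left_mono[OF yx Lb(1)] by (simp add: norm_minus_commute)
          then show "norm (U t *\<^sub>R (b (x t) - b (y t))) \<le> (\<rho> + L1) * (Lb * (L3 * e))"
            using Ub by (simp add: mult_mono)
          show "norm (e *\<^sub>R W (x t) (v t)) \<le> L3 * e" using L3(3)[OF bt] e by (simp add: mult.commute)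
        qed
        also have "\<dots> = (L1 + (\<rho> + L1) * (Lb * L3) + L3) * e" by (simp add: algebra_simps)
        also have "\<dots> \<le> C * e" using CL(4) e by (intro mult_right_mono) auto
        finally show ?thesis .
      qed
      moreover have "\<bar>s\<bar> \<le> C * e"
      proof -
        have R: "norm (x t, moment (x t) (v t)) \<le> R" "norm (y t, ?m0) \<le> R"
          using norm_Pair_le[of "x t" "moment (x t) (v t)"] norm_Pair_le[of "y t" ?m0] bt yb L3(1)
            Lm(2)[OF bt] Lm(2)[OF bd[OF zT]] unfolding R_def by linarith+
        have "\<bar>g (moment (x t) (v t)) (x t) - g ?m0 (y t)\<bar> \<le> Lg * norm ((x t, moment (x t) (v t)) - (y t, ?m0))"
          using Lg(2)[OF R] by simp
        also have "\<dots> \<le> Lg * (L3 * e + Cm * e)"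
          using norm_Pair_le[of "x t - y t" "moment (x t) (v t) - ?m0"] yx mom[OF t] Lg(1)
          by (intro mult_left_mono) (simp_all add: norm_minus_commute)
        finally have "\<bar>g (moment (x t) (v t)) (x t) - g ?m0 (y t)\<bar> \<le> Lg * (L3 * e + Cm * e)" .
        moreover have "\<bar>e * Y (x t) (v t)\<bar> \<le> L1 * e" using L1(3)[OF bt] e by (simp add: abs_mult mult.commute)
        ultimately have "\<bar>s\<bar> \<le> (Lg * (L3 + Cm) + L1) * e" unfolding s_def by (simp add: algebra_simps)
        also have "\<dots> \<le> C * e" using CL(5) e by (intro mult_right_mono) auto
        finally show ?thesis .
      qed
      moreover have "L3 * e \<le> C * e" "L1 * e \<le> C * e" using CL e by (auto intro: mult_right_mono)
      moreover have "(y has_vector_derivative U t *\<^sub>R b (y t) + r) (at t within {0..T})"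
        "(U has_vector_derivative g ?m0 (y t) + s) (at t within {0..T})"
        using dy dU by (simp_all add: r_def s_def)
      ultimately show ?thesis using bt yx Up by (meson order_trans)
    qed
    have "\<bar>?m0\<bar> \<le> C" using Lm(2)[OF bd[OF zT]] CL(1) by simp
    with main show "\<bar>?m0\<bar> \<le> C \<and> (\<exists>y U. \<forall>t\<in>{0..T}. norm (x t) \<le> \<rho> \<and> norm (v t) \<le> \<rho> \<and>
        norm (y t - x t) \<le> C * e \<and> \<bar>U t - par (x t) (v t)\<bar> \<le> C * e \<and>
        (\<exists>r s. (y has_vector_derivative U t *\<^sub>R b (y t) + r) (at t within {0..T}) \<and>
          (U has_vector_derivative g ?m0 (y t) + s) (at t within {0..T}) \<and>
          norm r \<le> C * e \<and> \<bar>s\<bar> \<le> C * e))" by blast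
  qed
qed


lemma smooth_E_b: "smooth3 (\<lambda>x. E x \<bullet> b x)" and smooth_G_b: "smooth3 (\<lambda>x. G x \<bullet> b x)"
  by (intro smooth3_inner smooth_E smooth_G smooth_b)+

lemma smooth_g: "smooth3 (g m)"
  unfolding g_def[abs_def] by (intro smooth3_diff smooth3_mult smooth3_const smooth_E_b smooth_G_b)

text \<open>Isolates the affine dependence on \<open>m\<close>, so that bounds on derivatives hold
  uniformly for bounded moments.\<close>

lemma fd_g: "fd (g m) x w = fd (\<lambda>x. E x \<bullet> b x) x w - m * fd (\<lambda>x. G x \<bullet> b x) x w"
proof -
  have "(g m has_derivative (\<lambda>w. fd (\<lambda>x. E x \<bullet> b x) x w - m * fd (\<lambda>x. G x \<bullet> b x) x w)) (at x)"
    unfolding g_def[abs_def]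
    by (intro has_derivative_diff has_derivative_mult_right smooth3_has_derivative[OF smooth_E_b]
      smooth3_has_derivative[OF smooth_G_b])
  then show ?thesis by (simp add: fd_eqI)
qed

lemma has_vector_derivative_smooth3_comp:
  assumes "smooth3 f" "(y has_vector_derivative y') (at t within S)"
  shows "((\<lambda>t. f (y t)) has_vector_derivative fd f (y t) y') (at t within S)"
  using vector_derivative_diff_chain_within[OF assms(2), of f "fd f (y t)"]
    smooth3_has_derivative[OF assms(1), of "y t"] by (simp add: o_def has_derivative_at_withinI)

text \<open>\<open>trapezoidal_defect\<close> is applied with \<open>U b(y)\<close> and with
  \<open>g m (y)\<close> as \<open>F\<close>. The derivative of each is a locally Lipschitz function
  of \<open>y\<close>, \<open>U\<close> and \<open>m\<close> plus a term of order \<open>e\<close>,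
  and \<open>y\<close>, \<open>U\<close> move with bounded speed, so the hypothesis on
  \<open>H\<close> holds.\<close>

lemma motion_trapezoidal:
  assumes T: "T \<ge> 0"
  obtains \<rho> C where "\<rho> \<ge> 0" "C \<ge> 0"
    "\<And>e x v. 0 < e \<Longrightarrow> e < 1 \<Longrightarrow> motion e T x v \<Longrightarrow> norm (x 0) \<le> M0 \<Longrightarrow> norm (v 0) \<le> M1 \<Longrightarrow>
      \<bar>moment (x 0) (v 0)\<bar> \<le> C \<and>
      (\<exists>y U. (\<forall>t\<in>{0..T}. norm (x t) \<le> \<rho> \<and> norm (v t) \<le> \<rho> \<and>
          norm (y t - x t) \<le> C * e \<and> \<bar>U t - par (x t) (v t)\<bar> \<le> C * e) \<and>
        (\<forall>t h. 0 \<le> t \<longrightarrow> 0 \<le> h \<longrightarrow> h \<le> 1 \<longrightarrow> t + h \<le> T \<longrightarrow>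
          norm (y (t + h) - y t - (h/2) *\<^sub>R (U t *\<^sub>R b (y t) + U (t + h) *\<^sub>R b (y (t + h)))) \<le> C * h * (e + h\<^sup>2) \<and>
          \<bar>U (t + h) - U t - (h/2) * (g (moment (x 0) (v 0)) (y t) + g (moment (x 0) (v 0)) (y (t + h)))\<bar>
            \<le> C * h * (e + h\<^sup>2)))"
proof -
  obtain \<rho> C where \<rho>: "\<rho> \<ge> 0" and C: "C \<ge> 0" and main:
    "\<And>e x v. 0 < e \<Longrightarrow> e < 1 \<Longrightarrow> motion e T x v \<Longrightarrow> norm (x 0) \<le> M0 \<Longrightarrow> norm (v 0) \<le> M1 \<Longrightarrow>
      \<bar>moment (x 0) (v 0)\<bar> \<le> C \<and>
      (\<exists>y U. \<forall>t\<in>{0..T}. norm (x t) \<le> \<rho> \<and> norm (v t) \<le> \<rho> \<and>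
        norm (y t - x t) \<le> C * e \<and> \<bar>U t - par (x t) (v t)\<bar> \<le> C * e \<and>
        (\<exists>r s. (y has_vector_derivative U t *\<^sub>R b (y t) + r) (at t within {0..T}) \<and>
          (U has_vector_derivative g (moment (x 0) (v 0)) (y t) + s) (at t within {0..T}) \<and>
          norm r \<le> C * e \<and> \<bar>s\<bar> \<le> C * e))"
    using motion_near_guiding_center[OF T, of M0 M1] by metis
  \<comment> \<open>The time derivatives of \<open>U b(y)\<close> and \<open>g m (y)\<close> with
    the residuals dropped, as functions of the nested pair \<open>((y, U), m)\<close>.\<close>
  let ?K1 = "\<lambda>z::(vec3 * real) * real. g (snd z) (fst (fst z)) *\<^sub>R b (fst (fst z))
    + (snd (fst z) * snd (fst z)) *\<^sub>R k (fst (fst z))"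
  let ?K2 = "\<lambda>z::(vec3 * real) * real. snd (fst z) * fd (g (snd z)) (fst (fst z)) (b (fst (fst z)))"
  have pos: "loc_lipschitz (\<lambda>z::(vec3 * real) * real. fst (fst z))" "loc_lipschitz (\<lambda>z::(vec3 * real) * real. snd (fst z))"
    by (rule lip_compose[OF lip_fst lip_fst], rule lip_compose[OF lip_fst lip_snd])
  have lg: "loc_lipschitz (\<lambda>z::(vec3 * real) * real. g (snd z) (fst (fst z)))"
    using lip_compose[OF lip_Pair[OF pos(1) lip_snd] lip_g] by simp
  have "loc_lipschitz ?K1"
    by (intro lip_add lip_scaleR lip_mult lg lip_smooth3_compose[OF smooth_b] lip_smooth3_compose[OF smooth_k] pos)
  \<comment> \<open>The radius allots \<open>\<rho> + C\<close> to each of the three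
    components.\<close>
  then obtain L1 where L1: "L1 \<ge> 0" "\<And>z z'. norm z \<le> 3 * (\<rho> + C) \<Longrightarrow> norm z' \<le> 3 * (\<rho> + C) \<Longrightarrow>
    norm (?K1 z - ?K1 z') \<le> L1 * norm (z - z')" by (rule lip_increment[where r="3 * (\<rho> + C)"]) (rule that)
  have "loc_lipschitz ?K2" unfolding fd_g
    by (intro lip_mult pos lip_diff lip_snd lip_fd smooth_E_b smooth_G_b lip_smooth3_compose[OF smooth_b])
  then obtain L2 where L2: "L2 \<ge> 0" "\<And>z z'. norm z \<le> 3 * (\<rho> + C) \<Longrightarrow> norm z' \<le> 3 * (\<rho> + C) \<Longrightarrow>
    norm (?K2 z - ?K2 z') \<le> L2 * norm (z - z')" by (rule lip_increment[where r="3 * (\<rho> + C)"]) (rule that)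
  obtain Lg where Lg: "Lg \<ge> 0" "\<And>z::(vec3 * real) * real. norm z \<le> 3 * (\<rho> + C) \<Longrightarrow> norm (g (snd z) (fst (fst z))) \<le> Lg"
    using lg by (rule lip_bound[where r="3 * (\<rho> + C)"]) (rule that)
  obtain D0 where D0: "D0 \<ge> 0" "\<And>x w. norm x \<le> \<rho> + C \<Longrightarrow> norm (fd b x w) \<le> D0 * norm w"
    using smooth3_fd_bounded[OF smooth_b] by metis
  obtain D1 where D1: "D1 \<ge> 0" "\<And>x w. norm x \<le> \<rho> + C \<Longrightarrow> norm (fd (\<lambda>x. E x \<bullet> b x) x w) \<le> D1 * norm w"
    using smooth3_fd_bounded[OF smooth_E_b] by metis
  obtain D2 where D2: "D2 \<ge> 0" "\<And>x w. norm x \<le> \<rho> + C \<Longrightarrow> norm (fd (\<lambda>x. G x \<bullet> b x) x w) \<le> D2 * norm w"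
    using smooth3_fd_bounded[OF smooth_G_b] by metis
  \<comment> \<open>\<open>V\<close> bounds the speeds of \<open>y\<close> and \<open>U\<close>;
    \<open>D * e\<close> bounds the residuals and their contributions to the derivatives of both
    \<open>F\<close>; \<open>K\<close> is the resulting Lipschitz constant in time.\<close>
  define V where "V = \<rho> + C + C + Lg"
  define D where "D = C + (\<rho> + C) * (D0 * C) + (D1 + C * D2) * C"
  define K where "K = (L1 + L2) * (2 * V)"
  have pos': "V \<ge> 0" "D \<ge> 0" "K \<ge> 0" "(\<rho> + C) * (D0 * C) \<ge> 0" "(D1 + C * D2) * C \<ge> 0"
    using \<rho> C Lg D0 D1 D2 L1 L2 by (simp_all add: V_def D_def K_def)
  show ?thesis
  proof (rule that[of \<rho> "C + 2 * D + K"])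
    show "\<rho> \<ge> 0" "C + 2 * D + K \<ge> 0" using \<rho> C pos' by auto
    fix e x v
    assume e: "0 < e" "e < 1" and m: "motion e T x v" and ini: "norm (x 0) \<le> M0" "norm (v 0) \<le> M1"
    let ?m = "moment (x 0) (v 0)"
    from main[OF e m ini] obtain y U where m0: "\<bar>?m\<bar> \<le> C" and
      yU: "\<And>t. t \<in> {0..T} \<Longrightarrow> norm (x t) \<le> \<rho> \<and> norm (v t) \<le> \<rho> \<and>
        norm (y t - x t) \<le> C * e \<and> \<bar>U t - par (x t) (v t)\<bar> \<le> C * e" and
      ex: "\<And>t. t \<in> {0..T} \<Longrightarrow> (\<exists>r s. (y has_vector_derivative U t *\<^sub>R b (y t) + r) (at t within {0..T}) \<and>
          (U has_vector_derivative g ?m (y t) + s) (at t within {0..T}) \<and>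
          norm r \<le> C * e \<and> \<bar>s\<bar> \<le> C * e)" by blast
    from ex obtain r s where
      dy: "\<And>t. t \<in> {0..T} \<Longrightarrow> (y has_vector_derivative U t *\<^sub>R b (y t) + r t) (at t within {0..T})" and
      dU: "\<And>t. t \<in> {0..T} \<Longrightarrow> (U has_vector_derivative g ?m (y t) + s t) (at t within {0..T})" and
      r: "\<And>t. t \<in> {0..T} \<Longrightarrow> norm (r t) \<le> C * e" and s: "\<And>t. t \<in> {0..T} \<Longrightarrow> \<bar>s t\<bar> \<le> C * e"
      by metis
    have Ce: "C * e \<le> C" using C e by (simp add: mult_left_le)
    have yb: "norm (y t) \<le> \<rho> + C" if "t \<in> {0..T}" for t
      using yU[OF that] norm_triangle_sub[of "y t" "x t"] Ce by linarith
    have Ub: "\<bar>U t\<bar> \<le> \<rho> + C" if "t \<in> {0..T}" for t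
    proof -
      have "\<bar>par (x t) (v t)\<bar> \<le> \<rho>"
        unfolding par_def using Cauchy_Schwarz_ineq2[of "v t" "b (x t)"] yU[OF that] norm_b by simp
      then show ?thesis using yU[OF that] Ce by linarith
    qed
    let ?z = "\<lambda>t. ((y t, U t), ?m)"
    have zb: "norm (?z t) \<le> 3 * (\<rho> + C)" if "t \<in> {0..T}" for t
      using norm_Pair_le[of "(y t, U t)" ?m] norm_Pair_le[of "y t" "U t"] yb[OF that] Ub[OF that] m0 \<rho> by simp
    have y_inc: "norm (y t - y t') \<le> V * \<bar>t - t'\<bar>" if "t \<in> {0..T}" "t' \<in> {0..T}" for t t'
    proof (rule vector_derivative_increment_le[OF dy _ that(2,1)])
      fix t assume t: "t \<in> {0..T}"
      show "norm (U t *\<^sub>R b (y t) + r t) \<le> V"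
        using norm_triangle_ineq[of "U t *\<^sub>R b (y t)" "r t"] Ub[OF t] r[OF t] Ce Lg(1)
        by (simp add: V_def norm_b)
    qed
    have U_inc: "\<bar>U t - U t'\<bar> \<le> V * \<bar>t - t'\<bar>" if "t \<in> {0..T}" "t' \<in> {0..T}" for t t'
    proof -
      have "norm (U t - U t') \<le> V * \<bar>t - t'\<bar>"
      proof (rule vector_derivative_increment_le[OF dU _ that(2,1)])
        fix t assume t: "t \<in> {0..T}"
        show "norm (g ?m (y t) + s t) \<le> V"
          using Lg(2)[OF zb[OF t]] s[OF t] Ce \<rho> C by (simp add: V_def)
      qed
      then show ?thesis by simp
    qed
    have z_inc: "norm (?z t - ?z t') \<le> (2 * V) * \<bar>t - t'\<bar>" if "t \<in> {0..T}" "t' \<in> {0..T}" for t t'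
      using norm_Pair_le[of "(y t - y t', U t - U t')" "0::real"] norm_Pair_le[of "y t - y t'" "U t - U t'"]
        y_inc[OF that] U_inc[OF that] by simp
    have H: "norm (?K1 (?z t) - ?K1 (?z t')) \<le> K * \<bar>t - t'\<bar>" "norm (?K2 (?z t) - ?K2 (?z t')) \<le> K * \<bar>t - t'\<bar>"
      if t: "t \<in> {0..T}" "t' \<in> {0..T}" for t t'
    proof -
      have "L1 * norm (?z t - ?z t') \<le> K * \<bar>t - t'\<bar>" "L2 * norm (?z t - ?z t') \<le> K * \<bar>t - t'\<bar>"
        unfolding K_def mult.assoc[of "L1 + L2"] using L1(1) L2(1)
        by (intro mult_mono[OF _ z_inc[OF t]]; simp)+
      then show "norm (?K1 (?z t) - ?K1 (?z t')) \<le> K * \<bar>t - t'\<bar>"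
        "norm (?K2 (?z t) - ?K2 (?z t')) \<le> K * \<bar>t - t'\<bar>"
        using L1(2)[OF zb[OF t(1)] zb[OF t(2)]] L2(2)[OF zb[OF t(1)] zb[OF t(2)]] by linarith+
    qed
    let ?q1 = "\<lambda>t. U t *\<^sub>R fd b (y t) (r t) + s t *\<^sub>R b (y t)" and ?q2 = "\<lambda>t. fd (g ?m) (y t) (r t)"
    have F1: "((\<lambda>t. U t *\<^sub>R b (y t)) has_vector_derivative ?K1 (?z t) + ?q1 t) (at t within {0..T})"
      if t: "t \<in> {0..T}" for t
    proof -
      interpret linear "fd b (y t)" by (rule smooth3_linear_fd[OF smooth_b])
      show ?thesis
        by (rule has_vector_derivative_eq_rhs[OF bounded_bilinear.has_vector_derivative[OF bounded_bilinear_scaleR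
          dU[OF t] has_vector_derivative_smooth3_comp[OF smooth_b dy[OF t]]]])
          (simp add: add scaleR k_def algebra_simps)
    qed
    have F2: "((\<lambda>t. g ?m (y t)) has_vector_derivative ?K2 (?z t) + ?q2 t) (at t within {0..T})"
      if t: "t \<in> {0..T}" for t
    proof -
      interpret linear "fd (g ?m) (y t)" by (rule smooth3_linear_fd[OF smooth_g])
      show ?thesis
        by (rule has_vector_derivative_eq_rhs[OF has_vector_derivative_smooth3_comp[OF smooth_g dy[OF t]]])
          (simp add: add scaleR)
    qed
    have rD: "norm (r t) \<le> D * e" "norm (s t) \<le> D * e" if t: "t \<in> {0..T}" for t
    proof -
      have "C * e \<le> D * e" using pos' e by (intro mult_right_mono) (auto simp: D_def)
      then show "norm (r t) \<le> D * e" "norm (s t) \<le> D * e" using r[OF t] s[OF t] by simp_all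
    qed
    have qD: "norm (?q1 t) \<le> D * e" "norm (?q2 t) \<le> D * e" if t: "t \<in> {0..T}" for t
    proof -
      have fr: "norm (fd b (y t) (r t)) \<le> D0 * (C * e)"
        using D0(2)[OF yb[OF t]] mult_left_mono[OF r[OF t] D0(1)] order_trans by blast
      have "norm (?q1 t) \<le> (\<rho> + C) * (D0 * (C * e)) + C * e"
        using s[OF t] Ub[OF t] fr by (intro norm_triangle_mono) (auto simp: norm_b intro!: mult_mono)
      also have "\<dots> = (C + (\<rho> + C) * (D0 * C)) * e" by (simp add: algebra_simps)
      also have "\<dots> \<le> D * e" using pos'(5) e by (intro mult_right_mono) (simp_all add: D_def)
      finally show "norm (?q1 t) \<le> D * e" .
      have "norm (?q2 t) \<le> D1 * (C * e) + C * (D2 * (C * e))"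
      proof -
        have "norm (fd (\<lambda>x. E x \<bullet> b x) (y t) (r t)) \<le> D1 * (C * e)"
          using D1(2)[OF yb[OF t]] mult_left_mono[OF r[OF t] D1(1)] order_trans by blast
        moreover have "norm (fd (\<lambda>x. G x \<bullet> b x) (y t) (r t)) \<le> D2 * (C * e)"
          using D2(2)[OF yb[OF t]] mult_left_mono[OF r[OF t] D2(1)] order_trans by blast
        then have "norm (?m * fd (\<lambda>x. G x \<bullet> b x) (y t) (r t)) \<le> C * (D2 * (C * e))"
          using m0 unfolding norm_mult by (intro mult_mono) auto
        ultimately show ?thesis unfolding fd_g using norm_triangle_ineq4 by (smt (verit))
      qed
      also have "\<dots> = ((D1 + C * D2) * C) * e" by (simp add: algebra_simps)
      also have "\<dots> \<le> D * e" using pos'(4) C e by (intro mult_right_mono) (simp_all add: D_def)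
      finally show "norm (?q2 t) \<le> D * e" .
    qed
    have fin: "h * (D * e + h * (D * e) + K * h\<^sup>2) \<le> (C + 2 * D + K) * h * (e + h\<^sup>2)"
      if h: "0 \<le> h" "h \<le> 1" for h
    proof -
      have "h * (D * e) \<le> D * e" using h pos' e by (intro mult_left_le_one_le) auto
      then have "D * e + h * (D * e) + K * h\<^sup>2 \<le> 2 * D * e + K * h\<^sup>2" by simp
      also have "\<dots> \<le> (C + 2 * D + K) * e + (C + 2 * D + K) * h\<^sup>2"
        using C pos' e by (intro add_mono mult_right_mono) auto
      finally have "D * e + h * (D * e) + K * h\<^sup>2 \<le> (C + 2 * D + K) * (e + h\<^sup>2)"
        by (simp only: distrib_left)
      from mult_left_mono[OF this h(1)] show ?thesis by (simp add: mult_ac)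
    qed
    have trap: "norm (y (t + h) - y t - (h/2) *\<^sub>R (U t *\<^sub>R b (y t) + U (t + h) *\<^sub>R b (y (t + h)))) \<le> (C + 2 * D + K) * h * (e + h\<^sup>2)"
        "norm (U (t + h) - U t - (h/2) *\<^sub>R (g ?m (y t) + g ?m (y (t + h)))) \<le> (C + 2 * D + K) * h * (e + h\<^sup>2)"
      if h: "0 \<le> t" "0 \<le> h" "h \<le> 1" "t + h \<le> T" for t h
    proof -
      have sub: "{t..t+h} \<subseteq> {0..T}" and el: "\<And>s. s \<in> {t..t+h} \<Longrightarrow> s \<in> {0..T}" using h by auto
      note ws = has_vector_derivative_within_subset[OF _ sub]
      show "norm (y (t + h) - y t - (h/2) *\<^sub>R (U t *\<^sub>R b (y t) + U (t + h) *\<^sub>R b (y (t + h)))) \<le> (C + 2 * D + K) * h * (e + h\<^sup>2)"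
        by (rule order_trans[OF trapezoidal_defect[OF ws[OF dy[OF el]] ws[OF F1[OF el]] rD(1)[OF el] qD(1)[OF el]
          H(1)[OF el el] h(2) pos'(3)] fin[OF h(2,3)]])
      show "norm (U (t + h) - U t - (h/2) *\<^sub>R (g ?m (y t) + g ?m (y (t + h)))) \<le> (C + 2 * D + K) * h * (e + h\<^sup>2)"
        by (rule order_trans[OF trapezoidal_defect[OF ws[OF dU[OF el]] ws[OF F2[OF el]] rD(2)[OF el] qD(2)[OF el]
          H(2)[OF el el] h(2) pos'(3)] fin[OF h(2,3)]])
    qed
    have "C * e \<le> (C + 2 * D + K) * e" using pos' e by (intro mult_right_mono) auto
    then have "\<forall>t\<in>{0..T}. norm (x t) \<le> \<rho> \<and> norm (v t) \<le> \<rho> \<and>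
          norm (y t - x t) \<le> (C + 2 * D + K) * e \<and> \<bar>U t - par (x t) (v t)\<bar> \<le> (C + 2 * D + K) * e"
      using yU by (meson order_trans)
    moreover have "\<bar>?m\<bar> \<le> C + 2 * D + K" using m0 pos' by simp
    ultimately show "\<bar>?m\<bar> \<le> C + 2 * D + K \<and>
      (\<exists>y U. (\<forall>t\<in>{0..T}. norm (x t) \<le> \<rho> \<and> norm (v t) \<le> \<rho> \<and>
          norm (y t - x t) \<le> (C + 2 * D + K) * e \<and> \<bar>U t - par (x t) (v t)\<bar> \<le> (C + 2 * D + K) * e) \<and>
        (\<forall>t h. 0 \<le> t \<longrightarrow> 0 \<le> h \<longrightarrow> h \<le> 1 \<longrightarrow> t + h \<le> T \<longrightarrow>
          norm (y (t + h) - y t - (h/2) *\<^sub>R (U t *\<^sub>R b (y t) + U (t + h) *\<^sub>R b (y (t + h)))) \<le> (C + 2 * D + K) * h * (e + h\<^sup>2) \<and>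
          \<bar>U (t + h) - U t - (h/2) * (g ?m (y t) + g ?m (y (t + h)))\<bar>
            \<le> (C + 2 * D + K) * h * (e + h\<^sup>2)))"
      using trap by (intro conjI exI[of _ y] exI[of _ U]) (auto simp only: real_norm_def real_scaleR_def)
  qed
qed

end

section \<open>The modified Boris method\<close>

lemma norm_cross3_le: "norm (x \<times> y) \<le> norm x * norm y"
proof (rule power2_le_imp_le)
  show "(norm (x \<times> y))\<^sup>2 \<le> (norm x * norm y)\<^sup>2"
    unfolding norm_cross_dot[symmetric] by simp
qed simp

lemma norm_le_dot_cross:
  assumes "norm b = 1"
  shows "norm z \<le> \<bar>z \<bullet> b\<bar> + norm (z \<times> b)"
proof (rule power2_le_imp_le)
  have "(norm z)\<^sup>2 = (norm (z \<times> b))\<^sup>2 + (z \<bullet> b)\<^sup>2"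
    unfolding norm_cross_dot using assms by simp
  also have "\<dots> \<le> (\<bar>z \<bullet> b\<bar> + norm (z \<times> b))\<^sup>2"
    by (simp add: power2_sum)
  finally show "(norm z)\<^sup>2 \<le> (\<bar>z \<bullet> b\<bar> + norm (z \<times> b))\<^sup>2" .
qed simp

text \<open>The inequality is implicit in \<open>s (Suc n)\<close> and granted only while
  \<open>s n \<le> R\<close>. Since the final bound is itself at most \<open>R\<close>, the
  induction keeps supplying this condition, which makes the lemma usable for bootstrapping.\<close>

lemma discrete_gronwall:
  fixes s :: "nat \<Rightarrow> real"
  assumes step: "\<And>n. n < M \<Longrightarrow> s n \<le> R \<Longrightarrow> s (Suc n) \<le> s n + h * L * (d + s n + s (Suc n))"
    and s0: "\<And>n. s n \<ge> 0" and h: "h \<ge> 0" and L: "L \<ge> 0" and d: "d \<ge> 0"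
    and hL: "h * L \<le> 1/2" and MT: "real M * h \<le> T"
    and R: "exp (4 * L * T) * (s 0 + d/2) \<le> R" and n: "n \<le> M"
  shows "s n \<le> exp (4 * L * T) * (s 0 + d/2)"
proof -
  have pw: "(1 + 4 * (h * L)) ^ n * (s 0 + d/2) \<le> exp (4 * L * T) * (s 0 + d/2)" if "n \<le> M" for n
  proof (rule mult_right_mono)
    have hL0: "h * L \<ge> 0" using h L by simp
    have "(1 + 4 * (h * L)) ^ n \<le> exp (4 * (h * L)) ^ n"
      using hL0 by (intro power_mono exp_ge_add_one_self) simp
    also have "\<dots> = exp (4 * L * (real n * h))" by (simp add: exp_of_nat_mult[symmetric] mult_ac)
    also have "\<dots> \<le> exp (4 * L * T)"
    proof -
      have "real n * h \<le> real M * h" using that h by (intro mult_right_mono) auto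
      then have "4 * L * (real n * h) \<le> 4 * L * T" using MT L by (intro mult_left_mono) auto
      then show ?thesis by simp
    qed
    finally show "(1 + 4 * (h * L)) ^ n \<le> exp (4 * L * T)" .
    show "0 \<le> s 0 + d/2" using s0[of 0] d by simp
  qed
  have "s n + d/2 \<le> (1 + 4 * (h * L)) ^ n * (s 0 + d/2)"
    using n
  proof (induction n)
    case (Suc n)
    \<comment> \<open>The shift by \<open>d/2\<close> absorbs the inhomogeneity, because
      \<open>d\<close> is split equally between the two time levels.\<close>
    define \<sigma> where "\<sigma> = s n + d/2"
    define \<sigma>' where "\<sigma>' = s (Suc n) + d/2"
    have IH: "\<sigma> \<le> (1 + 4 * (h * L)) ^ n * (s 0 + d/2)" using Suc by (simp add: \<sigma>_def)
    with pw[of n] Suc.prems R d have "s n \<le> R" by (simp add: \<sigma>_def)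
    then have "\<sigma>' \<le> \<sigma> + (h * L) * (\<sigma> + \<sigma>')" using step[of n] Suc.prems by (simp add: \<sigma>_def \<sigma>'_def algebra_simps)
    then have 1: "(1 - h * L) * \<sigma>' \<le> (1 + h * L) * \<sigma>" by (simp add: algebra_simps)
    have \<sigma>0: "\<sigma> \<ge> 0" using s0[of n] d by (simp add: \<sigma>_def)
    \<comment> \<open>This is \<open>(1 + y) / (1 - y) \<le> 1 + 4 y\<close> for
      \<open>y = h * L\<close>, valid for \<open>y\<close> up to 1/2; hence the factor 4 in the
      exponent.\<close>
    have "(1 - h * L) * (1 + 4 * (h * L)) - (1 + h * L) = 2 * (h * L) * (1 - 2 * (h * L))" by (simp add: algebra_simps)
    also have "\<dots> \<ge> 0" using hL h L by simp
    finally have "1 + h * L \<le> (1 - h * L) * (1 + 4 * (h * L))" by simp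
    from mult_right_mono[OF this \<sigma>0] 1 have "(1 - h * L) * \<sigma>' \<le> (1 - h * L) * ((1 + 4 * (h * L)) * \<sigma>)"
      by (simp add: mult.assoc)
    then have "\<sigma>' \<le> (1 + 4 * (h * L)) * \<sigma>" using hL by (subst (asm) mult_le_cancel_left_pos) auto
    also have "\<dots> \<le> (1 + 4 * (h * L)) * ((1 + 4 * (h * L)) ^ n * (s 0 + d/2))"
      using IH h L by (intro mult_left_mono) auto
    finally show ?case by (simp add: \<sigma>'_def mult_ac)
  qed simp
  with pw[OF n] d show ?thesis by linarith
qed

context charged_particle
begin

definition "force m x = E x - m *\<^sub>R G x"
definition "qcurv x v = - (v \<times> fd B x v)"
text \<open>The acceleration of a numerical solution without oscillations: its component along \<open>b\<close> is forced, and
  differentiating the equation \<open>v \<times> B = O(\<epsilon>)\<close> shows that its cross product with \<open>B\<close> is \<open>qcurv\<close>.\<close>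

definition "slow m x v = g m x *\<^sub>R b x + p x \<times> qcurv x v"

text \<open>The two-step method in velocity Verlet form.\<close>

definition boris_step where
  "boris_step e h m x v a x' v' a' \<longleftrightarrow> x' = x + h *\<^sub>R v + (h\<^sup>2/2) *\<^sub>R a \<and> v' = v + (h/2) *\<^sub>R (a + a') \<and>
    a = (1/e) *\<^sub>R (v \<times> B x) + force m x \<and> a' = (1/e) *\<^sub>R (v' \<times> B x') + force m x'"

lemma boris_acc_parallel:
  assumes "a = (1/e) *\<^sub>R (v \<times> B x) + force m x"
  shows "a \<bullet> b x = g m x"
  by (simp add: assms inner_add_left cross_B gyr_orth force_def g_def inner_diff_left)

lemma boris_acc_cross:
  assumes "a = (1/e) *\<^sub>R (v \<times> B x) + force m x" "e > 0"
  shows "v \<times> B x = e *\<^sub>R (a - force m x)"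
  using assms by simp

lemma p_B: "p x \<bullet> B x = 1"
  using N_pos[of x] by (simp add: p_def B_eq b_b)

text \<open>Crossing with \<open>p x\<close> and then with \<open>B x\<close> recovers
  \<open>qcurv x v\<close> only up to its component along the field; by \<open>qcurv_B\<close> that
  component is small along the scheme.\<close>

lemma slow_cross: "slow m x v \<times> B x = qcurv x v - (qcurv x v \<bullet> B x) *\<^sub>R p x"
proof -
  have "b x \<times> B x = 0" by (simp add: B_eq cross_mult_right)
  then show ?thesis
    by (simp add: slow_def cross_add_left cross_mult_left triple_cross_left p_B)
qed

lemma slow_parallel: "slow m x v \<bullet> b x = g m x"
proof -
  have "(p x \<times> qcurv x v) \<bullet> b x = 0" by (simp add: p_def cross_mult_left dot_cross_self)
  then show ?thesis by (simp add: slow_def inner_add_left b_b)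
qed

text \<open>Permuting the triple product exposes \<open>v \<times> B x\<close>, which by
  \<open>boris_acc_cross\<close> carries a factor \<open>e\<close>.\<close>

lemma qcurv_B: "qcurv x v \<bullet> B x = fd B x v \<bullet> (v \<times> B x)"
  by (simp add: qcurv_def cross3_simps)

text \<open>Converts a bounded acceleration into a perpendicular velocity of order \<open>e\<close>,
  because \<open>v \<times> B x\<close> is \<open>e\<close> times acceleration minus force and the
  field strength is at least 1.\<close>

lemma norm_perp_le: "norm (perp x v) \<le> norm (v \<times> B x)"
proof -
  have "norm (perp x v) \<le> norm (gyr x v)"
    using norm_le_dot_cross[OF norm_b, of "perp x v" x] by (simp add: gyr_orth perp_cross_b)
  also have "\<dots> \<le> N x * norm (gyr x v)" using N_ge[of x] by (simp add: mult_le_cancel_right1)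
  finally show ?thesis using N_pos[of x] by (simp add: cross_B)
qed

lemma lip_slow: "loc_lipschitz (\<lambda>z. slow (snd z) (fst (fst z)) (snd (fst z)))"
  and lip_qcurv: "loc_lipschitz (\<lambda>z. qcurv (fst z) (snd z))"
  and lip_force: "loc_lipschitz (\<lambda>z. force (snd z) (fst z))"
proof -
  show q: "loc_lipschitz (\<lambda>z. qcurv (fst z) (snd z))"
    unfolding qcurv_def by (intro lip_minus lip_cross lip_snd lip_fd B_smooth lip_fst)
  show "loc_lipschitz (\<lambda>z. force (snd z) (fst z))"
    unfolding force_def by (intro lip_diff lip_scaleR lip_snd lip_smooth3_compose[OF smooth_E]
      lip_smooth3_compose[OF smooth_G] lip_fst)
  have pos: "loc_lipschitz (\<lambda>z::(vec3 * vec3) * real. fst (fst z))" "loc_lipschitz (\<lambda>z::(vec3 * vec3) * real. snd (fst z))"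
    by (rule lip_compose[OF lip_fst lip_fst], rule lip_compose[OF lip_fst lip_snd])
  have lg: "loc_lipschitz (\<lambda>z::(vec3 * vec3) * real. g (snd z) (fst (fst z)))"
    using lip_compose[OF lip_Pair[OF pos(1) lip_snd] lip_g] by simp
  show "loc_lipschitz (\<lambda>z. slow (snd z) (fst (fst z)) (snd (fst z)))"
    unfolding slow_def by (intro lip_add lip_scaleR lip_cross lg lip_smooth3_compose[OF smooth_b]
      lip_smooth3_compose[OF smooth_p] pos lip_compose[OF lip_fst q])
qed

text \<open>Consecutive accelerations add up to twice the slow acceleration up to \<open>O(h)\<close>: the
  rotation by almost \<open>\<pi>\<close> makes the remainder flip its sign in each step.\<close>

lemma boris_step_residual:
  assumes cs: "cs > 0"
  obtains C where "C \<ge> 0" "\<And>e h m x v a x' v' a'. boris_step e h m x v a x' v' a' \<Longrightarrow>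
    0 < e \<Longrightarrow> 0 < h \<Longrightarrow> h \<le> 1 \<Longrightarrow> cs * e \<le> h\<^sup>2 \<Longrightarrow> \<bar>m\<bar> \<le> r \<Longrightarrow> norm x \<le> r \<Longrightarrow> norm x' \<le> r \<Longrightarrow>
    norm v \<le> r \<Longrightarrow> norm v' \<le> r \<Longrightarrow> h * norm a \<le> 1 \<Longrightarrow>
    norm (a' - slow m x' v') \<le> norm (a - slow m x v)
      + h * C * (1 + norm (a - slow m x v) + norm (a' - slow m x' v'))"
proof -
  obtain Lf where Lf: "Lf \<ge> 0" "\<And>z. norm z \<le> 2 * r \<Longrightarrow> norm (force (snd z) (fst z)) \<le> Lf"
    by (rule lip_bound[OF lip_force, where r="2*r"]) (rule that)
  obtain Lc where Lc: "Lc \<ge> 0" "\<And>z. norm z \<le> 3 * r \<Longrightarrow> norm (slow (snd z) (fst (fst z)) (snd (fst z))) \<le> Lc"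
    by (rule lip_bound[OF lip_slow, where r="3*r"]) (rule that)
  obtain Lq where Lq: "Lq \<ge> 0" "\<And>z z'. norm z \<le> 2 * r \<Longrightarrow> norm z' \<le> 2 * r \<Longrightarrow>
      norm (qcurv (fst z) (snd z) - qcurv (fst z') (snd z')) \<le> Lq * norm (z - z')"
    by (rule lip_increment[OF lip_qcurv, where r="2*r"]) (rule that)
  obtain LB where LB: "LB \<ge> 0" "\<And>x y. norm x \<le> r \<Longrightarrow> norm y \<le> r \<Longrightarrow> norm (B x - B y) \<le> LB * norm (x - y)"
    by (rule lip_increment[OF lip_smooth3[OF B_smooth], where r=r]) (rule that)
  obtain Lb where Lb: "Lb \<ge> 0" "\<And>x y. norm x \<le> r \<Longrightarrow> norm y \<le> r \<Longrightarrow> norm (b x - b y) \<le> Lb * norm (x - y)"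
    by (rule lip_increment[OF lip_smooth3[OF smooth_b], where r=r]) (rule that)
  obtain Lp where Lp: "Lp \<ge> 0" "\<And>x. norm x \<le> r \<Longrightarrow> norm (p x) \<le> Lp"
    by (rule lip_bound[OF lip_smooth3[OF smooth_p], where r=r]) (rule that)
  obtain LT where LT: "LT \<ge> 0"
    "\<And>x y. norm x \<le> r \<Longrightarrow> norm y \<le> r \<Longrightarrow> norm (B y - B x - fd B x (y - x)) \<le> LT * (norm (y - x))\<^sup>2"
    by (rule smooth3_taylor[OF B_smooth, where r=r]) (rule that)
  obtain LD where LD: "LD \<ge> 0" "\<And>x w. norm x \<le> r \<Longrightarrow> norm (fd B x w) \<le> LD * norm w"
    by (rule smooth3_fd_bounded[OF B_smooth, where r=r]) (rule that)
  \<comment> \<open>\<open>\<kappa>\<close> serves in the bound of an acceleration by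
    \<open>\<kappa> * Q\<close>, and \<open>D\<close> in the bound of the displacement by
    \<open>h * D\<close>.\<close>
  define \<kappa> where "\<kappa> = 1 + Lc"
  define D where "D = \<bar>r\<bar> + 1"
  \<comment> \<open>The summands are the constants of \<open>t1\<close> to \<open>t4\<close>, then
    \<open>t5\<close> and \<open>t6\<close> together, \<open>t7\<close>, and finally
    \<open>par\<close>.\<close>
  define C where "C = (2 / cs) * (2 * \<kappa> + 2 * Lf) + Lq * (D + 2 * \<kappa>) + \<bar>r\<bar> * LD * \<kappa> + 2 * \<bar>r\<bar> * LT * D\<^sup>2
    + 2 * ((1 / cs) * (LD * \<bar>r\<bar> * (\<kappa> + Lf)) * Lp) + Lc * LB * D + Lb * D"
  have pos: "\<kappa> \<ge> 1" "D \<ge> 1" using Lc by (simp_all add: \<kappa>_def D_def)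
  have C0: "C \<ge> 0" unfolding C_def using pos Lf Lc Lq LB Lb Lp LT LD cs by (intro add_nonneg_nonneg mult_nonneg_nonneg) auto
  show ?thesis
  proof (rule that[OF C0])
    fix e h m x v a x' v' a'
    assume st: "boris_step e h m x v a x' v' a'" and e: "0 < e" and h: "0 < h" "h \<le> 1" and he: "cs * e \<le> h\<^sup>2"
      and bd: "\<bar>m\<bar> \<le> r" "norm x \<le> r" "norm x' \<le> r" "norm v \<le> r" "norm v' \<le> r" and ha: "h * norm a \<le> 1"
    have x': "x' = x + h *\<^sub>R v + (h\<^sup>2/2) *\<^sub>R a" and v': "v' = v + (h/2) *\<^sub>R (a + a')"
      and aa: "a = (1/e) *\<^sub>R (v \<times> B x) + force m x" and aa': "a' = (1/e) *\<^sub>R (v' \<times> B x') + force m x'"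
      using st unfolding boris_step_def by blast+
    have r0: "\<bar>r\<bar> = r" using bd(2) norm_ge_zero[of x] by linarith
    have r0': "0 \<le> r" using r0 by linarith
    have eh: "e \<le> (1/cs) * h\<^sup>2" using he cs by (simp add: field_simps)
    have h2: "h\<^sup>2 \<le> h" using h by (simp add: power2_eq_square mult_left_le)
    have eh1: "e \<le> (1/cs) * h" by (rule order_trans[OF eh mult_left_mono[OF h2]]) (use cs in simp)
    let ?c = "slow m x v" and ?c' = "slow m x' v'" and ?f = "force m x" and ?f' = "force m x'"
    define s where "s = a - ?c"
    define s' where "s' = a' - ?c'"
    \<comment> \<open>All errors are estimated by multiples of \<open>h * Q\<close>, linear in the
      unknown residuals as Gronwall requires. The hypothesis \<open>h * norm a \<le> 1\<close> makes
      the displacement bound free of \<open>Q\<close>, so no squares of \<open>Q\<close>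
      appear.\<close>
    define Q where "Q = 1 + norm s + norm s'"
    have Q1: "Q \<ge> 1" by (simp add: Q_def)
    have nz: "norm ((x, v), m) \<le> 3 * r" "norm ((x', v'), m) \<le> 3 * r"
      using norm_Pair_le[of "(x, v)" m] norm_Pair_le[of x v] norm_Pair_le[of "(x', v')" m] norm_Pair_le[of x' v'] bd by auto
    have c: "norm ?c \<le> Lc" "norm ?c' \<le> Lc" using Lc(2)[OF nz(1)] Lc(2)[OF nz(2)] by simp_all
    have nf: "norm (x, m) \<le> 2 * r" "norm (x', m) \<le> 2 * r"
      using norm_Pair_le[of x m] norm_Pair_le[of x' m] bd by auto
    have f: "norm ?f \<le> Lf" "norm ?f' \<le> Lf" using Lf(2)[OF nf(1)] Lf(2)[OF nf(2)] by simp_all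
    have xk: "y \<le> y * Q" if "y \<ge> 0" for y using that Q1 by (simp add: mult_le_cancel_left1)
    have ak: "norm a \<le> \<kappa> * Q" "norm a' \<le> \<kappa> * Q"
    proof -
      have "norm a \<le> norm s + Lc" "norm a' \<le> norm s' + Lc"
        using norm_triangle_sub[of a ?c] norm_triangle_sub[of a' ?c'] c by (simp_all add: s_def s'_def)
      moreover have "Lc \<le> Lc * Q" by (rule xk[OF Lc(1)])
      moreover have "norm s \<le> Q" "norm s' \<le> Q" by (simp_all add: Q_def)
      ultimately show "norm a \<le> \<kappa> * Q" "norm a' \<le> \<kappa> * Q"
        unfolding \<kappa>_def distrib_right mult_1 by linarith+
    qed
    have dx: "norm (x' - x) \<le> h * D"
    proof -
      have "norm (x' - x) \<le> norm (h *\<^sub>R v) + norm ((h\<^sup>2/2) *\<^sub>R a)"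
        unfolding x' using norm_triangle_ineq[of "h *\<^sub>R v" "(h\<^sup>2/2) *\<^sub>R a"] by (simp add: algebra_simps)
      also have "\<dots> = h * (norm v + (h * norm a) / 2)" using h by (simp add: power2_eq_square algebra_simps)
      also have "\<dots> \<le> h * D" using ha bd(4) h r0 by (intro mult_left_mono) (auto simp: D_def)
      finally show ?thesis .
    qed
    have dv: "norm (v' - v) \<le> h * (\<kappa> * Q)"
    proof -
      have "norm (v' - v) = (h/2) * norm (a + a')" using h by (simp add: v')
      also have "\<dots> \<le> (h/2) * (\<kappa> * Q + \<kappa> * Q)"
        using h by (intro mult_left_mono norm_triangle_mono ak) auto
      finally show ?thesis by (simp add: mult.commute)
    qed
    have dB: "norm (B x' - B x) \<le> LB * (h * D)"
      using LB(2)[OF bd(3,2)] mult_left_mono[OF dx LB(1)] by linarith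
    define \<rho> where "\<rho> = B x' - B x - fd B x (x' - x)"
    have \<rho>: "norm \<rho> \<le> LT * (h * D)\<^sup>2"
    proof -
      have "norm \<rho> \<le> LT * (norm (x' - x))\<^sup>2" unfolding \<rho>_def by (rule LT(2)[OF bd(2,3)])
      also have "\<dots> \<le> LT * (h * D)\<^sup>2" using dx LT(1) by (intro mult_left_mono power_mono) auto
      finally show ?thesis .
    qed
    interpret linear "fd B x" by (rule smooth3_linear_fd[OF B_smooth])
    have vB: "v \<times> B x = e *\<^sub>R (a - ?f)" "v' \<times> B x' = e *\<^sub>R (a' - ?f')"
      using boris_acc_cross[OF aa e] boris_acc_cross[OF aa' e] by auto
    \<comment> \<open>The same vector is computed in two ways: from the equation
      \<open>v \<times> B x = e *\<^sub>R (a - force)\<close> at both ends, and from the velocity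
      update. Equating them gives \<open>aB\<close>.\<close>
    have "(2/h) *\<^sub>R ((v' - v) \<times> B x') = (2/h) *\<^sub>R (v' \<times> B x' - v \<times> B x - v \<times> (B x' - B x))"
      by (simp add: Cross3.left_diff_distrib Cross3.right_diff_distrib)
    moreover have "(2/h) *\<^sub>R ((v' - v) \<times> B x') = (a + a') \<times> B x'"
      using h by (simp add: v' cross_mult_left)
    moreover have "v \<times> (B x' - B x) = h *\<^sub>R (v \<times> fd B x v) + (h\<^sup>2/2) *\<^sub>R (v \<times> fd B x a) + v \<times> \<rho>"
    proof -
      have "B x' - B x = fd B x (h *\<^sub>R v + (h\<^sup>2/2) *\<^sub>R a) + \<rho>" by (simp add: \<rho>_def x')
      then show ?thesis by (simp add: add scaleR cross_add_right cross_mult_right)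
    qed
    ultimately have "(a + a') \<times> B x' = (2/h) *\<^sub>R (e *\<^sub>R (a' - ?f') - e *\<^sub>R (a - ?f)
        - (h *\<^sub>R (v \<times> fd B x v) + (h\<^sup>2/2) *\<^sub>R (v \<times> fd B x a) + v \<times> \<rho>))" by (simp only: vB)
    also have "\<dots> = (2 * e / h) *\<^sub>R ((a' - ?f') - (a - ?f)) + 2 *\<^sub>R qcurv x v - h *\<^sub>R (v \<times> fd B x a) - (2/h) *\<^sub>R (v \<times> \<rho>)"
      using h by (simp add: qcurv_def algebra_simps power2_eq_square)
    finally have aB: "(a + a') \<times> B x' = (2 * e / h) *\<^sub>R ((a' - ?f') - (a - ?f)) + 2 *\<^sub>R qcurv x v
        - h *\<^sub>R (v \<times> fd B x a) - (2/h) *\<^sub>R (v \<times> \<rho>)" .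
    \<comment> \<open>The two slow accelerations remove \<open>2 *\<^sub>R qcurv x v\<close> up to
      an increment of \<open>qcurv\<close> over one step, which is again of order
      \<open>h\<close>.\<close>
    have "(s' + s) \<times> B x' = (a + a') \<times> B x' - ?c' \<times> B x' - ?c \<times> B x - ?c \<times> (B x' - B x)"
      by (simp add: s_def s'_def Cross3.left_diff_distrib Cross3.right_diff_distrib cross_add_left algebra_simps)
    also have "\<dots> = (2 * e / h) *\<^sub>R ((a' - ?f') - (a - ?f)) + (qcurv x v - qcurv x' v')
        - h *\<^sub>R (v \<times> fd B x a) - (2/h) *\<^sub>R (v \<times> \<rho>)
        + (qcurv x' v' \<bullet> B x') *\<^sub>R p x' + (qcurv x v \<bullet> B x) *\<^sub>R p x - ?c \<times> (B x' - B x)"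
      unfolding aB slow_cross by (simp add: scaleR_2)
    finally have sB: "(s' + s) \<times> B x' = \<dots>" .
    have nq: "norm (x, v) \<le> 2 * r" "norm (x', v') \<le> 2 * r"
      using norm_Pair_le[of x v] norm_Pair_le[of x' v'] bd by auto
    have t1: "norm ((2 * e / h) *\<^sub>R ((a' - ?f') - (a - ?f))) \<le> h * ((2 / cs) * (2 * \<kappa> + 2 * Lf)) * Q"
    proof -
      have "norm ((a' - ?f') - (a - ?f)) \<le> (\<kappa> * Q + Lf) + (\<kappa> * Q + Lf)"
        using ak f by (intro order_trans[OF norm_triangle_ineq4] add_mono) auto
      also have "\<dots> \<le> (2 * \<kappa> + 2 * Lf) * Q" using xk[OF Lf(1)] by (simp add: algebra_simps)
      finally have n: "norm ((a' - ?f') - (a - ?f)) \<le> (2 * \<kappa> + 2 * Lf) * Q" .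
      have "2 * e / h \<le> h * (2 / cs)" using eh h cs by (simp add: field_simps power2_eq_square)
      then have "norm ((2 * e / h) *\<^sub>R ((a' - ?f') - (a - ?f))) \<le> (h * (2 / cs)) * ((2 * \<kappa> + 2 * Lf) * Q)"
        using n e h cs by (simp only: norm_scaleR) (intro mult_mono, auto)
      then show ?thesis by (simp add: mult_ac)
    qed
    have t2: "norm (qcurv x v - qcurv x' v') \<le> h * (Lq * (D + 2 * \<kappa>)) * Q"
    proof -
      have "norm (qcurv x v - qcurv x' v') \<le> Lq * norm ((x, v) - (x', v'))" using Lq(2)[OF nq] by simp
      also have "\<dots> \<le> Lq * (h * D * Q + h * (\<kappa> * Q))"
      proof -
        have "norm ((x, v) - (x', v')) \<le> h * D + h * (\<kappa> * Q)"
          using norm_Pair_le[of "x - x'" "v - v'"] dx dv by (simp add: norm_minus_commute)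
        moreover have "h * D \<le> h * D * Q" using h pos by (intro xk) auto
        ultimately show ?thesis using Lq(1) by (intro mult_left_mono) auto
      qed
      also have "\<dots> \<le> h * (Lq * (D + 2 * \<kappa>)) * Q" using h Lq(1) pos Q1 by (simp add: algebra_simps)
      finally show ?thesis .
    qed
    have t3: "norm (h *\<^sub>R (v \<times> fd B x a)) \<le> h * (\<bar>r\<bar> * LD * \<kappa>) * Q"
    proof -
      have "norm (v \<times> fd B x a) \<le> r * (LD * (\<kappa> * Q))"
        using bd(4) r0' LD(2)[OF bd(2), of a] mult_left_mono[OF ak(1) LD(1)]
        by (intro order_trans[OF norm_cross3_le] mult_mono) auto
      then show ?thesis using h r0 by (simp add: mult_ac)
    qed
    have t4: "norm ((2/h) *\<^sub>R (v \<times> \<rho>)) \<le> h * (2 * \<bar>r\<bar> * LT * D\<^sup>2) * Q"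
    proof -
      have "norm (v \<times> \<rho>) \<le> r * (LT * (h * D)\<^sup>2)"
        using bd(4) r0' \<rho> by (intro order_trans[OF norm_cross3_le] mult_mono) auto
      then have "norm ((2/h) *\<^sub>R (v \<times> \<rho>)) \<le> (2/h) * (r * (LT * (h * D)\<^sup>2))"
        using h by (simp add: divide_right_mono)
      also have "\<dots> = h * (2 * \<bar>r\<bar> * LT * D\<^sup>2)" using h r0 by (simp add: power2_eq_square)
      also have "\<dots> \<le> h * (2 * \<bar>r\<bar> * LT * D\<^sup>2) * Q" using h LT(1) by (intro xk) auto
      finally show ?thesis .
    qed
    \<comment> \<open>The leftover of \<open>slow_cross\<close>: it is proportional to
      \<open>w \<times> B y\<close>, of order \<open>e\<close>, and
      \<open>e \<le> h / cs\<close>.\<close>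
    have qB: "norm ((qcurv y w \<bullet> B y) *\<^sub>R p y) \<le> h * ((1 / cs) * (LD * \<bar>r\<bar> * (\<kappa> + Lf)) * Lp) * Q"
      if y: "norm y \<le> r" "norm w \<le> r" "w \<times> B y = e *\<^sub>R (\<alpha> - F)" "norm \<alpha> \<le> \<kappa> * Q" "norm F \<le> Lf" for y w \<alpha> F
    proof -
      have "norm (\<alpha> - F) \<le> (\<kappa> + Lf) * Q"
        using norm_triangle_ineq4[of \<alpha> F] y(4,5) xk[OF Lf(1)] by (simp add: algebra_simps)
      then have "norm (w \<times> B y) \<le> ((1/cs) * h) * ((\<kappa> + Lf) * Q)"
        unfolding y(3) using e h cs eh1 by (simp only: norm_scaleR) (intro mult_mono, auto)
      moreover have "norm (fd B y w) \<le> LD * \<bar>r\<bar>"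
        using LD(2)[OF y(1), of w] mult_left_mono[OF y(2) LD(1)] r0 by simp
      ultimately have "\<bar>fd B y w \<bullet> (w \<times> B y)\<bar> \<le> (LD * \<bar>r\<bar>) * (((1/cs) * h) * ((\<kappa> + Lf) * Q))"
        using LD(1) by (intro order_trans[OF Cauchy_Schwarz_ineq2] mult_mono) auto
      then have "norm ((qcurv y w \<bullet> B y) *\<^sub>R p y) \<le> ((LD * \<bar>r\<bar>) * (((1/cs) * h) * ((\<kappa> + Lf) * Q))) * Lp"
        unfolding qcurv_B norm_scaleR using Lp(2)[OF y(1)] by (intro mult_mono) auto
      then show ?thesis by (simp add: mult_ac)
    qed
    note t5 = qB[OF bd(3,5) vB(2) ak(2) f(2)] and t6 = qB[OF bd(2,4) vB(1) ak(1) f(1)]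
    have t7: "norm (?c \<times> (B x' - B x)) \<le> h * (Lc * LB * D) * Q"
    proof -
      have "norm (?c \<times> (B x' - B x)) \<le> Lc * (LB * (h * D))"
        using c dB Lc(1) by (intro order_trans[OF norm_cross3_le] mult_mono) auto
      also have "\<dots> \<le> Lc * (LB * (h * D)) * Q" using Lc(1) LB(1) h pos by (intro xk) auto
      finally show ?thesis by (simp add: mult_ac)
    qed
    have "norm ((s' + s) \<times> B x') \<le> h * ((2 / cs) * (2 * \<kappa> + 2 * Lf)) * Q + h * (Lq * (D + 2 * \<kappa>)) * Q
      + h * (\<bar>r\<bar> * LD * \<kappa>) * Q + h * (2 * \<bar>r\<bar> * LT * D\<^sup>2) * Q
      + h * ((1 / cs) * (LD * \<bar>r\<bar> * (\<kappa> + Lf)) * Lp) * Q + h * ((1 / cs) * (LD * \<bar>r\<bar> * (\<kappa> + Lf)) * Lp) * Q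
      + h * (Lc * LB * D) * Q"
      unfolding sB
      by (intro order_trans[OF norm_triangle_ineq] order_trans[OF norm_triangle_ineq4] add_mono t1 t2 t3 t4 t5 t6 t7)
    also have "\<dots> = h * (C - Lb * D) * Q" by (simp add: C_def algebra_simps)
    finally have perp: "norm ((s' + s) \<times> B x') \<le> h * (C - Lb * D) * Q" .
    have "norm ((s' + s) \<times> b x') \<le> N x' * norm ((s' + s) \<times> b x')"
      using N_ge[of x'] by (simp add: mult_le_cancel_right1)
    also have "\<dots> = norm ((s' + s) \<times> B x')" using N_pos[of x'] by (simp add: B_eq cross_mult_right)
    finally have perp': "norm ((s' + s) \<times> b x') \<le> h * (C - Lb * D) * Q" using perp by simp
    \<comment> \<open>Acceleration and slow acceleration have the same parallel component, so the
      residuals are orthogonal to the field at their own points, and the parallel part of the sum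
      only sees the change of \<open>b\<close>.\<close>
    have sb: "s \<bullet> b x = 0" "s' \<bullet> b x' = 0"
      using boris_acc_parallel[OF aa] boris_acc_parallel[OF aa'] by (simp_all add: s_def s'_def inner_diff_left slow_parallel)
    have "\<bar>(s' + s) \<bullet> b x'\<bar> = \<bar>s \<bullet> (b x' - b x)\<bar>" using sb by (simp add: inner_add_left inner_diff_right)
    also have "\<dots> \<le> norm s * norm (b x' - b x)" by (rule Cauchy_Schwarz_ineq2)
    also have "\<dots> \<le> Q * (Lb * (h * D))"
      using Lb(2)[OF bd(3,2)] mult_left_mono[OF dx Lb(1)] Q1 by (intro mult_mono) (auto simp: Q_def)
    finally have par: "\<bar>(s' + s) \<bullet> b x'\<bar> \<le> h * (Lb * D) * Q" by (simp add: mult_ac)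
    have "norm s' \<le> norm (s' + s) + norm s" using norm_triangle_ineq4[of "s' + s" s] by simp
    also have "norm (s' + s) \<le> h * (Lb * D) * Q + h * (C - Lb * D) * Q"
      using norm_le_dot_cross[OF norm_b, of "s' + s" x'] par perp' by linarith
    also have "\<dots> = h * C * Q" by (simp add: algebra_simps)
    finally show "norm (a' - slow m x' v') \<le> norm (a - slow m x v)
      + h * C * (1 + norm (a - slow m x v) + norm (a' - slow m x' v'))"
      by (simp add: s_def s'_def Q_def)
  qed
qed


text \<open>These corrections cancel the part of the numerical solution that alternates with the parity of
  the step, so that the corrected pair satisfies the trapezoidal rule for the guiding-center equations.\<close>

definition "xcor h x a = x + (h\<^sup>2/4) *\<^sub>R (a::vec3)"
definition "ucor h x v a = v \<bullet> b x + (h\<^sup>2/4) * (a \<bullet> fd b x v)"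

lemma par_le: "\<bar>par x v\<bar> \<le> norm v"
  unfolding par_def using Cauchy_Schwarz_ineq2[of v "b x"] norm_b by simp

text \<open>A bounded acceleration suffices: the shifts carry \<open>h^2/4\<close>, and
  \<open>v \<times> B x = e *\<^sub>R (a - force m x)\<close> with \<open>e \<le> h^2 / cs\<close>
  makes the perpendicular velocity equally small. The comparisons at the corrected position follow
  from Lipschitz bounds.\<close>

lemma boris_corrections:
  assumes cs: "cs > 0"
  obtains C where "C \<ge> 0" "\<And>e h m x v a. a = (1/e) *\<^sub>R (v \<times> B x) + force m x \<Longrightarrow>
    0 < e \<Longrightarrow> 0 < h \<Longrightarrow> h \<le> 1 \<Longrightarrow> cs * e \<le> h\<^sup>2 \<Longrightarrow> \<bar>m\<bar> \<le> r \<Longrightarrow> norm x \<le> r \<Longrightarrow>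
    norm v \<le> r \<Longrightarrow> norm a \<le> R \<Longrightarrow>
    norm (xcor h x a - x) \<le> C * h\<^sup>2 \<and> \<bar>ucor h x v a - par x v\<bar> \<le> C * h\<^sup>2 \<and> norm (perp x v) \<le> C * h\<^sup>2 \<and>
    norm (v - ucor h x v a *\<^sub>R b (xcor h x a)) \<le> C * h\<^sup>2 \<and> \<bar>g m (xcor h x a) - g m x\<bar> \<le> C * h\<^sup>2"
proof -
  \<comment> \<open>No sign of \<open>R\<close> and \<open>r\<close> is known at this point, so the
    constants are formed with absolute values.\<close>
  define R' where "R' = \<bar>R\<bar>"
  have R'0: "R' \<ge> 0" by (simp add: R'_def)
  obtain Lf where Lf: "Lf \<ge> 0" "\<And>z. norm z \<le> 2 * r \<Longrightarrow> norm (force (snd z) (fst z)) \<le> Lf"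
    by (rule lip_bound[OF lip_force, where r="2*r"]) (rule that)
  obtain LD where LD: "LD \<ge> 0" "\<And>x w. norm x \<le> r \<Longrightarrow> norm (fd b x w) \<le> LD * norm w"
    by (rule smooth3_fd_bounded[OF smooth_b, where r=r]) (rule that)
  obtain Lb where Lb: "Lb \<ge> 0" "\<And>x y. norm x \<le> r + R' \<Longrightarrow> norm y \<le> r + R' \<Longrightarrow> norm (b x - b y) \<le> Lb * norm (x - y)"
    by (rule lip_increment[OF lip_smooth3[OF smooth_b], where r="r + R'"]) (rule that)
  obtain Lg where Lg: "Lg \<ge> 0" "\<And>z z'. norm z \<le> 2 * r + R' \<Longrightarrow> norm z' \<le> 2 * r + R' \<Longrightarrow>
      norm (g (snd z) (fst z) - g (snd z') (fst z')) \<le> Lg * norm (z - z')"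
    by (rule lip_increment[OF lip_g, where r="2 * r + R'"]) (rule that)
  define Cu where "Cu = R' * (LD * \<bar>r\<bar>)"
  define Cw where "Cw = (1/cs) * (R' + Lf)"
  define C where "C = R' + Cu + Cw + (\<bar>r\<bar> * (Lb * R') + Cu + Cw) + Lg * R'"
  have p: "Cu \<ge> 0" "Cw \<ge> 0" "Lg * R' \<ge> 0" "\<bar>r\<bar> * (Lb * R') \<ge> 0"
    using R'0 Lf LD Lb Lg cs by (simp_all add: Cu_def Cw_def)
  show ?thesis
  proof (rule that[of C])
    show "C \<ge> 0" using p R'0 unfolding C_def by linarith
    fix e h m x v a
    assume aa: "a = (1/e) *\<^sub>R (v \<times> B x) + force m x" and e: "0 < e" and h: "0 < h" "h \<le> 1" and he: "cs * e \<le> h\<^sup>2"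
      and bd: "\<bar>m\<bar> \<le> r" "norm x \<le> r" "norm v \<le> r" and aR: "norm a \<le> R"
    have aR': "norm a \<le> R'" using aR by (simp add: R'_def)
    have r0: "\<bar>r\<bar> = r" "0 \<le> r" using bd(2) norm_ge_zero[of x] by linarith+
    have eh: "e \<le> (1/cs) * h\<^sup>2" using he cs by (simp add: field_simps)
    have h21: "h\<^sup>2 \<le> 1" using h by (simp add: power_le_one)
    have ox: "norm (xcor h x a - x) \<le> R' * h\<^sup>2"
    proof -
      have "norm (xcor h x a - x) = (h\<^sup>2/4) * norm a" by (simp add: xcor_def)
      also have "\<dots> \<le> h\<^sup>2 * R'" using aR' by (intro mult_mono) auto
      finally show ?thesis by (simp add: mult.commute)
    qed
    have ou: "\<bar>ucor h x v a - par x v\<bar> \<le> Cu * h\<^sup>2"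
    proof -
      have "norm (fd b x v) \<le> LD * \<bar>r\<bar>"
        using LD(2)[OF bd(2), of v] mult_left_mono[OF bd(3) LD(1)] r0 by simp
      then have "\<bar>a \<bullet> fd b x v\<bar> \<le> R' * (LD * \<bar>r\<bar>)"
        using aR' R'0 by (intro order_trans[OF Cauchy_Schwarz_ineq2] mult_mono) auto
      then have "(h\<^sup>2/4) * \<bar>a \<bullet> fd b x v\<bar> \<le> h\<^sup>2 * Cu"
        unfolding Cu_def by (intro mult_mono) auto
      then show ?thesis by (simp add: ucor_def par_def abs_mult mult.commute)
    qed
    have ow: "norm (perp x v) \<le> Cw * h\<^sup>2"
    proof -
      have "norm (x, m) \<le> 2 * r" using norm_Pair_le[of x m] bd by auto
      from Lf(2)[OF this] have "norm (a - force m x) \<le> R' + Lf"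
        using norm_triangle_ineq4[of a "force m x"] aR' by simp
      then have "e * norm (a - force m x) \<le> ((1/cs) * h\<^sup>2) * (R' + Lf)"
        using eh e cs by (intro mult_mono) auto
      moreover have "norm (v \<times> B x) = e * norm (a - force m x)"
        using boris_acc_cross[OF aa e] e by simp
      ultimately show ?thesis using norm_perp_le[of x v] by (simp add: Cw_def mult_ac)
    qed
    have xb: "norm (xcor h x a) \<le> r + R'"
      using norm_triangle_sub[of "xcor h x a" x] ox bd(2) mult_left_le[OF h21 R'0] by linarith
    have bb: "norm (b x - b (xcor h x a)) \<le> Lb * (R' * h\<^sup>2)"
    proof -
      have "norm (b x - b (xcor h x a)) \<le> Lb * norm (x - xcor h x a)"
        using bd(2) R'0 xb by (intro Lb(2)) auto
      also have "\<dots> \<le> Lb * (R' * h\<^sup>2)" using ox Lb(1) by (intro mult_left_mono) (simp_all add: norm_minus_commute)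
      finally show ?thesis .
    qed
    have ov: "norm (v - ucor h x v a *\<^sub>R b (xcor h x a)) \<le> (\<bar>r\<bar> * (Lb * R') + Cu + Cw) * h\<^sup>2"
    proof -
      have "v - ucor h x v a *\<^sub>R b (xcor h x a) = par x v *\<^sub>R (b x - b (xcor h x a))
          + (par x v - ucor h x v a) *\<^sub>R b (xcor h x a) + perp x v"
        using perp_decomp[of v x] by (simp add: algebra_simps)
      also have "norm \<dots> \<le> \<bar>r\<bar> * (Lb * (R' * h\<^sup>2)) + Cu * h\<^sup>2 + Cw * h\<^sup>2"
      proof (intro norm_triangle_mono)
        show "norm (par x v *\<^sub>R (b x - b (xcor h x a))) \<le> \<bar>r\<bar> * (Lb * (R' * h\<^sup>2))"
          unfolding norm_scaleR using bb par_le[of x v] bd(3) by (intro mult_mono) auto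
        show "norm ((par x v - ucor h x v a) *\<^sub>R b (xcor h x a)) \<le> Cu * h\<^sup>2"
          using ou by (simp add: norm_b abs_minus_commute)
      qed (rule ow)
      finally show ?thesis by (simp add: algebra_simps)
    qed
    have og: "\<bar>g m (xcor h x a) - g m x\<bar> \<le> (Lg * R') * h\<^sup>2"
    proof -
      have "norm (xcor h x a, m) \<le> 2 * r + R'" "norm (x, m) \<le> 2 * r + R'"
        using norm_Pair_le[of "xcor h x a" m] norm_Pair_le[of x m] xb bd R'0 by auto
      from Lg(2)[OF this] have "\<bar>g m (xcor h x a) - g m x\<bar> \<le> Lg * norm (xcor h x a - x)"
        by (simp add: norm_Pair)
      also have "\<dots> \<le> Lg * (R' * h\<^sup>2)" using ox Lg(1) by (intro mult_left_mono)
      finally show ?thesis by (simp add: mult.assoc)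
    qed
    have up: "y \<le> C * h\<^sup>2" if "y \<le> c * h\<^sup>2" "c \<le> C" for y c
      using that by (meson mult_right_mono order_trans zero_le_power2)
    show "norm (xcor h x a - x) \<le> C * h\<^sup>2 \<and> \<bar>ucor h x v a - par x v\<bar> \<le> C * h\<^sup>2 \<and> norm (perp x v) \<le> C * h\<^sup>2 \<and>
      norm (v - ucor h x v a *\<^sub>R b (xcor h x a)) \<le> C * h\<^sup>2 \<and> \<bar>g m (xcor h x a) - g m x\<bar> \<le> C * h\<^sup>2"
      by (intro conjI up[OF ox] up[OF ou] up[OF ow] up[OF ov] up[OF og]; use p R'0 in \<open>simp add: C_def\<close>)
  qed
qed

text \<open>An exact identity. The increment of the parallel velocity contains
  \<open>- (h/4) * ((a' - a) \<bullet> (b x' - b x))\<close>, of order \<open>h^2\<close> because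
  \<open>a\<close> alternates; since \<open>b x' - b x\<close> is close to
  \<open>h *\<^sub>R fd b x v\<close>, the corrections in \<open>ucor\<close> remove its leading
  part, and every remaining term is of order \<open>h^3\<close>.\<close>

lemma parallel_increment:
  assumes "boris_step e h m x v a x' v' a'"
  shows "ucor h x' v' a' - ucor h x v a - (h/2) * (g m x + g m x') =
    - ((h/4) * ((a' - a) \<bullet> (b x' - b x - h *\<^sub>R fd b x v)))
    + (1/4) * (par x' v' - par x v) * ((b x' - b x) \<bullet> (b x' - b x))
    + (1/2) * ((perp x v + perp x' v') \<bullet> (b x' - b x)) + (h\<^sup>2/4) * (a' \<bullet> (fd b x' v' - fd b x v))"
proof -
  have "v' = v + (h/2) *\<^sub>R (a + a')" using assms unfolding boris_step_def by blast
  then have v': "v' - v = (h/2) *\<^sub>R (a + a')" by simp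
  have G: "a \<bullet> b x = g m x" "a' \<bullet> b x' = g m x'"
    using assms boris_acc_parallel unfolding boris_step_def by blast+
  let ?u = "par x v" and ?u' = "par x' v'" and ?w = "perp x v" and ?w' = "perp x' v'"
  let ?b = "b x" and ?b' = "b x'"
  \<comment> \<open>A discrete product rule for \<open>v \<bullet> b x\<close>, symmetric in both
    ends, which later makes the mean of the two parallel forces appear.\<close>
  have "2 * (?u' - ?u) = (v' - v) \<bullet> (?b + ?b') + (v + v') \<bullet> (?b' - ?b)"
    by (simp add: par_def algebra_simps)
  also have "(v' - v) \<bullet> (?b + ?b') = (h/2) * (2 * g m x + 2 * g m x' - (a' - a) \<bullet> (?b' - ?b))"
    unfolding v' by (simp add: G[symmetric] algebra_simps)
  also have "(v + v') \<bullet> (?b' - ?b) = (?u *\<^sub>R ?b + ?u' *\<^sub>R ?b') \<bullet> (?b' - ?b) + (?w + ?w') \<bullet> (?b' - ?b)"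
  proof -
    have "v + v' = (?u *\<^sub>R ?b + ?w) + (?u' *\<^sub>R ?b' + ?w')" by (simp only: perp_decomp[symmetric])
    then show ?thesis by (simp add: inner_add_left)
  qed
  also have "(?u *\<^sub>R ?b + ?u' *\<^sub>R ?b') \<bullet> (?b' - ?b) = (1/2) * (?u' - ?u) * ((?b' - ?b) \<bullet> (?b' - ?b))"
    by (simp add: inner_add_left inner_diff_left inner_diff_right b_b inner_commute[of ?b' ?b] algebra_simps)
  finally show ?thesis
    by (simp add: ucor_def par_def[symmetric] inner_diff_left inner_diff_right power2_eq_square algebra_simps)
qed

text \<open>For the position, the increment of \<open>xcor\<close> is exactly \<open>h\<close> times
  the mean velocity, and each velocity is within order \<open>h^2\<close> of the slow one. For the
  parallel velocity, the remainders of \<open>parallel_increment\<close> are estimated one by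
  one.\<close>

lemma boris_step_trapezoidal:
  assumes cs: "cs > 0"
  obtains C where "C \<ge> 0" "\<And>e h m x v a x' v' a'. boris_step e h m x v a x' v' a' \<Longrightarrow>
    0 < e \<Longrightarrow> 0 < h \<Longrightarrow> h \<le> 1 \<Longrightarrow> cs * e \<le> h\<^sup>2 \<Longrightarrow> \<bar>m\<bar> \<le> r \<Longrightarrow> norm x \<le> r \<Longrightarrow> norm x' \<le> r \<Longrightarrow>
    norm v \<le> r \<Longrightarrow> norm v' \<le> r \<Longrightarrow> norm a \<le> R \<Longrightarrow> norm a' \<le> R \<Longrightarrow>
    norm (xcor h x' a' - xcor h x a - (h/2) *\<^sub>R (ucor h x v a *\<^sub>R b (xcor h x a) + ucor h x' v' a' *\<^sub>R b (xcor h x' a')))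
      \<le> C * h ^ 3 \<and>
    \<bar>ucor h x' v' a' - ucor h x v a - (h/2) * (g m (xcor h x a) + g m (xcor h x' a'))\<bar> \<le> C * h ^ 3"
proof -
  obtain C0 where C0: "C0 \<ge> 0" and cor: "\<And>e h m x v a. a = (1/e) *\<^sub>R (v \<times> B x) + force m x \<Longrightarrow>
    0 < e \<Longrightarrow> 0 < h \<Longrightarrow> h \<le> 1 \<Longrightarrow> cs * e \<le> h\<^sup>2 \<Longrightarrow> \<bar>m\<bar> \<le> r \<Longrightarrow> norm x \<le> r \<Longrightarrow>
    norm v \<le> r \<Longrightarrow> norm a \<le> R \<Longrightarrow>
    norm (xcor h x a - x) \<le> C0 * h\<^sup>2 \<and> \<bar>ucor h x v a - par x v\<bar> \<le> C0 * h\<^sup>2 \<and> norm (perp x v) \<le> C0 * h\<^sup>2 \<and>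
    norm (v - ucor h x v a *\<^sub>R b (xcor h x a)) \<le> C0 * h\<^sup>2 \<and> \<bar>g m (xcor h x a) - g m x\<bar> \<le> C0 * h\<^sup>2"
    by (rule boris_corrections[OF cs, of r R]) (rule that)
  obtain LD where LD: "LD \<ge> 0" "\<And>x w. norm x \<le> r \<Longrightarrow> norm (fd b x w) \<le> LD * norm w"
    by (rule smooth3_fd_bounded[OF smooth_b, where r=r]) (rule that)
  obtain Lb where Lb: "Lb \<ge> 0" "\<And>x y. norm x \<le> r \<Longrightarrow> norm y \<le> r \<Longrightarrow> norm (b x - b y) \<le> Lb * norm (x - y)"
    by (rule lip_increment[OF lip_smooth3[OF smooth_b], where r=r]) (rule that)
  obtain LT where LT: "LT \<ge> 0"
    "\<And>x y. norm x \<le> r \<Longrightarrow> norm y \<le> r \<Longrightarrow> norm (b y - b x - fd b x (y - x)) \<le> LT * (norm (y - x))\<^sup>2"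
    by (rule smooth3_taylor[OF smooth_b, where r=r]) (rule that)
  have "loc_lipschitz (\<lambda>z. fd b (fst z) (snd z))" by (intro lip_fd smooth_b lip_fst lip_snd)
  then obtain Ld where Ld: "Ld \<ge> 0" "\<And>z z'. norm z \<le> 2 * r \<Longrightarrow> norm z' \<le> 2 * r \<Longrightarrow>
      norm (fd b (fst z) (snd z) - fd b (fst z') (snd z')) \<le> Ld * norm (z - z')"
    by (rule lip_increment[where r="2 * r"]) (rule that)
  define d where "d = r + R"
  \<comment> \<open>\<open>k1\<close> to \<open>k4\<close> belong to the four terms on the right of
    \<open>parallel_increment\<close>, in their order; \<open>C0\<close> covers the passage from
    \<open>g m x\<close> to the corrected position.\<close>
  define k1 where "k1 = (2 * R) * (LD * R + LT * d\<^sup>2)"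
  define k2 where "k2 = (R + r * (Lb * d)) * ((Lb * d) * (Lb * d))"
  define k3 where "k3 = (2 * C0) * (Lb * d)"
  define k4 where "k4 = R * (Ld * (d + R))"
  define C where "C = C0 + \<bar>k1\<bar> + \<bar>k2\<bar> + \<bar>k3\<bar> + \<bar>k4\<bar>"
  show ?thesis
  proof (rule that[of C])
    show "C \<ge> 0" using C0 by (simp add: C_def)
    fix e h m x v a x' v' a'
    assume st: "boris_step e h m x v a x' v' a'" and e: "0 < e" and h: "0 < h" "h \<le> 1" and he: "cs * e \<le> h\<^sup>2"
      and bd: "\<bar>m\<bar> \<le> r" "norm x \<le> r" "norm x' \<le> r" "norm v \<le> r" "norm v' \<le> r" and aR: "norm a \<le> R" "norm a' \<le> R"
    have x': "x' = x + h *\<^sub>R v + (h\<^sup>2/2) *\<^sub>R a" and v': "v' = v + (h/2) *\<^sub>R (a + a')"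
      and aa: "a = (1/e) *\<^sub>R (v \<times> B x) + force m x" and aa': "a' = (1/e) *\<^sub>R (v' \<times> B x') + force m x'"
      using st unfolding boris_step_def by blast+
    have r0: "0 \<le> r" "0 \<le> R" using bd(2) norm_ge_zero[of x] aR(1) norm_ge_zero[of a] by linarith+
    have d0: "0 \<le> d" using r0 by (simp add: d_def)
    note c = cor[OF aa e h he bd(1,2,4) aR(1)] and c' = cor[OF aa' e h he bd(1,3,5) aR(2)]
    have h3: "h * h\<^sup>2 = h ^ 3" by (simp add: power3_eq_cube power2_eq_square)
    have h2: "h\<^sup>2 \<le> h" using h by (simp add: power2_eq_square mult_left_le)
    have C0C: "C0 * h ^ 3 \<le> C * h ^ 3" using h by (intro mult_right_mono) (auto simp: C_def)
    let ?X = "ucor h x v a *\<^sub>R b (xcor h x a)" and ?X' = "ucor h x' v' a' *\<^sub>R b (xcor h x' a')"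
    \<comment> \<open>Exact: the accelerations telescope because \<open>h^2/2 a\<close> minus
      \<open>h^2/4 (a + a')\<close> is minus the increment of \<open>h^2/4 a\<close>.\<close>
    have "xcor h x' a' - xcor h x a = (h/2) *\<^sub>R (v + v')"
    proof -
      have "h *\<^sub>R v = (h/2) *\<^sub>R v + (h/2) *\<^sub>R v" "(h\<^sup>2/2) *\<^sub>R a = (h\<^sup>2/4) *\<^sub>R a + (h\<^sup>2/4) *\<^sub>R a"
        by (simp_all flip: scaleR_add_left)
      then show ?thesis by (simp add: x' v' xcor_def algebra_simps power2_eq_square)
    qed
    then have "xcor h x' a' - xcor h x a - (h/2) *\<^sub>R (?X + ?X') = (h/2) *\<^sub>R ((v - ?X) + (v' - ?X'))"
      by (simp add: algebra_simps)
    also have "norm \<dots> \<le> (h/2) * (C0 * h\<^sup>2 + C0 * h\<^sup>2)"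
      using h c c' by (simp only: norm_scaleR) (intro mult_mono norm_triangle_mono; simp)
    also have "\<dots> = C0 * h ^ 3" using h3 by (simp add: mult_ac)
    finally have X: "norm (xcor h x' a' - xcor h x a - (h/2) *\<^sub>R (?X + ?X')) \<le> C * h ^ 3" using C0C by linarith
    have dx: "norm (x' - x) \<le> h * d"
    proof -
      have "x' - x = h *\<^sub>R v + (h\<^sup>2/2) *\<^sub>R a" by (simp add: x')
      also have "norm \<dots> \<le> h * r + h * R"
      proof (rule norm_triangle_mono)
        show "norm (h *\<^sub>R v) \<le> h * r" using h bd by simp
        have "(h\<^sup>2/2) * norm a \<le> h * R" using h2 aR h by (intro mult_mono) auto
        then show "norm ((h\<^sup>2/2) *\<^sub>R a) \<le> h * R" by simp
      qed
      finally show ?thesis by (simp add: d_def algebra_simps)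
    qed
    have dv: "norm (v' - v) \<le> h * R"
    proof -
      have "norm (v' - v) = (h/2) * norm (a + a')" using h by (simp add: v')
      also have "\<dots> \<le> (h/2) * (R + R)" using h aR by (intro mult_left_mono norm_triangle_mono) auto
      finally show ?thesis by simp
    qed
    let ?\<delta> = "b x' - b x"
    have \<delta>: "norm ?\<delta> \<le> (Lb * d) * h"
      using Lb(2)[OF bd(3,2)] mult_left_mono[OF dx Lb(1)] by (simp add: mult_ac)
    have s1: "norm (?\<delta> - h *\<^sub>R fd b x v) \<le> (LD * R + LT * d\<^sup>2) * h\<^sup>2"
    proof -
      interpret linear "fd b x" by (rule smooth3_linear_fd[OF smooth_b])
      have "fd b x (x' - x) = h *\<^sub>R fd b x v + (h\<^sup>2/2) *\<^sub>R fd b x a" by (simp add: x' add scaleR)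
      then have "?\<delta> - h *\<^sub>R fd b x v = (h\<^sup>2/2) *\<^sub>R fd b x a + (?\<delta> - fd b x (x' - x))" by simp
      also have "norm \<dots> \<le> h\<^sup>2 * (LD * R) + LT * (h * d)\<^sup>2"
      proof (rule norm_triangle_mono)
        have "norm (fd b x a) \<le> LD * R"
          using LD(2)[OF bd(2), of a] mult_left_mono[OF aR(1) LD(1)] by linarith
        then have "(h\<^sup>2/2) * norm (fd b x a) \<le> h\<^sup>2 * (LD * R)" by (intro mult_mono) auto
        then show "norm ((h\<^sup>2/2) *\<^sub>R fd b x a) \<le> h\<^sup>2 * (LD * R)" by simp
        have "LT * (norm (x' - x))\<^sup>2 \<le> LT * (h * d)\<^sup>2" using dx LT(1) by (intro mult_left_mono power_mono) auto
        then show "norm (?\<delta> - fd b x (x' - x)) \<le> LT * (h * d)\<^sup>2" using LT(2)[OF bd(2,3)] by linarith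
      qed
      finally show ?thesis by (simp add: power_mult_distrib algebra_simps)
    qed
    have i1: "\<bar>(h/4) * ((a' - a) \<bullet> (?\<delta> - h *\<^sub>R fd b x v))\<bar> \<le> \<bar>k1\<bar> * h ^ 3"
    proof -
      have "norm (a' - a) \<le> 2 * R" using norm_triangle_ineq4[of a' a] aR by linarith
      then have "\<bar>(a' - a) \<bullet> (?\<delta> - h *\<^sub>R fd b x v)\<bar> \<le> (2 * R) * ((LD * R + LT * d\<^sup>2) * h\<^sup>2)"
        using s1 r0 by (intro order_trans[OF Cauchy_Schwarz_ineq2] mult_mono) auto
      also have "\<dots> = k1 * h\<^sup>2" by (simp add: k1_def)
      also have "\<dots> \<le> \<bar>k1\<bar> * h\<^sup>2" by (intro mult_right_mono) auto
      finally have "(h/4) * \<bar>(a' - a) \<bullet> (?\<delta> - h *\<^sub>R fd b x v)\<bar> \<le> h * (\<bar>k1\<bar> * h\<^sup>2)"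
        using h by (intro mult_mono) auto
      moreover have "\<bar>(h/4) * ((a' - a) \<bullet> (?\<delta> - h *\<^sub>R fd b x v))\<bar> = (h/4) * \<bar>(a' - a) \<bullet> (?\<delta> - h *\<^sub>R fd b x v)\<bar>"
        using h by (simp add: abs_mult)
      moreover have "h * (\<bar>k1\<bar> * h\<^sup>2) = \<bar>k1\<bar> * h ^ 3" using h3 by (simp add: mult.left_commute)
      ultimately show ?thesis by linarith
    qed
    have i2: "\<bar>(1/4) * (par x' v' - par x v) * (?\<delta> \<bullet> ?\<delta>)\<bar> \<le> \<bar>k2\<bar> * h ^ 3"
    proof -
      have "par x' v' - par x v = (v' - v) \<bullet> b x' + v \<bullet> ?\<delta>" by (simp add: par_def inner_diff_left inner_diff_right)
      also have "\<bar>\<dots>\<bar> \<le> norm (v' - v) * norm (b x') + norm v * norm ?\<delta>"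
        by (intro order_trans[OF abs_triangle_ineq] add_mono Cauchy_Schwarz_ineq2)
      also have "\<dots> \<le> h * R + r * ((Lb * d) * h)"
        using dv mult_mono[OF bd(4) \<delta>] r0 by (simp add: norm_b)
      finally have "\<bar>par x' v' - par x v\<bar> \<le> (R + r * (Lb * d)) * h" by (simp add: algebra_simps)
      moreover have "\<bar>?\<delta> \<bullet> ?\<delta>\<bar> \<le> ((Lb * d) * h) * ((Lb * d) * h)"
        using \<delta> Lb(1) d0 h by (intro order_trans[OF Cauchy_Schwarz_ineq2] mult_mono) auto
      ultimately have "\<bar>par x' v' - par x v\<bar> * \<bar>?\<delta> \<bullet> ?\<delta>\<bar> \<le> ((R + r * (Lb * d)) * h) * (((Lb * d) * h) * ((Lb * d) * h))"
        using r0 Lb(1) d0 h by (intro mult_mono) auto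
      also have "\<dots> = k2 * h ^ 3" by (simp add: k2_def power3_eq_cube mult_ac)
      also have "\<dots> \<le> \<bar>k2\<bar> * h ^ 3" using h by (intro mult_right_mono) auto
      finally have le: "\<bar>(par x' v' - par x v) * (?\<delta> \<bullet> ?\<delta>)\<bar> \<le> \<bar>k2\<bar> * h ^ 3" by (simp only: abs_mult)
      have "\<bar>(1/4) * (par x' v' - par x v) * (?\<delta> \<bullet> ?\<delta>)\<bar> = (1/4) * \<bar>(par x' v' - par x v) * (?\<delta> \<bullet> ?\<delta>)\<bar>"
        by (simp only: mult.assoc abs_mult[of "1/4"])
      then show ?thesis using le by linarith
    qed
    have i3: "\<bar>(1/2) * ((perp x v + perp x' v') \<bullet> ?\<delta>)\<bar> \<le> \<bar>k3\<bar> * h ^ 3"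
    proof -
      have "norm (perp x v + perp x' v') \<le> C0 * h\<^sup>2 + C0 * h\<^sup>2" using c c' by (intro norm_triangle_mono) auto
      then have "\<bar>(perp x v + perp x' v') \<bullet> ?\<delta>\<bar> \<le> (C0 * h\<^sup>2 + C0 * h\<^sup>2) * ((Lb * d) * h)"
        using \<delta> C0 by (intro order_trans[OF Cauchy_Schwarz_ineq2] mult_mono) auto
      also have "\<dots> = k3 * h ^ 3" using h3 by (simp add: k3_def algebra_simps)
      also have "\<dots> \<le> \<bar>k3\<bar> * h ^ 3" using h by (intro mult_right_mono) auto
      finally show ?thesis by simp
    qed
    have i4: "\<bar>(h\<^sup>2/4) * (a' \<bullet> (fd b x' v' - fd b x v))\<bar> \<le> \<bar>k4\<bar> * h ^ 3"
    proof -
      have nq: "norm (x', v') \<le> 2 * r" "norm (x, v) \<le> 2 * r"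
        using norm_Pair_le[of x v] norm_Pair_le[of x' v'] bd by auto
      have "norm (fd b x' v' - fd b x v) \<le> Ld * norm ((x', v') - (x, v))" using Ld(2)[OF nq] by simp
      also have "\<dots> \<le> Ld * (h * d + h * R)"
        using norm_Pair_le[of "x' - x" "v' - v"] dx dv Ld(1) by (intro mult_left_mono) auto
      finally have "\<bar>a' \<bullet> (fd b x' v' - fd b x v)\<bar> \<le> R * (Ld * (h * d + h * R))"
        using aR r0 by (intro order_trans[OF Cauchy_Schwarz_ineq2] mult_mono) auto
      also have "\<dots> = k4 * h" by (simp add: k4_def algebra_simps)
      also have "\<dots> \<le> \<bar>k4\<bar> * h" using h by (intro mult_right_mono) auto
      finally have "(h\<^sup>2/4) * \<bar>a' \<bullet> (fd b x' v' - fd b x v)\<bar> \<le> h\<^sup>2 * (\<bar>k4\<bar> * h)"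
        by (intro mult_mono) auto
      moreover have "\<bar>(h\<^sup>2/4) * (a' \<bullet> (fd b x' v' - fd b x v))\<bar> = (h\<^sup>2/4) * \<bar>a' \<bullet> (fd b x' v' - fd b x v)\<bar>"
        by (simp add: abs_mult)
      moreover have "h\<^sup>2 * (\<bar>k4\<bar> * h) = \<bar>k4\<bar> * h ^ 3" by (simp add: power2_eq_square power3_eq_cube)
      ultimately show ?thesis by linarith
    qed
    have "\<bar>(h/2) * (g m x + g m x') - (h/2) * (g m (xcor h x a) + g m (xcor h x' a'))\<bar> \<le> C0 * h ^ 3"
    proof -
      have "\<bar>(g m x + g m x') - (g m (xcor h x a) + g m (xcor h x' a'))\<bar> \<le> 2 * (C0 * h\<^sup>2)"
        using c c' by linarith
      then have "(h/2) * \<bar>(g m x + g m x') - (g m (xcor h x a) + g m (xcor h x' a'))\<bar> \<le> (h/2) * (2 * (C0 * h\<^sup>2))"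
        using h by (intro mult_left_mono) auto
      moreover have "\<bar>(h/2) * (g m x + g m x') - (h/2) * (g m (xcor h x a) + g m (xcor h x' a'))\<bar>
          = (h/2) * \<bar>(g m x + g m x') - (g m (xcor h x a) + g m (xcor h x' a'))\<bar>"
        using h by (simp only: abs_mult right_diff_distrib[symmetric])
      moreover have "(h/2) * (2 * (C0 * h\<^sup>2)) = C0 * h ^ 3" by (simp add: power2_eq_square power3_eq_cube)
      ultimately show ?thesis by linarith
    qed
    note q = this
    have comb: "\<bar>z - q2\<bar> \<le> c1 + c2 + c3 + c4 + c0"
      if "z - q1 = - t1 + t2 + t3 + t4" "\<bar>t1\<bar> \<le> c1" "\<bar>t2\<bar> \<le> c2" "\<bar>t3\<bar> \<le> c3" "\<bar>t4\<bar> \<le> c4" "\<bar>q1 - q2\<bar> \<le> c0"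
      for z q1 q2 t1 t2 t3 t4 c0 c1 c2 c3 c4 :: real
      using that by linarith
    have "\<bar>ucor h x' v' a' - ucor h x v a - (h/2) * (g m (xcor h x a) + g m (xcor h x' a'))\<bar>
      \<le> \<bar>k1\<bar> * h ^ 3 + \<bar>k2\<bar> * h ^ 3 + \<bar>k3\<bar> * h ^ 3 + \<bar>k4\<bar> * h ^ 3 + C0 * h ^ 3"
      by (rule comb[OF parallel_increment[OF st] i1 i2 i3 i4 q])
    also have "\<dots> = C * h ^ 3" by (simp add: C_def algebra_simps)
    finally show "norm (xcor h x' a' - xcor h x a - (h/2) *\<^sub>R (?X + ?X')) \<le> C * h ^ 3 \<and>
      \<bar>ucor h x' v' a' - ucor h x v a - (h/2) * (g m (xcor h x a) + g m (xcor h x' a'))\<bar> \<le> C * h ^ 3"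
      using X by blast
  qed
qed

section \<open>Boundedness of the numerical acceleration\<close>

definition "boris e h m X V A \<longleftrightarrow>
  (\<forall>n::nat. boris_step e h m (X n) (V n) (A n) (X (Suc n)) (V (Suc n)) (A (Suc n)))"

text \<open>\<open>boris_step_residual\<close> presupposes \<open>h * norm a \<le> 1\<close>. The
  guard in \<open>discrete_gronwall\<close> supplies it: a residual of at most \<open>Rs\<close>
  means an acceleration of at most \<open>R\<close>, and \<open>h0\<close> is chosen so that
  \<open>h * R \<le> 1\<close>.\<close>

lemma boris_acc_bounded:
  assumes cs: "cs > 0" and T: "T \<ge> 0"
  obtains R h0 where "R \<ge> 0" "h0 > 0" "\<And>e h m X V A M n. boris e h m X V A \<Longrightarrow>
    0 < e \<Longrightarrow> 0 < h \<Longrightarrow> h \<le> h0 \<Longrightarrow> cs * e \<le> h\<^sup>2 \<Longrightarrow> \<bar>m\<bar> \<le> r \<Longrightarrow> real M * h \<le> T \<Longrightarrow>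
    \<forall>n\<le>M. norm (X n) \<le> r \<and> norm (V n) \<le> r \<Longrightarrow> V 0 \<times> B (X 0) = 0 \<Longrightarrow> n \<le> M \<Longrightarrow> norm (A n) \<le> R"
proof -
  obtain C where C: "C \<ge> 0" and res: "\<And>e h m x v a x' v' a'. boris_step e h m x v a x' v' a' \<Longrightarrow>
    0 < e \<Longrightarrow> 0 < h \<Longrightarrow> h \<le> 1 \<Longrightarrow> cs * e \<le> h\<^sup>2 \<Longrightarrow> \<bar>m\<bar> \<le> r \<Longrightarrow> norm x \<le> r \<Longrightarrow> norm x' \<le> r \<Longrightarrow>
    norm v \<le> r \<Longrightarrow> norm v' \<le> r \<Longrightarrow> h * norm a \<le> 1 \<Longrightarrow>
    norm (a' - slow m x' v') \<le> norm (a - slow m x v)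
      + h * C * (1 + norm (a - slow m x v) + norm (a' - slow m x' v'))"
    by (rule boris_step_residual[OF cs, of r]) (rule that)
  obtain Lf where Lf: "Lf \<ge> 0" "\<And>z. norm z \<le> 2 * r \<Longrightarrow> norm (force (snd z) (fst z)) \<le> Lf"
    by (rule lip_bound[OF lip_force, where r="2*r"]) (rule that)
  obtain Lc where Lc: "Lc \<ge> 0" "\<And>z. norm z \<le> 3 * r \<Longrightarrow> norm (slow (snd z) (fst (fst z)) (snd (fst z))) \<le> Lc"
    by (rule lip_bound[OF lip_slow, where r="3*r"]) (rule that)
  \<comment> \<open>The Gronwall bound with \<open>d = 1\<close> and initial residual at most
    \<open>Lf + Lc\<close>.\<close>
  define Rs where "Rs = exp (4 * C * T) * (Lf + Lc + 1/2)"
  define R where "R = Rs + Lc"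
  \<comment> \<open>The three bounds give \<open>h \<le> 1\<close>, \<open>h * C \<le> 1/2\<close>
    and \<open>h * R \<le> 1\<close>.\<close>
  define h0 where "h0 = min 1 (min (1 / (2 * C + 1)) (1 / (R + 1)))"
  have Rs0: "Rs \<ge> 0" using Lf Lc by (simp add: Rs_def)
  have R0: "R \<ge> 0" using Rs0 Lc by (simp add: R_def)
  have h00: "h0 > 0" using C R0 by (simp add: h0_def)
  show ?thesis
  proof (rule that[OF R0 h00])
    fix e h m X V A and M n :: nat
    assume bo: "boris e h m X V A" and e: "0 < e" and h: "0 < h" "h \<le> h0" and he: "cs * e \<le> h\<^sup>2" and m: "\<bar>m\<bar> \<le> r"
      and MT: "real M * h \<le> T" and bd': "\<forall>n\<le>M. norm (X n) \<le> r \<and> norm (V n) \<le> r"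
      and V0: "V 0 \<times> B (X 0) = 0" and n: "n \<le> M"
    have bd: "norm (X n) \<le> r \<and> norm (V n) \<le> r" if "n \<le> M" for n using bd' that by blast
    have h1: "h \<le> 1" using h by (simp add: h0_def)
    have hC: "h * C \<le> 1/2"
    proof -
      have "h * C \<le> (1 / (2 * C + 1)) * C" using h C by (intro mult_right_mono) (auto simp: h0_def)
      also have "\<dots> \<le> 1/2" using C by (simp add: field_simps)
      finally show ?thesis .
    qed
    have hR: "h * R \<le> 1"
    proof -
      have "h * R \<le> (1 / (R + 1)) * R" using h R0 by (intro mult_right_mono) (auto simp: h0_def)
      also have "\<dots> \<le> 1" using R0 by (simp add: field_simps)
      finally show ?thesis .
    qed
    have st: "boris_step e h m (X n) (V n) (A n) (X (Suc n)) (V (Suc n)) (A (Suc n))" for n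
      using bo by (simp add: boris_def)
    have sl: "norm (slow m (X n) (V n)) \<le> Lc" if "n \<le> M" for n
      using Lc(2)[of "((X n, V n), m)"] norm_Pair_le[of "(X n, V n)" m] norm_Pair_le[of "X n" "V n"] bd[OF that] m by simp
    let ?s = "\<lambda>n. norm (A n - slow m (X n) (V n))"
    have s0: "?s 0 \<le> Lf + Lc"
    proof -
      have "A 0 = (1/e) *\<^sub>R (V 0 \<times> B (X 0)) + force m (X 0)" using st[of 0] unfolding boris_step_def by blast
      \<comment> \<open>The initial velocity is parallel to the field, so the term with
        \<open>1/e\<close> is absent and the initial acceleration is bounded uniformly in
        \<open>e\<close>.\<close>
      then have "A 0 = force m (X 0)" using V0 by simp
      moreover have "norm (force m (X 0)) \<le> Lf"
        using Lf(2)[of "(X 0, m)"] norm_Pair_le[of "X 0" m] bd[of 0] m by simp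
      ultimately show ?thesis using norm_triangle_ineq4[of "A 0" "slow m (X 0) (V 0)"] sl[of 0] by simp
    qed
    have b: "exp (4 * C * T) * (?s 0 + 1/2) \<le> Rs" unfolding Rs_def using s0 by (intro mult_left_mono) auto
    have an: "norm (A n) \<le> ?s n + Lc" if "n \<le> M" for n
      using norm_triangle_sub[of "A n" "slow m (X n) (V n)"] sl[OF that] by linarith
    have "?s n \<le> exp (4 * C * T) * (?s 0 + 1/2)"
    proof (rule discrete_gronwall[where s="?s" and d=1 and R=Rs and L=C and h=h and M=M])
      fix n assume nM: "n < M" and sn: "?s n \<le> Rs"
      have "norm (A n) \<le> R" using an[of n] nM sn by (simp add: R_def)
      then have "h * norm (A n) \<le> 1" using mult_left_mono[of "norm (A n)" R h] h hR by linarith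
      then show "?s (Suc n) \<le> ?s n + h * C * (1 + ?s n + ?s (Suc n))"
        using bd[of n] bd[of "Suc n"] nM by (intro res[OF st e h(1) h1 he m]) auto
    qed (use h C hC MT b n in auto)
    then show "norm (A n) \<le> R" using an[OF n] b by (simp add: R_def)
  qed
qed

end

section \<open>Convergence\<close>

lemma defect_increment_le:
  fixes a a' b b' q1 q2 :: "'a::real_normed_vector"
  assumes "norm (a' - a - q1) \<le> c1" "norm (b' - b - q2) \<le> c2" "norm (q1 - q2) \<le> c3"
  shows "norm (a' - b') \<le> norm (a - b) + c3 + (c1 + c2)"
proof -
  have "a' - b' = (a - b) + (q1 - q2) + ((a' - a - q1) - (b' - b - q2))" by simp
  also have "norm \<dots> \<le> norm (a - b) + c3 + (c1 + c2)"
    using assms by (intro norm_triangle_mono order_trans[OF norm_triangle_ineq4 add_mono]) auto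
  finally show ?thesis .
qed

lemma scaled_sum_diff_le:
  fixes a a' b b' :: "'a::real_normed_vector"
  assumes "norm (a - b) \<le> c" "norm (a' - b') \<le> c'" "h \<ge> 0"
  shows "norm (h *\<^sub>R (a + a') - h *\<^sub>R (b + b')) \<le> h * (c + c')"
proof -
  have "h *\<^sub>R (a + a') - h *\<^sub>R (b + b') = h *\<^sub>R ((a - b) + (a' - b'))" by (simp add: algebra_simps)
  also have "norm \<dots> \<le> h * (c + c')"
    using assms by (simp add: mult_left_mono norm_triangle_mono)
  finally show ?thesis .
qed

context charged_particle
begin

text \<open>The magnetic force at the new point is orthogonal to \<open>v'\<close>; testing the
  update with \<open>v'\<close> removes this implicit term. The bound contains no \<open>1/e\<close>
  beyond \<open>a\<close> and does not refer to \<open>a'\<close>.\<close>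

lemma boris_velocity_le:
  assumes "boris_step e h m x v a x' v' a'" "h \<ge> 0"
  shows "norm v' \<le> norm v + (h/2) * (norm a + norm (force m x'))"
proof (cases "v' = 0")
  case False
  have v': "v' = v + (h/2) *\<^sub>R (a + a')" and a': "a' = (1/e) *\<^sub>R (v' \<times> B x') + force m x'"
    using assms(1) unfolding boris_step_def by blast+
  \<comment> \<open>The velocity update with the magnetic part of \<open>a'\<close> left
    out.\<close>
  let ?z = "v + (h/2) *\<^sub>R (a + force m x')"
  have "v' \<bullet> a' = v' \<bullet> force m x'"
    by (subst a') (simp add: inner_add_right dot_cross_self)
  then have "v' \<bullet> (v + (h/2) *\<^sub>R (a + a')) = v' \<bullet> ?z" by (simp add: inner_add_right)
  then have "v' \<bullet> v' = v' \<bullet> ?z" using v' by simp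
  then have "norm v' * norm v' = v' \<bullet> ?z" by (simp add: dot_square_norm power2_eq_square)
  also have "\<dots> \<le> norm v' * norm ?z" by (rule norm_cauchy_schwarz)
  finally have "norm v' \<le> norm ?z" using False by simp
  also have "\<dots> \<le> norm v + (h/2) * (norm a + norm (force m x'))"
  proof (rule norm_triangle_mono)
    show "norm ((h/2) *\<^sub>R (a + force m x')) \<le> (h/2) * (norm a + norm (force m x'))"
      using assms(2) by (simp add: norm_triangle_ineq mult_left_mono divide_right_mono)
  qed simp
  finally show ?thesis .
qed (use assms(2) in simp)

text \<open>The auxiliary constants are valid only on a ball that the numerical solution is not
  known to respect. Two radii \<open>r1 < r\<close> break the circle: staying within
  \<open>r\<close> up to some step gives the error bound, for small \<open>h\<close> this gives
  \<open>r1\<close>, and one further step cannot lead from \<open>r1\<close> beyond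
  \<open>r\<close>.\<close>

lemma boris_convergence_small_step:
  assumes cs: "cs > 0" and T: "T \<ge> 0"
  obtains C h0 where "C \<ge> 0" "h0 > 0" "\<And>e h x v X V A n. 0 < e \<Longrightarrow> e < 1 \<Longrightarrow> 0 < h \<Longrightarrow> h \<le> h0 \<Longrightarrow>
    cs * e \<le> h\<^sup>2 \<Longrightarrow> motion e T x v \<Longrightarrow> norm (x 0) \<le> M0 \<Longrightarrow> norm (v 0) \<le> M1 \<Longrightarrow>
    boris e h (moment (x 0) (v 0)) X V A \<Longrightarrow> X 0 = x 0 \<Longrightarrow> V 0 = par (x 0) (v 0) *\<^sub>R b (x 0) \<Longrightarrow>
    real n * h \<le> T \<Longrightarrow>
    norm (X n - x (real n * h)) \<le> C * h\<^sup>2 \<and>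
    \<bar>par (X n) (V n) - par (x (real n * h)) (v (real n * h))\<bar> \<le> C * h\<^sup>2 \<and>
    norm (perp (X n) (V n)) \<le> C * h\<^sup>2"
proof -
  obtain \<rho> Cx where \<rho>: "\<rho> \<ge> 0" and Cx: "Cx \<ge> 0" and ex:
    "\<And>e x v. 0 < e \<Longrightarrow> e < 1 \<Longrightarrow> motion e T x v \<Longrightarrow> norm (x 0) \<le> M0 \<Longrightarrow> norm (v 0) \<le> M1 \<Longrightarrow>
      \<bar>moment (x 0) (v 0)\<bar> \<le> Cx \<and>
      (\<exists>y U. (\<forall>t\<in>{0..T}. norm (x t) \<le> \<rho> \<and> norm (v t) \<le> \<rho> \<and>
          norm (y t - x t) \<le> Cx * e \<and> \<bar>U t - par (x t) (v t)\<bar> \<le> Cx * e) \<and>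
        (\<forall>t h. 0 \<le> t \<longrightarrow> 0 \<le> h \<longrightarrow> h \<le> 1 \<longrightarrow> t + h \<le> T \<longrightarrow>
          norm (y (t + h) - y t - (h/2) *\<^sub>R (U t *\<^sub>R b (y t) + U (t + h) *\<^sub>R b (y (t + h)))) \<le> Cx * h * (e + h\<^sup>2) \<and>
          \<bar>U (t + h) - U t - (h/2) * (g (moment (x 0) (v 0)) (y t) + g (moment (x 0) (v 0)) (y (t + h)))\<bar>
            \<le> Cx * h * (e + h\<^sup>2)))"
    by (rule motion_trapezoidal[OF T, of M0 M1]) (rule that)
  \<comment> \<open>\<open>\<rho>\<close> bounds the exact motion, \<open>Cx\<close> leaves room for
    the moment and for \<open>y\<close> and \<open>U\<close>, and 1 for the numerical error. The
    extra 1 in \<open>r\<close> is the allowance for a single step.\<close>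
  define r1 where "r1 = \<rho> + Cx + 1"
  define r where "r = r1 + 1"
  obtain R h1 where R: "R \<ge> 0" and h1: "h1 > 0" and acc: "\<And>e h m X V A M n. boris e h m X V A \<Longrightarrow>
    0 < e \<Longrightarrow> 0 < h \<Longrightarrow> h \<le> h1 \<Longrightarrow> cs * e \<le> h\<^sup>2 \<Longrightarrow> \<bar>m\<bar> \<le> r \<Longrightarrow> real M * h \<le> T \<Longrightarrow>
    \<forall>n\<le>M. norm (X n) \<le> r \<and> norm (V n) \<le> r \<Longrightarrow> V 0 \<times> B (X 0) = 0 \<Longrightarrow> n \<le> M \<Longrightarrow> norm (A n) \<le> R"
    by (rule boris_acc_bounded[OF cs T, of r]) (rule that)
  obtain C0 where C0: "C0 \<ge> 0" and cor: "\<And>e h m x v a. a = (1/e) *\<^sub>R (v \<times> B x) + force m x \<Longrightarrow>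
    0 < e \<Longrightarrow> 0 < h \<Longrightarrow> h \<le> 1 \<Longrightarrow> cs * e \<le> h\<^sup>2 \<Longrightarrow> \<bar>m\<bar> \<le> r \<Longrightarrow> norm x \<le> r \<Longrightarrow>
    norm v \<le> r \<Longrightarrow> norm a \<le> R \<Longrightarrow>
    norm (xcor h x a - x) \<le> C0 * h\<^sup>2 \<and> \<bar>ucor h x v a - par x v\<bar> \<le> C0 * h\<^sup>2 \<and> norm (perp x v) \<le> C0 * h\<^sup>2 \<and>
    norm (v - ucor h x v a *\<^sub>R b (xcor h x a)) \<le> C0 * h\<^sup>2 \<and> \<bar>g m (xcor h x a) - g m x\<bar> \<le> C0 * h\<^sup>2"
    by (rule boris_corrections[OF cs, of r R]) (rule that)
  obtain C2 where C2: "C2 \<ge> 0" and trap: "\<And>e h m x v a x' v' a'. boris_step e h m x v a x' v' a' \<Longrightarrow>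
    0 < e \<Longrightarrow> 0 < h \<Longrightarrow> h \<le> 1 \<Longrightarrow> cs * e \<le> h\<^sup>2 \<Longrightarrow> \<bar>m\<bar> \<le> r \<Longrightarrow> norm x \<le> r \<Longrightarrow> norm x' \<le> r \<Longrightarrow>
    norm v \<le> r \<Longrightarrow> norm v' \<le> r \<Longrightarrow> norm a \<le> R \<Longrightarrow> norm a' \<le> R \<Longrightarrow>
    norm (xcor h x' a' - xcor h x a - (h/2) *\<^sub>R (ucor h x v a *\<^sub>R b (xcor h x a) + ucor h x' v' a' *\<^sub>R b (xcor h x' a')))
      \<le> C2 * h ^ 3 \<and>
    \<bar>ucor h x' v' a' - ucor h x v a - (h/2) * (g m (xcor h x a) + g m (xcor h x' a'))\<bar> \<le> C2 * h ^ 3"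
    by (rule boris_step_trapezoidal[OF cs, of r R]) (rule that)
  define rr where "rr = 2 * (r + C0)"
  have "loc_lipschitz (\<lambda>z. snd z *\<^sub>R b (fst z))"
    by (intro lip_scaleR lip_snd lip_smooth3_compose[OF smooth_b] lip_fst)
  then obtain L1 where L1: "L1 \<ge> 0" "\<And>z z'. norm z \<le> rr \<Longrightarrow> norm z' \<le> rr \<Longrightarrow>
      norm (snd z *\<^sub>R b (fst z) - snd z' *\<^sub>R b (fst z')) \<le> L1 * norm (z - z')"
    by (rule lip_increment[where r=rr]) (rule that)
  obtain Lg where Lg: "Lg \<ge> 0" "\<And>z z'. norm z \<le> rr \<Longrightarrow> norm z' \<le> rr \<Longrightarrow>
      norm (g (snd z) (fst z) - g (snd z') (fst z')) \<le> Lg * norm (z - z')"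
    by (rule lip_increment[OF lip_g, where r=rr]) (rule that)
  obtain Lf where Lf: "Lf \<ge> 0" "\<And>z. norm z \<le> 2 * r \<Longrightarrow> norm (force (snd z) (fst z)) \<le> Lf"
    by (rule lip_bound[OF lip_force, where r="2*r"]) (rule that)
  define L where "L = L1 + Lg + 1"
  \<comment> \<open>\<open>K * h\<^sup>2\<close> becomes the parameter \<open>d\<close> of
    \<open>discrete_gronwall\<close>: position and parallel velocity each contribute a numerical and
    an exact defect, with \<open>e \<le> h^2 / cs\<close>. Likewise \<open>E0\<close> adds the
    initial distances of both components.\<close>
  define K where "K = 2 * C2 + 2 * (Cx * (1/cs + 1))"
  define E0 where "E0 = 2 * (C0 + Cx / cs)"
  define C3 where "C3 = exp (4 * L * T) * (E0 + K)"
  define C4 where "C4 = C0 + C3 + Cx / cs"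
  \<comment> \<open>In this order: \<open>h \<le> 1\<close>, the bound on the acceleration,
    \<open>h * L \<le> 1/2\<close> for Gronwall, an error of at most 1, and a single step changing
    position and velocity by at most 1.\<close>
  define h0 where "h0 = min (min 1 h1) (min (1 / (2 * L)) (min (1 / (C4 + C0 + 1)) (1 / (r1 + R + Lf + 1))))"
  have L0: "L \<ge> 1" using L1 Lg by (simp add: L_def)
  have K0: "K \<ge> 0" "E0 \<ge> 0" using C2 Cx cs C0 by (simp_all add: K_def E0_def)
  have C30: "C3 \<ge> 0" using K0 by (simp add: C3_def)
  have C40: "C4 \<ge> 0" using C30 C0 Cx cs by (simp add: C4_def)
  have r10: "r1 \<ge> 1" "r \<ge> 2" using \<rho> Cx by (simp_all add: r1_def r_def)
  have h00: "h0 > 0" using h1 L0 C40 C0 r10 R Lf by (simp add: h0_def add_nonneg_pos)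
  show ?thesis
  proof (rule that[of C4 h0])
    show "C4 \<ge> 0" "h0 > 0" by fact+
    fix e h x v X V A and n :: nat
    assume e: "0 < e" "e < 1" and h: "0 < h" "h \<le> h0" and he: "cs * e \<le> h\<^sup>2" and mo: "motion e T x v"
      and ini: "norm (x 0) \<le> M0" "norm (v 0) \<le> M1" and bo: "boris e h (moment (x 0) (v 0)) X V A"
      and X0: "X 0 = x 0" and V0: "V 0 = par (x 0) (v 0) *\<^sub>R b (x 0)" and nT: "real n * h \<le> T"
    define m where "m = moment (x 0) (v 0)"
    have hh: "h \<le> 1" "h \<le> h1" "h \<le> 1 / (2 * L)" "h \<le> 1 / (C4 + C0 + 1)" "h \<le> 1 / (r1 + R + Lf + 1)"
      using h by (simp_all add: h0_def)
    have hL: "h * L \<le> 1/2" using hh(3) L0 by (simp add: field_simps)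
    have h2: "h\<^sup>2 \<le> h" using h hh(1) by (simp add: power2_eq_square mult_left_le)
    have hC: "(C4 + C0) * h\<^sup>2 \<le> 1"
    proof -
      have "(C4 + C0) * h\<^sup>2 \<le> (C4 + C0 + 1) * (1 / (C4 + C0 + 1))"
        using h2 hh(4) C40 C0 by (intro mult_mono) auto
      then show ?thesis using C40 C0 by simp
    qed
    have hR: "h * (r1 + R + Lf) \<le> 1"
    proof -
      have "h * (r1 + R + Lf) \<le> (1 / (r1 + R + Lf + 1)) * (r1 + R + Lf + 1)"
        using h hh(5) r10 R Lf(1) by (intro mult_mono) auto
      then show ?thesis using r10 R Lf(1) by simp
    qed
    have eh: "e \<le> (1/cs) * h\<^sup>2" using he cs by (simp add: field_simps)
    have Ceh: "Cx * e \<le> (Cx / cs) * h\<^sup>2" using mult_left_mono[OF eh Cx] by simp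
    have Ce1: "Cx * e \<le> Cx" using Cx e by (simp add: mult_left_le)
    have h21: "h\<^sup>2 \<le> 1" using h2 hh(1) by linarith
    from ex[OF e mo ini] obtain y U where m0: "\<bar>m\<bar> \<le> Cx" and
      yU: "\<And>t. t \<in> {0..T} \<Longrightarrow> norm (x t) \<le> \<rho> \<and> norm (v t) \<le> \<rho> \<and>
          norm (y t - x t) \<le> Cx * e \<and> \<bar>U t - par (x t) (v t)\<bar> \<le> Cx * e" and
      ytrap: "\<And>t h. 0 \<le> t \<Longrightarrow> 0 \<le> h \<Longrightarrow> h \<le> 1 \<Longrightarrow> t + h \<le> T \<Longrightarrow>
          norm (y (t + h) - y t - (h/2) *\<^sub>R (U t *\<^sub>R b (y t) + U (t + h) *\<^sub>R b (y (t + h)))) \<le> Cx * h * (e + h\<^sup>2) \<and>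
          \<bar>U (t + h) - U t - (h/2) * (g m (y t) + g m (y (t + h)))\<bar> \<le> Cx * h * (e + h\<^sup>2)"
      unfolding m_def by blast
    have mr: "\<bar>m\<bar> \<le> r" using m0 \<rho> by (simp add: r_def r1_def)
    have st: "boris_step e h m (X n) (V n) (A n) (X (Suc n)) (V (Suc n)) (A (Suc n))" for n
      using bo by (simp add: boris_def m_def)
    have aeq: "A n = (1/e) *\<^sub>R (V n \<times> B (X n)) + force m (X n)" for n
      using st[of n] unfolding boris_step_def by blast
    have V0B: "V 0 \<times> B (X 0) = 0" by (simp add: V0 X0 B_eq cross_mult_left cross_mult_right)
    have tT: "real k * h \<in> {0..T}" if "k \<le> M" "real M * h \<le> T" for k M :: nat
    proof -
      have "real k * h \<le> real M * h" using that(1) h by (intro mult_right_mono) auto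
      from order_trans[OF this that(2)] show ?thesis using h by simp
    qed
    \<comment> \<open>The comparison, conditional on the trajectory staying within radius
      \<open>r\<close> up to step \<open>M\<close>.\<close>
    have close: "norm (X k - x (real k * h)) \<le> C4 * h\<^sup>2 \<and>
        \<bar>par (X k) (V k) - par (x (real k * h)) (v (real k * h))\<bar> \<le> C4 * h\<^sup>2 \<and> norm (perp (X k) (V k)) \<le> C0 * h\<^sup>2"
      if MT: "real M * h \<le> T" and bd: "\<And>n. n \<le> M \<Longrightarrow> norm (X n) \<le> r \<and> norm (V n) \<le> r" and kM: "k \<le> M" for M k
    proof -
      have aR: "norm (A k) \<le> R" if "k \<le> M" for k
        by (rule acc[OF bo e(1) h(1) hh(2) he mr[unfolded m_def] MT _ V0B that]) (use bd in blast)
      have ck: "norm (xcor h (X k) (A k) - X k) \<le> C0 * h\<^sup>2 \<and> \<bar>ucor h (X k) (V k) (A k) - par (X k) (V k)\<bar> \<le> C0 * h\<^sup>2 \<and>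
          norm (perp (X k) (V k)) \<le> C0 * h\<^sup>2" if "k \<le> M" for k
        using cor[OF aeq e(1) h(1) hh(1) he mr _ _ aR[OF that]] bd[OF that] by blast
      let ?t = "\<lambda>k. real k * h"
      let ?X = "\<lambda>k. xcor h (X k) (A k)" and ?U = "\<lambda>k. ucor h (X k) (V k) (A k)"
      define s where "s k = norm (?X k - y (?t k)) + \<bar>?U k - U (?t k)\<bar>" for k
      have zb: "norm (?X k, ?U k) \<le> rr \<and> norm (?X k, m) \<le> rr \<and> norm (y (?t k), U (?t k)) \<le> rr \<and> norm (y (?t k), m) \<le> rr"
        if k: "k \<le> M" for k
      proof -
        have C0h: "C0 * h\<^sup>2 \<le> C0" using C0 h21 by (simp add: mult_left_le)
        have "norm (?X k) \<le> r + C0" using ck[OF k] bd[OF k] norm_triangle_sub[of "?X k" "X k"] C0h by linarith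
        moreover have "\<bar>?U k\<bar> \<le> r + C0" using ck[OF k] bd[OF k] par_le[of "X k" "V k"] C0h by linarith
        moreover have "norm (y (?t k)) \<le> r + C0"
          using yU[OF tT[OF k MT]] norm_triangle_sub[of "y (?t k)" "x (?t k)"] Ce1 C0 unfolding r_def r1_def by linarith
        moreover have "\<bar>U (?t k)\<bar> \<le> r + C0"
          using yU[OF tT[OF k MT]] par_le[of "x (?t k)" "v (?t k)"] Ce1 C0 unfolding r_def r1_def by linarith
        moreover have "\<bar>m\<bar> \<le> r + C0" using mr C0 by linarith
        moreover have "norm (q, c) \<le> rr" if "norm q \<le> r + C0" "\<bar>c\<bar> \<le> r + C0" for q :: vec3 and c :: real
          using norm_Pair_le[of q c] that by (simp add: rr_def)
        ultimately show ?thesis by blast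
      qed
      have F1: "norm (?U k *\<^sub>R b (?X k) - U (?t k) *\<^sub>R b (y (?t k))) \<le> L1 * s k" if "k \<le> M" for k
      proof -
        have "norm (?U k *\<^sub>R b (?X k) - U (?t k) *\<^sub>R b (y (?t k))) \<le> L1 * norm ((?X k, ?U k) - (y (?t k), U (?t k)))"
          using L1(2)[of "(?X k, ?U k)" "(y (?t k), U (?t k))"] zb[OF that] by simp
        also have "\<dots> \<le> L1 * s k"
          using norm_Pair_le[of "?X k - y (?t k)" "?U k - U (?t k)"] L1(1) by (intro mult_left_mono) (simp_all add: s_def)
        finally show ?thesis .
      qed
      have F2: "\<bar>g m (?X k) - g m (y (?t k))\<bar> \<le> Lg * s k" if "k \<le> M" for k
      proof -
        have "\<bar>g m (?X k) - g m (y (?t k))\<bar> \<le> Lg * norm ((?X k, m) - (y (?t k), m))"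
          using Lg(2)[of "(?X k, m)" "(y (?t k), m)"] zb[OF that] by simp
        also have "\<dots> \<le> Lg * s k"
          using Lg(1) by (intro mult_left_mono) (simp_all add: s_def norm_Pair)
        finally show ?thesis .
      qed
      \<comment> \<open>\<open>R\<close> is set to the final bound itself, so the size condition of
        \<open>discrete_gronwall\<close> is reflexive.\<close>
      have "s k \<le> exp (4 * L * T) * (s 0 + (K * h\<^sup>2)/2)"
      proof (rule discrete_gronwall[where R="exp (4 * L * T) * (s 0 + (K * h\<^sup>2)/2)" and h=h and M=M])
        fix k assume k: "k < M"
        then have k1: "k \<le> M" "Suc k \<le> M" by auto
        let ?k = "Suc k"
        have tk: "?t ?k = ?t k + h" by (simp add: algebra_simps)
        have "?t ?k \<le> T" using tT[OF k1(2) MT] by simp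
        then have yt: "norm (y (?t ?k) - y (?t k) - (h/2) *\<^sub>R (U (?t k) *\<^sub>R b (y (?t k)) + U (?t ?k) *\<^sub>R b (y (?t ?k)))) \<le> Cx * h * (e + h\<^sup>2)"
          "\<bar>U (?t ?k) - U (?t k) - (h/2) * (g m (y (?t k)) + g m (y (?t ?k)))\<bar> \<le> Cx * h * (e + h\<^sup>2)"
          using ytrap[of "?t k" h] h hh(1) unfolding tk by auto
        have Xt: "norm (?X ?k - ?X k - (h/2) *\<^sub>R (?U k *\<^sub>R b (?X k) + ?U ?k *\<^sub>R b (?X ?k))) \<le> C2 * h ^ 3"
          "\<bar>?U ?k - ?U k - (h/2) * (g m (?X k) + g m (?X ?k))\<bar> \<le> C2 * h ^ 3"
          using trap[OF st[of k] e(1) h(1) hh(1) he mr _ _ _ _ aR[OF k1(1)] aR[OF k1(2)]] bd[OF k1(1)] bd[OF k1(2)] by auto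
        define \<delta> where "\<delta> = C2 * h ^ 3 + Cx * h * (e + h\<^sup>2)"
        have d: "\<delta> \<le> h * (K * h\<^sup>2) / 2"
        proof -
          have "e + h\<^sup>2 \<le> (1/cs + 1) * h\<^sup>2" using eh by (simp only: distrib_right mult_1)
          then have "Cx * h * (e + h\<^sup>2) \<le> Cx * h * ((1/cs + 1) * h\<^sup>2)"
            using Cx h by (intro mult_left_mono) auto
          moreover have "C2 * h ^ 3 + Cx * h * ((1/cs + 1) * h\<^sup>2) = h * (K * h\<^sup>2) / 2"
            by (simp add: K_def power3_eq_cube power2_eq_square algebra_simps)
          ultimately show ?thesis unfolding \<delta>_def by linarith
        qed
        have SX: "norm (?X ?k - y (?t ?k)) \<le> norm (?X k - y (?t k)) + (h/2) * (L1 * s k + L1 * s ?k) + \<delta>"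
          unfolding \<delta>_def
        proof (rule defect_increment_le[OF Xt(1) yt(1)])
          show "norm ((h/2) *\<^sub>R (?U k *\<^sub>R b (?X k) + ?U ?k *\<^sub>R b (?X ?k)) - (h/2) *\<^sub>R (U (?t k) *\<^sub>R b (y (?t k)) + U (?t ?k) *\<^sub>R b (y (?t ?k))))
              \<le> (h/2) * (L1 * s k + L1 * s ?k)"
            using h(1) by (intro scaled_sum_diff_le F1 k1) simp
        qed
        have SU: "\<bar>?U ?k - U (?t ?k)\<bar> \<le> \<bar>?U k - U (?t k)\<bar> + (h/2) * (Lg * s k + Lg * s ?k) + \<delta>"
          unfolding \<delta>_def real_norm_def[symmetric]
        proof (rule defect_increment_le[OF Xt(2)[folded real_norm_def] yt(2)[folded real_norm_def]])
          have "norm ((h/2) *\<^sub>R (g m (?X k) + g m (?X ?k)) - (h/2) *\<^sub>R (g m (y (?t k)) + g m (y (?t ?k)))) \<le> (h/2) * (Lg * s k + Lg * s ?k)"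
            using h(1) F2[OF k1(1)] F2[OF k1(2)] by (intro scaled_sum_diff_le) auto
          then show "norm ((h/2) * (g m (?X k) + g m (?X ?k)) - (h/2) * (g m (y (?t k)) + g m (y (?t ?k)))) \<le> (h/2) * (Lg * s k + Lg * s ?k)"
            by (simp only: real_scaleR_def)
        qed
        have sL: "(h/2) * (L1 * s k + L1 * s ?k) + (h/2) * (Lg * s k + Lg * s ?k) \<le> h * L * (s k + s ?k)"
        proof -
          have "(h/2) * (L1 * s k + L1 * s ?k) + (h/2) * (Lg * s k + Lg * s ?k) = h * ((L1 + Lg) / 2) * (s k + s ?k)"
            by (simp add: algebra_simps)
          also have "\<dots> \<le> h * L * (s k + s ?k)"
            using h L1(1) Lg(1) by (intro mult_right_mono mult_left_mono) (auto simp: L_def s_def)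
          finally show ?thesis .
        qed
        \<comment> \<open>The summand 1 in \<open>L\<close> gives \<open>L \<ge> 1\<close>, which
          brings the defect into the form \<open>h * L * d\<close>.\<close>
        have "h * (K * h\<^sup>2) \<le> h * L * (K * h\<^sup>2)"
          using L0 h K0 by (intro mult_right_mono) (auto simp: mult_le_cancel_left1)
        then have "s ?k \<le> s k + (h * L * (K * h\<^sup>2) + h * L * (s k + s ?k))"
          using SX SU sL d by (simp only: s_def[of ?k] s_def[of k])
        then show "s ?k \<le> s k + h * L * (K * h\<^sup>2 + s k + s ?k)" by (simp add: distrib_left add.assoc)
      qed (use h L0 K0 hL MT kM in \<open>auto simp: s_def\<close>)
      also have "\<dots> \<le> C3 * h\<^sup>2"
      proof -
        have z: "0 \<in> {0..T}" using T by simp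
        have p0: "par (X 0) (V 0) = par (x 0) (v 0)" by (simp add: X0 V0 par_def b_b)
        have "norm (?X 0 - y 0) \<le> norm (?X 0 - X 0) + norm (y 0 - x 0)"
          using norm_triangle_ineq4[of "?X 0 - X 0" "y 0 - x 0"] by (simp add: X0)
        then have "norm (?X 0 - y 0) \<le> C0 * h\<^sup>2 + (Cx / cs) * h\<^sup>2" using ck[of 0] yU[OF z] Ceh by simp
        moreover have "\<bar>?U 0 - par (x 0) (v 0)\<bar> \<le> C0 * h\<^sup>2" using ck[of 0] p0 by simp
        then have "\<bar>?U 0 - U 0\<bar> \<le> C0 * h\<^sup>2 + (Cx / cs) * h\<^sup>2" using yU[OF z] Ceh by linarith
        moreover have "s 0 = norm (?X 0 - y 0) + \<bar>?U 0 - U 0\<bar>" by (simp add: s_def)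
        moreover have "E0 * h\<^sup>2 = (C0 * h\<^sup>2 + (Cx / cs) * h\<^sup>2) + (C0 * h\<^sup>2 + (Cx / cs) * h\<^sup>2)"
          by (simp add: E0_def algebra_simps)
        ultimately have "s 0 \<le> E0 * h\<^sup>2" by linarith
        moreover have "(K * h\<^sup>2)/2 \<le> K * h\<^sup>2" using K0 by simp
        ultimately have "s 0 + (K * h\<^sup>2)/2 \<le> (E0 + K) * h\<^sup>2" by (simp only: distrib_right)
        then have "exp (4 * L * T) * (s 0 + (K * h\<^sup>2)/2) \<le> exp (4 * L * T) * ((E0 + K) * h\<^sup>2)" by (intro mult_left_mono) auto
        then show ?thesis by (simp add: C3_def mult.assoc)
      qed
      finally have sk: "s k \<le> C3 * h\<^sup>2" .
      have C4: "C0 * h\<^sup>2 + C3 * h\<^sup>2 + (Cx / cs) * h\<^sup>2 = C4 * h\<^sup>2" by (simp add: C4_def algebra_simps)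
      have "X k - x (?t k) = (X k - ?X k) + (?X k - y (?t k)) + (y (?t k) - x (?t k))" by simp
      also have "norm \<dots> \<le> C0 * h\<^sup>2 + C3 * h\<^sup>2 + (Cx / cs) * h\<^sup>2"
      proof (intro norm_triangle_mono)
        show "norm (X k - ?X k) \<le> C0 * h\<^sup>2" using ck[OF kM] by (simp add: norm_minus_commute)
        show "norm (?X k - y (?t k)) \<le> C3 * h\<^sup>2" using sk by (simp add: s_def)
        show "norm (y (?t k) - x (?t k)) \<le> (Cx / cs) * h\<^sup>2" using yU[OF tT[OF kM MT]] Ceh by linarith
      qed
      finally have "norm (X k - x (?t k)) \<le> C4 * h\<^sup>2" unfolding C4 .
      moreover have "\<bar>?U k - U (?t k)\<bar> \<le> C3 * h\<^sup>2" using sk norm_ge_zero[of "?X k - y (?t k)"] unfolding s_def by linarith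
      then have "\<bar>par (X k) (V k) - par (x (?t k)) (v (?t k))\<bar> \<le> C4 * h\<^sup>2"
        using ck[OF kM] yU[OF tT[OF kM MT]] Ceh C4 by linarith
      ultimately show ?thesis using ck[OF kM] by blast
    qed
    \<comment> \<open>The error bound is at most 1 by \<open>hC\<close>, so closeness to the exact
      solution returns the trajectory from radius \<open>r\<close> to \<open>r1\<close>.\<close>
    have inner: "norm (X k) \<le> r1 \<and> norm (V k) \<le> r1"
      if MT: "real M * h \<le> T" and bd: "\<And>n. n \<le> M \<Longrightarrow> norm (X n) \<le> r \<and> norm (V n) \<le> r" and kM: "k \<le> M" for M k
    proof -
      note c = close[OF that]
      have c1: "C4 * h\<^sup>2 + C0 * h\<^sup>2 \<le> 1" "C0 * h\<^sup>2 \<ge> 0" using hC C0 by (simp_all add: distrib_right)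
      note y = yU[OF tT[OF kM MT]]
      have "norm (X k) \<le> \<rho> + C4 * h\<^sup>2"
        using c y norm_triangle_sub[of "X k" "x (real k * h)"] by linarith
      then have "norm (X k) \<le> r1" using c1 Cx unfolding r1_def by linarith
      moreover have "norm (V k) \<le> \<bar>par (X k) (V k)\<bar> + norm (perp (X k) (V k))"
        using norm_triangle_ineq[of "par (X k) (V k) *\<^sub>R b (X k)" "perp (X k) (V k)"] perp_decomp[of "V k" "X k"] norm_b
        by simp
      then have "norm (V k) \<le> r1" using c y par_le[of "x (real k * h)" "v (real k * h)"] c1 Cx unfolding r1_def by linarith
      ultimately show ?thesis by simp
    qed
    have bdd: "norm (X k) \<le> r1 \<and> norm (V k) \<le> r1" if "real M * h \<le> T" "k \<le> M" for M k
      using that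
    proof (induction M arbitrary: k)
      case 0
      have z: "0 \<in> {0..T}" using T by simp
      show ?case using yU[OF z] par_le[of "x 0" "v 0"] Cx 0 by (simp add: X0 V0 norm_b r1_def)
    next
      case (Suc M)
      have MT: "real M * h \<le> T"
        using Suc.prems(1) h mult_right_mono[of "real M" "real (Suc M)" h] by linarith
      have bM: "norm (X n) \<le> r1 \<and> norm (V n) \<le> r1" if "n \<le> M" for n by (rule Suc.IH[OF MT that])
      have bM': "norm (X n) \<le> r \<and> norm (V n) \<le> r" if "n \<le> M" for n using bM[OF that] by (simp add: r_def)
      \<comment> \<open>Only the acceleration at step \<open>M\<close> is available: a bound at
        \<open>Suc M\<close> would presuppose the radius bound being proved. This is why
        \<open>boris_velocity_le\<close> avoids the new acceleration.\<close>
      have aM: "norm (A M) \<le> R"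
        by (rule acc[OF bo e(1) h(1) hh(2) he mr[unfolded m_def] MT _ V0B order_refl]) (use bM' in blast)
      have hs: "h * r1 + h * R + h * Lf \<le> 1" using hR by (simp add: distrib_left)
      have hn: "h * r1 \<ge> 0" "h * R \<ge> 0" "h * Lf \<ge> 0" using h r10 R Lf(1) by simp_all
      have "X (Suc M) = X M + h *\<^sub>R V M + (h\<^sup>2/2) *\<^sub>R A M" using st[of M] unfolding boris_step_def by blast
      also have "norm \<dots> \<le> r1 + h * r1 + h * R"
      proof (intro norm_triangle_mono)
        show "norm (X M) \<le> r1" using bM by simp
        show "norm (h *\<^sub>R V M) \<le> h * r1" using bM[of M] h by (simp add: mult_left_mono)
        have "(h\<^sup>2/2) * norm (A M) \<le> h * R" using h2 aM h by (intro mult_mono) auto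
        then show "norm ((h\<^sup>2/2) *\<^sub>R A M) \<le> h * R" by simp
      qed
      finally have XS: "norm (X (Suc M)) \<le> r" using hs hn unfolding r_def by linarith
      have "norm (force m (X (Suc M))) \<le> Lf"
        using Lf(2)[of "(X (Suc M), m)"] norm_Pair_le[of "X (Suc M)" m] XS mr by simp
      then have "(h/2) * (norm (A M) + norm (force m (X (Suc M)))) \<le> h * (R + Lf)"
        using aM h by (intro mult_mono) auto
      then have "norm (V (Suc M)) \<le> r1 + h * R + h * Lf"
        using boris_velocity_le[OF st[of M]] h bM[of M] by (simp add: distrib_left)
      then have VS: "norm (V (Suc M)) \<le> r" using hs hn unfolding r_def by linarith
      have "norm (X n) \<le> r \<and> norm (V n) \<le> r" if "n \<le> Suc M" for n
        using that bM'[of n] XS VS by (cases "n = Suc M") auto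
      then show ?case using inner[OF Suc.prems(1)] Suc.prems(2) by blast
    qed
    have "norm (X k) \<le> r \<and> norm (V k) \<le> r" if "k \<le> n" for k using bdd[OF nT that] by (simp add: r_def)
    from close[OF nT this order_refl]
    have c: "norm (X n - x (real n * h)) \<le> C4 * h\<^sup>2" "\<bar>par (X n) (V n) - par (x (real n * h)) (v (real n * h))\<bar> \<le> C4 * h\<^sup>2"
      "norm (perp (X n) (V n)) \<le> C0 * h\<^sup>2" by blast+
    have "C0 * h\<^sup>2 \<le> C4 * h\<^sup>2" using C30 Cx cs by (intro mult_right_mono) (auto simp: C4_def)
    with c show "norm (X n - x (real n * h)) \<le> C4 * h\<^sup>2 \<and>
      \<bar>par (X n) (V n) - par (x (real n * h)) (v (real n * h))\<bar> \<le> C4 * h\<^sup>2 \<and>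
      norm (perp (X n) (V n)) \<le> C4 * h\<^sup>2" by linarith
  qed
qed


text \<open>With \<open>e\<close> bounded below, each single step maps bounded sets to bounded sets.
  The bound may grow with \<open>n\<close> without control, which is harmless because only finitely
  many steps fit into \<open>[0, T]\<close> when \<open>h\<close> is bounded below.\<close>

lemma boris_bounded_large_step:
  assumes e0: "e0 > 0"
  shows "\<exists>b. \<forall>e h m X V A. boris e h m X V A \<longrightarrow> e0 \<le> e \<longrightarrow> 0 < h \<longrightarrow> h \<le> H \<longrightarrow> \<bar>m\<bar> \<le> M \<longrightarrow>
    norm (X 0) \<le> M0 \<longrightarrow> norm (V 0) \<le> M1 \<longrightarrow> norm (X n) \<le> b \<and> norm (V n) \<le> b"
proof (induction n)
  case 0
  show ?case by (intro exI[of _ "max M0 M1"]) auto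
next
  case (Suc n)
  then obtain c where c: "\<And>e h m X V A. boris e h m X V A \<Longrightarrow> e0 \<le> e \<Longrightarrow> 0 < h \<Longrightarrow> h \<le> H \<Longrightarrow> \<bar>m\<bar> \<le> M \<Longrightarrow>
    norm (X 0) \<le> M0 \<Longrightarrow> norm (V 0) \<le> M1 \<Longrightarrow> norm (X n) \<le> c \<and> norm (V n) \<le> c" by metis
  obtain LB where LB: "LB \<ge> 0" "\<And>x. norm x \<le> c \<Longrightarrow> norm (B x) \<le> LB"
    by (rule lip_bound[OF lip_smooth3[OF B_smooth], where r=c]) (rule that)
  obtain Lf where Lf: "Lf \<ge> 0" "\<And>z. norm z \<le> c + M \<Longrightarrow> norm (force (snd z) (fst z)) \<le> Lf"
    by (rule lip_bound[OF lip_force, where r="c + M"]) (rule that)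
  define a where "a = (1/e0) * (c * LB) + Lf"
  define d where "d = c + H * c + H\<^sup>2 * a"
  obtain Lf' where Lf': "Lf' \<ge> 0" "\<And>z. norm z \<le> d + M \<Longrightarrow> norm (force (snd z) (fst z)) \<le> Lf'"
    by (rule lip_bound[OF lip_force, where r="d + M"]) (rule that)
  have "norm (X (Suc n)) \<le> max d (c + H * (a + Lf')) \<and> norm (V (Suc n)) \<le> max d (c + H * (a + Lf'))"
    if bo: "boris e h m X V A" and *: "e0 \<le> e" "0 < h" "h \<le> H" "\<bar>m\<bar> \<le> M" "norm (X 0) \<le> M0" "norm (V 0) \<le> M1"
    for e h m X V A
  proof -
    have st: "boris_step e h m (X n) (V n) (A n) (X (Suc n)) (V (Suc n)) (A (Suc n))"
      using bo by (simp add: boris_def)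
    have XV: "norm (X n) \<le> c" "norm (V n) \<le> c" using c[OF bo *] by auto
    have c0: "c \<ge> 0" using XV(1) norm_ge_zero[of "X n"] by linarith
    have A: "norm (A n) \<le> a"
    proof -
      have "A n = (1/e) *\<^sub>R (V n \<times> B (X n)) + force m (X n)" using st unfolding boris_step_def by blast
      also have "norm \<dots> \<le> (1/e0) * (c * LB) + Lf"
      proof (rule norm_triangle_mono)
        have "norm (V n \<times> B (X n)) \<le> c * LB"
          using XV LB(2)[OF XV(1)] c0 by (intro order_trans[OF norm_cross3_le] mult_mono) auto
        moreover have "1/e \<le> 1/e0" using * e0 by (simp add: frac_le)
        ultimately have "(1/e) * norm (V n \<times> B (X n)) \<le> (1/e0) * (c * LB)"
          using * e0 by (intro mult_mono) auto
        then show "norm ((1/e) *\<^sub>R (V n \<times> B (X n))) \<le> (1/e0) * (c * LB)" using * e0 by simp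
        show "norm (force m (X n)) \<le> Lf"
          using Lf(2)[of "(X n, m)"] norm_Pair_le[of "X n" m] XV * by simp
      qed
      finally show ?thesis by (simp add: a_def)
    qed
    have a0: "a \<ge> 0" using A norm_ge_zero[of "A n"] by linarith
    have "X (Suc n) = X n + h *\<^sub>R V n + (h\<^sup>2/2) *\<^sub>R A n" using st unfolding boris_step_def by blast
    also have "norm \<dots> \<le> c + H * c + H\<^sup>2 * a"
    proof (intro norm_triangle_mono XV)
      show "norm (h *\<^sub>R V n) \<le> H * c" using XV * by (simp add: mult_mono)
      have "h\<^sup>2 \<le> H\<^sup>2" using * by (intro power_mono) auto
      then have "h\<^sup>2/2 \<le> H\<^sup>2" using zero_le_power2[of h] by linarith
      then have "(h\<^sup>2/2) * norm (A n) \<le> H\<^sup>2 * a" using A by (intro mult_mono) auto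
      then show "norm ((h\<^sup>2/2) *\<^sub>R A n) \<le> H\<^sup>2 * a" by simp
    qed
    finally have X: "norm (X (Suc n)) \<le> d" by (simp add: d_def)
    have "norm (force m (X (Suc n))) \<le> Lf'"
      using Lf'(2)[of "(X (Suc n), m)"] norm_Pair_le[of "X (Suc n)" m] X * by simp
    then have "(h/2) * (norm (A n) + norm (force m (X (Suc n)))) \<le> H * (a + Lf')"
      using A * by (intro mult_mono) auto
    then have "norm (V (Suc n)) \<le> c + H * (a + Lf')" using boris_velocity_le[OF st] XV * by simp
    with X show ?thesis by auto
  qed
  then show ?case by blast
qed

text \<open>Above the threshold \<open>h0\<close>, mere boundedness is an error bound of order
  \<open>h^2\<close>, after division of the constant by \<open>h0^2\<close>.\<close>

lemma boris_convergence:
  assumes cs: "cs > 0" and Cs: "Cs > 0" and T: "T \<ge> 0"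
  obtains C where "C \<ge> 0" "\<And>e h x v X V A n. 0 < e \<Longrightarrow> e < 1 \<Longrightarrow> 0 < h \<Longrightarrow>
    cs * e \<le> h\<^sup>2 \<Longrightarrow> h\<^sup>2 \<le> Cs * e \<Longrightarrow> motion e T x v \<Longrightarrow> norm (x 0) \<le> M0 \<Longrightarrow> norm (v 0) \<le> M1 \<Longrightarrow>
    boris e h (moment (x 0) (v 0)) X V A \<Longrightarrow> X 0 = x 0 \<Longrightarrow> V 0 = par (x 0) (v 0) *\<^sub>R b (x 0) \<Longrightarrow>
    real n * h \<le> T \<Longrightarrow>
    norm (X n - x (real n * h)) \<le> C * h\<^sup>2 \<and>
    norm (par (X n) (V n) *\<^sub>R b (X n) - par (x (real n * h)) (v (real n * h)) *\<^sub>R b (x (real n * h))) \<le> C * h\<^sup>2 \<and>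
    norm (perp (X n) (V n)) \<le> C * h\<^sup>2"
proof -
  obtain C1 h0 where C1: "C1 \<ge> 0" and h0: "h0 > 0" and small: "\<And>e h x v X V A n. 0 < e \<Longrightarrow> e < 1 \<Longrightarrow> 0 < h \<Longrightarrow> h \<le> h0 \<Longrightarrow>
    cs * e \<le> h\<^sup>2 \<Longrightarrow> motion e T x v \<Longrightarrow> norm (x 0) \<le> M0 \<Longrightarrow> norm (v 0) \<le> M1 \<Longrightarrow>
    boris e h (moment (x 0) (v 0)) X V A \<Longrightarrow> X 0 = x 0 \<Longrightarrow> V 0 = par (x 0) (v 0) *\<^sub>R b (x 0) \<Longrightarrow>
    real n * h \<le> T \<Longrightarrow>
    norm (X n - x (real n * h)) \<le> C1 * h\<^sup>2 \<and>
    \<bar>par (X n) (V n) - par (x (real n * h)) (v (real n * h))\<bar> \<le> C1 * h\<^sup>2 \<and>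
    norm (perp (X n) (V n)) \<le> C1 * h\<^sup>2"
    by (rule boris_convergence_small_step[OF cs T, of M0 M1]) (rule that)
  obtain \<rho>' where \<rho>': "\<And>e x v t. motion e T x v \<Longrightarrow> norm (x 0) \<le> M0 \<Longrightarrow> norm (v 0) \<le> M1 \<Longrightarrow> t \<in> {0..T} \<Longrightarrow>
    norm (x t) \<le> \<rho>' \<and> norm (v t) \<le> \<rho>'" by (rule motion_bounded[OF T, of M0 M1]) (rule that)
  define \<rho> where "\<rho> = \<bar>\<rho>'\<bar>"
  obtain Lm where Lm: "\<And>x v. norm x \<le> max M0 M1 \<Longrightarrow> norm v \<le> max M0 M1 \<Longrightarrow> norm (moment x v) \<le> Lm"
    using phase_bound[OF phase_moment] by metis
  \<comment> \<open>From \<open>h0 < h\<close> and \<open>h^2 \<le> Cs * e\<close> it follows that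
    \<open>e0 \<le> e\<close>.\<close>
  define e0 where "e0 = h0\<^sup>2 / Cs"
  have e0: "e0 > 0" using h0 Cs by (simp add: e0_def)
  \<comment> \<open>One bound for all step numbers compatible with \<open>n * h \<le> T\<close> and
    \<open>h0 \<le> h\<close>, obtained by summing the bounds for the individual
    \<open>n\<close>.\<close>
  have "\<exists>b. \<forall>n e h m X V A. n \<le> nat \<lceil>T / h0\<rceil> \<longrightarrow> boris e h m X V A \<longrightarrow> e0 \<le> e \<longrightarrow> 0 < h \<longrightarrow> h \<le> sqrt Cs \<longrightarrow> \<bar>m\<bar> \<le> Lm \<longrightarrow>
    norm (X 0) \<le> M0 \<longrightarrow> norm (V 0) \<le> M1 \<longrightarrow> norm (X n) \<le> b \<and> norm (V n) \<le> b"
  proof -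
    obtain c where c: "\<And>n e h m X V A. boris e h m X V A \<Longrightarrow> e0 \<le> e \<Longrightarrow> 0 < h \<Longrightarrow> h \<le> sqrt Cs \<Longrightarrow> \<bar>m\<bar> \<le> Lm \<Longrightarrow>
      norm (X 0) \<le> M0 \<Longrightarrow> norm (V 0) \<le> M1 \<Longrightarrow> norm (X n) \<le> c n \<and> norm (V n) \<le> c n"
      using boris_bounded_large_step[OF e0, of "sqrt Cs" Lm M0 M1] by metis
    have "c n \<le> (\<Sum>k\<le>nat \<lceil>T / h0\<rceil>. \<bar>c k\<bar>)" if "n \<le> nat \<lceil>T / h0\<rceil>" for n
      by (rule order_trans[OF abs_ge_self member_le_sum[where f="\<lambda>k. \<bar>c k\<bar>"]]) (use that in auto)
    then show ?thesis using c by (meson order_trans)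
  qed
  then obtain c where c: "\<And>n e h m X V A. n \<le> nat \<lceil>T / h0\<rceil> \<Longrightarrow> boris e h m X V A \<Longrightarrow> e0 \<le> e \<Longrightarrow> 0 < h \<Longrightarrow> h \<le> sqrt Cs \<Longrightarrow> \<bar>m\<bar> \<le> Lm \<Longrightarrow>
    norm (X 0) \<le> M0 \<Longrightarrow> norm (V 0) \<le> M1 \<Longrightarrow> norm (X n) \<le> c \<and> norm (V n) \<le> c" by metis
  \<comment> \<open>The second entry dominates the sum of the numerical and exact bounds, twice
    \<open>\<bar>c\<bar>\<close> because the perpendicular part is estimated by velocity plus
    parallel velocity.\<close>
  define D where "D = max C1 ((2 * \<bar>c\<bar> + \<rho>) / h0\<^sup>2)"
  obtain Lb where Lb: "Lb \<ge> 0" "\<And>x y. norm x \<le> \<rho> + D * Cs \<Longrightarrow> norm y \<le> \<rho> + D * Cs \<Longrightarrow> norm (b x - b y) \<le> Lb * norm (x - y)"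
    by (rule lip_increment[OF lip_smooth3[OF smooth_b], where r="\<rho> + D * Cs"]) (rule that)
  have D0: "D \<ge> 0" using C1 by (simp add: D_def)
  have \<rho>0: "\<rho> \<ge> 0" by (simp add: \<rho>_def)
  show ?thesis
  proof (rule that[of "D + \<rho> * (Lb * D)"])
    show "D + \<rho> * (Lb * D) \<ge> 0" using D0 \<rho>0 Lb(1) by simp
    fix e h x v X V A and n :: nat
    assume e: "0 < e" "e < 1" and h: "0 < h" and he: "cs * e \<le> h\<^sup>2" "h\<^sup>2 \<le> Cs * e" and mo: "motion e T x v"
      and ini: "norm (x 0) \<le> M0" "norm (v 0) \<le> M1" and bo: "boris e h (moment (x 0) (v 0)) X V A"
      and X0: "X 0 = x 0" and V0: "V 0 = par (x 0) (v 0) *\<^sub>R b (x 0)" and nT: "real n * h \<le> T"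
    let ?t = "real n * h"
    have t: "?t \<in> {0..T}" using nT h by simp
    have xv: "norm (x ?t) \<le> \<rho>" "norm (v ?t) \<le> \<rho>" using \<rho>'[OF mo ini t] by (auto simp: \<rho>_def)
    have h2: "h\<^sup>2 \<le> Cs" using he(2) mult_left_mono[of e 1 Cs] e Cs by linarith
    have est: "norm (X n - x ?t) \<le> D * h\<^sup>2 \<and> \<bar>par (X n) (V n) - par (x ?t) (v ?t)\<bar> \<le> D * h\<^sup>2 \<and> norm (perp (X n) (V n)) \<le> D * h\<^sup>2"
    proof (cases "h \<le> h0")
      case True
      have "C1 * h\<^sup>2 \<le> D * h\<^sup>2" by (intro mult_right_mono) (auto simp: D_def)
      with small[OF e h True he(1) mo ini bo X0 V0 nT] show ?thesis by linarith
    next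
      case False
      then have hh: "h0 \<le> h" by simp
      have "real n \<le> T / h0"
      proof -
        have "real n * h0 \<le> real n * h" using hh by (intro mult_left_mono) auto
        then have "real n * h0 \<le> T" using nT by linarith
        then show ?thesis using h0 by (simp add: field_simps)
      qed
      then have n: "n \<le> nat \<lceil>T / h0\<rceil>" by linarith
      have hsq: "h0\<^sup>2 \<le> h\<^sup>2" using hh h0 by (intro power_mono) auto
      have "e0 \<le> e" using hsq he(2) Cs by (simp add: e0_def field_simps)
      moreover have "h \<le> sqrt Cs" using h2 by (rule real_le_rsqrt)
      moreover have "\<bar>moment (x 0) (v 0)\<bar> \<le> Lm" using Lm[of "x 0" "v 0"] ini by simp
      moreover have "norm (V 0) \<le> M1" using par_le[of "x 0" "v 0"] ini by (simp add: V0 norm_b)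
      ultimately have XV: "norm (X n) \<le> c" "norm (V n) \<le> c" using c[OF n bo _ h] ini by (auto simp: X0)
      have "(2 * \<bar>c\<bar> + \<rho>) / h0\<^sup>2 * h0\<^sup>2 \<le> D * h\<^sup>2" using hsq D0 by (intro mult_mono) (auto simp: D_def)
      then have D: "2 * \<bar>c\<bar> + \<rho> \<le> D * h\<^sup>2" using h0 by simp
      have "norm (X n - x ?t) \<le> D * h\<^sup>2" using norm_triangle_ineq4[of "X n" "x ?t"] XV xv D by linarith
      moreover have "\<bar>par (X n) (V n) - par (x ?t) (v ?t)\<bar> \<le> D * h\<^sup>2"
        using par_le[of "X n" "V n"] par_le[of "x ?t" "v ?t"] XV xv D by linarith
      moreover have "norm (perp (X n) (V n)) \<le> norm (V n) + \<bar>par (X n) (V n)\<bar>"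
        using norm_triangle_ineq4[of "V n" "par (X n) (V n) *\<^sub>R b (X n)"] by (simp add: perp_def par_def norm_b)
      then have "norm (perp (X n) (V n)) \<le> D * h\<^sup>2" using par_le[of "X n" "V n"] XV \<rho>0 D by linarith
      ultimately show ?thesis by blast
    qed
    have Dh: "D * h\<^sup>2 \<le> D * Cs" using h2 D0 by (rule mult_left_mono)
    have dC0: "D * Cs \<ge> 0" using D0 Cs by simp
    have "norm (b (X n) - b (x ?t)) \<le> Lb * (D * h\<^sup>2)"
    proof -
      have "norm (X n) \<le> \<rho> + D * Cs" using norm_triangle_sub[of "X n" "x ?t"] est xv Dh by linarith
      then have "norm (b (X n) - b (x ?t)) \<le> Lb * norm (X n - x ?t)" using xv dC0 by (intro Lb(2)) auto
      also have "\<dots> \<le> Lb * (D * h\<^sup>2)" using est Lb(1) by (intro mult_left_mono) auto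
      finally show ?thesis .
    qed
    moreover have "\<bar>par (x ?t) (v ?t)\<bar> \<le> \<rho>" using par_le[of "x ?t" "v ?t"] xv by linarith
    ultimately have "\<bar>par (x ?t) (v ?t)\<bar> * norm (b (X n) - b (x ?t)) \<le> \<rho> * (Lb * (D * h\<^sup>2))"
      using \<rho>0 by (intro mult_mono) auto
    \<comment> \<open>The parallel vectors differ by their lengths and by the directions of the
      field at two points; the latter is controlled by the position error.\<close>
    moreover have "par (X n) (V n) *\<^sub>R b (X n) - par (x ?t) (v ?t) *\<^sub>R b (x ?t)
        = (par (X n) (V n) - par (x ?t) (v ?t)) *\<^sub>R b (X n) + par (x ?t) (v ?t) *\<^sub>R (b (X n) - b (x ?t))"
      by (simp add: algebra_simps)
    ultimately have "norm (par (X n) (V n) *\<^sub>R b (X n) - par (x ?t) (v ?t) *\<^sub>R b (x ?t)) \<le> D * h\<^sup>2 + \<rho> * (Lb * (D * h\<^sup>2))"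
      using est by (simp only:) (intro norm_triangle_mono; simp add: norm_b)
    also have "\<dots> = (D + \<rho> * (Lb * D)) * h\<^sup>2" by (simp add: algebra_simps)
    finally have P: "norm (par (X n) (V n) *\<^sub>R b (X n) - par (x ?t) (v ?t) *\<^sub>R b (x ?t)) \<le> (D + \<rho> * (Lb * D)) * h\<^sup>2" .
    have "D * h\<^sup>2 \<le> (D + \<rho> * (Lb * D)) * h\<^sup>2" using D0 \<rho>0 Lb(1) by (intro mult_right_mono) auto
    with est P show "norm (X n - x ?t) \<le> (D + \<rho> * (Lb * D)) * h\<^sup>2 \<and>
      norm (par (X n) (V n) *\<^sub>R b (X n) - par (x ?t) (v ?t) *\<^sub>R b (x ?t)) \<le> (D + \<rho> * (Lb * D)) * h\<^sup>2 \<and>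
      norm (perp (X n) (V n)) \<le> (D + \<rho> * (Lb * D)) * h\<^sup>2"
      by linarith
  qed
qed

section \<open>Passage between the field \<open>B\<close> and the scaled field
  \<open>B/\<epsilon>\<close>\<close>

lemma Ppar_scaled:
  assumes "e > 0"
  shows "Ppar (\<lambda>y. (1/e) *\<^sub>R B y) x v = par x v *\<^sub>R b x"
proof -
  have "(norm ((1/e) *\<^sub>R B x))\<^sup>2 = (N x / e)\<^sup>2" using assms by (simp add: N_def)
  then show ?thesis
    using assms N_pos[of x] unfolding Ppar_def by (simp add: par_def B_eq power2_eq_square)
qed

lemma Pperp_scaled:
  assumes "e > 0"
  shows "Pperp (\<lambda>y. (1/e) *\<^sub>R B y) x v = perp x v"
  unfolding Pperp_def Ppar_scaled[OF assms] by (simp add: perp_def par_def)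

text \<open>The numerator scales like \<open>1/e^2\<close> and the denominator like
  \<open>1/e^3\<close>. The factor \<open>e\<close> cancels the \<open>1/e\<close> of
  \<open>grad_norm_scaled\<close>, so the mirror force in the scheme is of order one.\<close>

lemma magmom_scaled:
  assumes "e > 0"
  shows "magmom (\<lambda>y. (1/e) *\<^sub>R B y) x v = e * moment x v"
proof -
  have "(norm (gyr x v))\<^sup>2 + (perp x v \<bullet> b x)\<^sup>2 = (norm (perp x v) * norm (b x))\<^sup>2"
    using norm_cross_dot[of "perp x v" "b x"] by (simp only: perp_cross_b)
  then have gy: "(norm (gyr x v))\<^sup>2 = perp x v \<bullet> perp x v"
    by (simp add: gyr_orth norm_b dot_square_norm)
  have "norm (v \<times> ((1/e) *\<^sub>R B x)) = (N x / e) * norm (gyr x v)"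
    using assms N_pos[of x] by (simp add: cross_mult_right cross_B)
  moreover have "norm ((1/e) *\<^sub>R B x) = N x / e" using assms by (simp add: N_def)
  ultimately have "magmom (\<lambda>y. (1/e) *\<^sub>R B y) x v = (1/2) * ((N x / e) * norm (gyr x v))\<^sup>2 / (N x / e) ^ 3"
    by (simp only: magmom_def)
  also have "\<dots> = e * moment x v"
    using assms N_pos[of x] unfolding moment_def gy[symmetric]
    by (simp add: field_simps power2_eq_square power3_eq_cube)
  finally show ?thesis .
qed

lemma grad_norm_scaled:
  assumes "e > 0"
  shows "grad (\<lambda>y. norm ((1/e) *\<^sub>R B y)) x = (1/e) *\<^sub>R G x"
proof -
  have "(\<lambda>y. norm ((1/e) *\<^sub>R B y)) = (\<lambda>y. (1/e) * N y)" using assms by (auto simp: N_def)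
  then show ?thesis using grad_scale[OF smooth_N, of "1/e" x] by (simp add: G_def)
qed

text \<open>Adding the centered first and second differences gives the forward position update;
  combining it with both differences at the next index gives the velocity update.\<close>

lemma two_step_imp_boris:
  fixes xs vs :: "nat \<Rightarrow> vec3"
  assumes h: "h > 0"
    and A: "\<And>n. A n = (1/e) *\<^sub>R (vs n \<times> B (xs n)) + force m (xs n)"
    and x1: "xs 1 = xs 0 + h *\<^sub>R vs 0 + (h\<^sup>2/2) *\<^sub>R A 0"
    and v: "\<And>n. n \<ge> 1 \<Longrightarrow> vs n = (1 / (2*h)) *\<^sub>R (xs (n+1) - xs (n-1))"
    and x: "\<And>n. n \<ge> 1 \<Longrightarrow> (1/h\<^sup>2) *\<^sub>R (xs (n+1) - 2 *\<^sub>R xs n + xs (n-1)) = A n"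
  shows "boris e h m xs vs A"
proof -
  have v2: "xs (n+1) - xs (n-1) = (2*h) *\<^sub>R vs n" if "n \<ge> 1" for n
    using v[OF that] h by simp
  have x2: "xs (n+1) - 2 *\<^sub>R xs n + xs (n-1) = h\<^sup>2 *\<^sub>R A n" if "n \<ge> 1" for n
    using x[OF that, symmetric] h by simp
  have X: "xs (Suc n) = xs n + h *\<^sub>R vs n + (h\<^sup>2/2) *\<^sub>R A n" for n
  proof (cases n)
    case (Suc k)
    then have n: "n \<ge> 1" by simp
    have "2 *\<^sub>R (xs (n+1) - xs n) = (xs (n+1) - xs (n-1)) + (xs (n+1) - 2 *\<^sub>R xs n + xs (n-1))"
      by (simp add: algebra_simps scaleR_2)
    also have "\<dots> = 2 *\<^sub>R (h *\<^sub>R vs n + (h\<^sup>2/2) *\<^sub>R A n)"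
      unfolding v2[OF n] x2[OF n] by (simp add: scaleR_add_right)
    finally have "xs (n+1) - xs n = h *\<^sub>R vs n + (h\<^sup>2/2) *\<^sub>R A n" by simp
    then show ?thesis by (simp add: algebra_simps)
  qed (use x1 in simp)
  have V: "vs (Suc n) = vs n + (h/2) *\<^sub>R (A n + A (Suc n))" for n
  proof -
    have "(2*h) *\<^sub>R vs (Suc n) = xs (Suc n + 1) - xs n" using v2[of "Suc n"] by simp
    also have "\<dots> = (xs (Suc n + 1) - 2 *\<^sub>R xs (Suc n) + xs n) + 2 *\<^sub>R (xs (Suc n) - xs n)"
      by (simp add: algebra_simps scaleR_2)
    also have "\<dots> = h\<^sup>2 *\<^sub>R A (Suc n) + 2 *\<^sub>R (h *\<^sub>R vs n + (h\<^sup>2/2) *\<^sub>R A n)"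
      using x2[of "Suc n"] X[of n] by simp
    also have "\<dots> = (2*h) *\<^sub>R (vs n + (h/2) *\<^sub>R (A n + A (Suc n)))"
      by (simp add: algebra_simps power2_eq_square)
    finally show ?thesis using h by simp
  qed
  show ?thesis
    unfolding boris_def boris_step_def
  proof (intro allI conjI)
    fix n
    show "xs (Suc n) = xs n + h *\<^sub>R vs n + (h\<^sup>2/2) *\<^sub>R A n" by (rule X)
    show "vs (Suc n) = vs n + (h/2) *\<^sub>R (A n + A (Suc n))" by (rule V)
    show "A n = (1/e) *\<^sub>R (vs n \<times> B (xs n)) + force m (xs n)"
      "A (Suc n) = (1/e) *\<^sub>R (vs (Suc n) \<times> B (xs (Suc n))) + force m (xs (Suc n))" by (rule A)+
  qed
qed

end

theorem theorem2p1:
  fixes B1 A1 :: "vec3 \<Rightarrow> vec3" and phi :: "vec3 \<Rightarrow> real"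
    and M0 M1 T cs Cs K :: real
  assumes B1_smooth: "smooth3 B1"
    and A1_smooth: "smooth3 A1"
    and B1_curl: "\<And>y. B1 y = curl A1 y"
    and B1_ge: "\<And>y. norm (B1 y) \<ge> 1"
    and phi_smooth: "smooth3 phi"
    and phi_bdd: "bdd_below (range phi)"
    and T_pos: "T > 0" and cs_pos: "cs > 0" and Cs_pos: "Cs > 0"
  shows "\<exists>C. \<forall>\<epsilon> h x x' xs vs.
     (let B = (\<lambda>y. (1/\<epsilon>) *\<^sub>R B1 y);
          E = (\<lambda>y. - grad phi y);
          mu0 = magmom B (x 0) (x' 0) in
       0 < \<epsilon> \<and> \<epsilon> < 1 \<and> 0 < h \<and> cs * \<epsilon> \<le> h\<^sup>2 \<and> h\<^sup>2 \<le> Cs * \<epsilon> \<and>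
       \<comment> \<open>exact solution on [0,T]\<close>
       (\<forall>t\<in>{0..T}. (x has_vector_derivative x' t) (at t within {0..T}) \<and>
          (x' has_vector_derivative (cross3 (x' t) (B (x t)) + E (x t))) (at t within {0..T})) \<and>
       norm (x 0) \<le> M0 \<and> norm (x' 0) \<le> M1 \<and>
       \<comment> \<open>modified Boris method\<close>
       xs 0 = x 0 \<and> vs 0 = Ppar B (xs 0) (x' 0) \<and>
       xs 1 = xs 0 + h *\<^sub>R vs 0 + (h\<^sup>2 / 2) *\<^sub>R
              (cross3 (vs 0) (B (xs 0)) + E (xs 0) - mu0 *\<^sub>R grad (\<lambda>y. norm (B y)) (xs 0)) \<and>
       (\<forall>n\<ge>1. vs n = (1 / (2*h)) *\<^sub>R (xs (n+1) - xs (n-1))) \<and>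
       (\<forall>n\<ge>1. (1 / h\<^sup>2) *\<^sub>R (xs (n+1) - 2 *\<^sub>R xs n + xs (n-1)) =
           cross3 (vs n) (B (xs n)) + E (xs n) - mu0 *\<^sub>R grad (\<lambda>y. norm (B y)) (xs n)) \<and>
       \<comment> \<open>nondegeneracy condition\<close>
       (\<forall>n. real n * h \<le> T \<longrightarrow>
          (let S = range (Pperp B (xs n));
               L = (\<lambda>z. z + (h\<^sup>2 / 4) *\<^sub>R Pperp B (xs n) (cross3 (vs n) (jac B (xs n) z))) in
           bij_betw L S S \<and> (\<forall>w\<in>S. norm (inv_into S L w) \<le> K * norm w)))
     \<longrightarrow>
       (\<forall>n. real n * h \<le> T \<longrightarrow>
          norm (xs n - x (real n * h)) \<le> C * h\<^sup>2 \<and>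
          norm (Ppar B (xs n) (vs n) - Ppar B (x (real n * h)) (x' (real n * h))) \<le> C * h\<^sup>2 \<and>
          norm (Pperp B (xs n) (vs n)) \<le> C * h\<^sup>2))"
proof -
  \<comment> \<open>The locale is instantiated with \<open>B1\<close>, so \<open>C\<close> is
    obtained before \<open>\<epsilon>\<close>, \<open>h\<close> and the solutions are fixed.\<close>
  interpret charged_particle B1 phi
    using B1_smooth phi_smooth B1_ge phi_bdd divg_curl[OF A1_smooth B1_smooth B1_curl]
    by unfold_locales
  have T: "T \<ge> 0" using T_pos by simp
  obtain C where C: "\<And>e h x v X V A n. 0 < e \<Longrightarrow> e < 1 \<Longrightarrow> 0 < h \<Longrightarrow>
    cs * e \<le> h\<^sup>2 \<Longrightarrow> h\<^sup>2 \<le> Cs * e \<Longrightarrow> motion e T x v \<Longrightarrow> norm (x 0) \<le> M0 \<Longrightarrow> norm (v 0) \<le> M1 \<Longrightarrow>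
    boris e h (moment (x 0) (v 0)) X V A \<Longrightarrow> X 0 = x 0 \<Longrightarrow> V 0 = par (x 0) (v 0) *\<^sub>R b (x 0) \<Longrightarrow>
    real n * h \<le> T \<Longrightarrow>
    norm (X n - x (real n * h)) \<le> C * h\<^sup>2 \<and>
    norm (par (X n) (V n) *\<^sub>R b (X n) - par (x (real n * h)) (v (real n * h)) *\<^sub>R b (x (real n * h))) \<le> C * h\<^sup>2 \<and>
    norm (perp (X n) (V n)) \<le> C * h\<^sup>2"
    using boris_convergence[OF cs_pos Cs_pos T, of M0 M1] by metis
  show ?thesis
    unfolding Let_def
  proof (rule exI[of _ C], intro allI impI, elim conjE)
    fix \<epsilon> h :: real and x x' :: "real \<Rightarrow> vec3" and xs vs :: "nat \<Rightarrow> vec3" and n :: nat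
    let ?B = "\<lambda>y. (1/\<epsilon>) *\<^sub>R B1 y"
    assume e: "0 < \<epsilon>" "\<epsilon> < 1" and h: "0 < h" and he: "cs * \<epsilon> \<le> h\<^sup>2" "h\<^sup>2 \<le> Cs * \<epsilon>"
      and sol: "\<forall>t\<in>{0..T}. (x has_vector_derivative x' t) (at t within {0..T}) \<and>
          (x' has_vector_derivative (cross3 (x' t) (?B (x t)) + - grad phi (x t))) (at t within {0..T})"
      and ini: "norm (x 0) \<le> M0" "norm (x' 0) \<le> M1"
      and xs0: "xs 0 = x 0" and vs0: "vs 0 = Ppar ?B (xs 0) (x' 0)"
      and xs1: "xs 1 = xs 0 + h *\<^sub>R vs 0 + (h\<^sup>2 / 2) *\<^sub>R
              (cross3 (vs 0) (?B (xs 0)) + - grad phi (xs 0) - magmom ?B (x 0) (x' 0) *\<^sub>R grad (\<lambda>y. norm (?B y)) (xs 0))"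
      and vs: "\<forall>n\<ge>1. vs n = (1 / (2*h)) *\<^sub>R (xs (n+1) - xs (n-1))"
      and xs: "\<forall>n\<ge>1. (1 / h\<^sup>2) *\<^sub>R (xs (n+1) - 2 *\<^sub>R xs n + xs (n-1)) =
           cross3 (vs n) (?B (xs n)) + - grad phi (xs n) - magmom ?B (x 0) (x' 0) *\<^sub>R grad (\<lambda>y. norm (?B y)) (xs n)"
      and nT: "real n * h \<le> T"
    define m where "m = moment (x 0) (x' 0)"
    define A where "A n = (1/\<epsilon>) *\<^sub>R cross3 (vs n) (B1 (xs n)) + force m (xs n)" for n
    \<comment> \<open>The factor \<open>\<epsilon>\<close> of the magnetic moment and
      \<open>1/\<epsilon>\<close> of the gradient cancel, which leaves \<open>force m\<close> with
      the rescaled moment.\<close>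
    have rhs: "cross3 (vs n) (?B (xs n)) + - grad phi (xs n)
        - magmom ?B (x 0) (x' 0) *\<^sub>R grad (\<lambda>y. norm (?B y)) (xs n) = A n" for n
      unfolding magmom_scaled[OF e(1)] grad_norm_scaled[OF e(1)]
      using e by (simp add: A_def m_def force_def E_def cross_mult_right)
    have bo: "boris \<epsilon> h m xs vs A"
    proof (rule two_step_imp_boris[OF h A_def])
      show "xs 1 = xs 0 + h *\<^sub>R vs 0 + (h\<^sup>2/2) *\<^sub>R A 0" using xs1 unfolding rhs .
      show "vs n = (1 / (2*h)) *\<^sub>R (xs (n+1) - xs (n-1))" if "n \<ge> 1" for n using vs that by blast
      show "(1/h\<^sup>2) *\<^sub>R (xs (n+1) - 2 *\<^sub>R xs n + xs (n-1)) = A n" if "n \<ge> 1" for n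
        using xs that unfolding rhs by blast
    qed
    have mo: "motion \<epsilon> T x x'"
      using sol by (simp add: motion_def E_def cross_mult_right)
    have vs0': "vs 0 = par (x 0) (x' 0) *\<^sub>R b (x 0)" using vs0 by (simp only: Ppar_scaled[OF e(1)] xs0)
    show "norm (xs n - x (real n * h)) \<le> C * h\<^sup>2 \<and>
        norm (Ppar ?B (xs n) (vs n) - Ppar ?B (x (real n * h)) (x' (real n * h))) \<le> C * h\<^sup>2 \<and>
        norm (Pperp ?B (xs n) (vs n)) \<le> C * h\<^sup>2"
      unfolding Ppar_scaled[OF e(1)] Pperp_scaled[OF e(1)]
      by (rule C[OF e h he mo ini bo[unfolded m_def] xs0 vs0' nT])
  qed
qed

end
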